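(* Let $T>0$, $b\in\mathbb{R}$, and let $W^{\rm av}$, $W^{\rm ir}$, $W^{\rm st}$ be the anticipative version, the integral representation and the space-time transform of the Wiener bridge from $0$ to $b$ over the time-interval $[0,T]$, all constructed from the same standard Wiener process $W$. Then for all $t\in[0,T)$ and $d\in\mathbb{R}$, $$\mathbb{E}\left((W_t-W_t^{\rm av})^2\,\big|\,W_T=d\right)=(d-b)^2\frac{t^2}{T^2},$$ $$\mathbb{E}\left((W_t-W_t^{\rm ir})^2\,\big|\,W_T=d\right)=2t\frac{T-t}{T}+2\frac{(T-t)^2}{T}\log\frac{T-t}{T}-\frac{(T-t)^2}{T}\left(\log\frac{T-t}{T}\right)^2+\left((d-b)\frac{t}{T}+d\,\frac{T-t}{T}\log\frac{T-t}{T}\right)^2,$$ $$\mathbb{E}\left((W_t-W_t^{\rm st})^2\,\big|\,W_T=d\right)=\frac{t^2}{T}-\frac{(2t-T)^2}{T}1_{[\frac{T}{2},T)}(t)+\left(b\frac{t}{T}-d\,\frac{2t-T}{T}1_{[\frac{T}{2},T)}(t)\right)^2.$$ Moreover, for all $d\in\mathbb{R}$, $$\mathbb{E}\left(\int_0^T(W_t-W_t^{\rm av})^2\,\mathrm{d}t\,\bigg|\,W_T=d\right)=\frac13(d-b)^2T,$$ $$\mathbb{E}\left(\int_0^T(W_t-W_t^{\rm ir})^2\,\mathrm{d}t\,\bigg|\,W_T=d\right)=\frac{7}{54}(b-d)^2T+\frac{11}{54}b^2T-\frac{7}{54}dbT+\frac{1}{27}T^2,$$ $$\mathbb{E}\left(\int_0^T(W_t-W_t^{\rm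 st})^2\,\mathrm{d}t\,\bigg|\,W_T=d\right)=\frac16(d-b)^2T+\frac16b^2T-\frac{1}{12}dbT+\frac16T^2.$$
   Context: $(W_t)_{t\ge 0}$ is a standard one-dimensional Wiener process. For $T>0$ and $b\in\mathbb{R}$, the following three versions of the Wiener bridge from $0$ to $b$ over $[0,T]$ are considered, all built from this same $W$: Anticipative version: $W_t^{\rm av}=b\frac{t}{T}+\left(W_t-\frac{t}{T}W_T\right)$ for $0\le t\le T$. Integral representation: $W_t^{\rm ir}=b\frac{t}{T}+\int_0^t\frac{T-t}{T-s}\,\mathrm{d}W_s$ for $0\le t<T$, and $W_T^{\rm ir}=b$. Space-time transform: $W_t^{\rm st}=b\frac{t}{T}+\frac{T-t}{T}W_{\frac{tT}{T-t}}$ for $0\le t<T$, and $W_T^{\rm st}=b$. Conditional expectations given $W_T=d$ are taken under the usual (Gaussian) regular conditional distribution of $W$ together with its bridge version given $W_T$, i.e. the version depending weakly continuously on $d\in\mathbb{R}$. $1_A$ denotes the indicator function of $A$. *)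

theory Defs
  imports "HOL-Probability.Probability"
begin

section \<open>The Wiener process\<close>

text \<open>Processes are families indexed by all reals; only times \<open>t \<ge> 0\<close> are constrained or used.\<close>

locale wiener_process = prob_space M for M :: "'a measure" +
  fixes W :: "real \<Rightarrow> 'a \<Rightarrow> real"
  assumes W_measurable: "\<And>t. 0 \<le> t \<Longrightarrow> W t \<in> borel_measurable M"
    and W_zero: "AE \<omega> in M. W 0 \<omega> = 0"
    and W_increment: "\<And>s t. 0 \<le> s \<Longrightarrow> s < t \<Longrightarrow>
      distributed M lborel (\<lambda>\<omega>. W t \<omega> - W s \<omega>) (normal_density 0 (sqrt (t - s)))"
    and W_indep_increments: "\<And>(n :: nat) (p :: nat \<Rightarrow> real).
      0 \<le> p 0 \<Longrightarrow> (\<forall>i<n. p i < p (Suc i)) \<Longrightarrow>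
      indep_vars (\<lambda>_. borel) (\<lambda>i \<omega>. W (p (Suc i)) \<omega> - W (p i) \<omega>) {..<n}"
    and W_continuous: "AE \<omega> in M. continuous_on {0..} (\<lambda>t. W t \<omega>)"

section \<open>The stochastic integral of a deterministic integrand\<close>

definition step_fun :: "nat \<Rightarrow> (nat \<Rightarrow> real) \<Rightarrow> (nat \<Rightarrow> real) \<Rightarrow> real \<Rightarrow> real" where
  "step_fun n p c s = (\<Sum>i<n. c i * indicator {p i<..p (Suc i)} s)"

definition step_integral ::
    "(real \<Rightarrow> 'a \<Rightarrow> real) \<Rightarrow> nat \<Rightarrow> (nat \<Rightarrow> real) \<Rightarrow> (nat \<Rightarrow> real) \<Rightarrow> 'a \<Rightarrow> real" where
  "step_integral W n p c \<omega> = (\<Sum>i<n. c i * (W (p (Suc i)) \<omega> - W (p i) \<omega>))"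

text \<open>
  \<open>I\<close> is a version of the integral of \<open>f\<close> against \<open>dW\<close> over \<open>[a, b]\<close>: the limit in
  \<open>L\<^sup>2(M)\<close> of the integrals of step functions that converge to \<open>f\<close> in \<open>L\<^sup>2([a, b])\<close>.
  The squared distances are \<open>ennreal\<close>-valued, so that an infinite distance is not read as 0.
\<close>

definition has_wiener_integral ::
    "'a measure \<Rightarrow> (real \<Rightarrow> 'a \<Rightarrow> real) \<Rightarrow> (real \<Rightarrow> real) \<Rightarrow> real \<Rightarrow> real \<Rightarrow> ('a \<Rightarrow> real) \<Rightarrow> bool" where
  "has_wiener_integral M W f a b I \<longleftrightarrow>
     set_borel_measurable lborel {a..b} f \<and>
     I \<in> borel_measurable M \<and>
     (\<exists>(n :: nat \<Rightarrow> nat) (p :: nat \<Rightarrow> nat \<Rightarrow> real) (c :: nat \<Rightarrow> nat \<Rightarrow> real).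
        (\<forall>k. p k 0 = a \<and> p k (n k) = b \<and> (\<forall>i<n k. p k i \<le> p k (Suc i))) \<and>
        ((\<lambda>k. \<integral>\<^sup>+s\<in>{a..b}. ennreal ((step_fun (n k) (p k) (c k) s - f s)\<^sup>2) \<partial>lborel)
           \<longlonglongrightarrow> 0) \<and>
        ((\<lambda>k. \<integral>\<^sup>+\<omega>. ennreal ((step_integral W (n k) (p k) (c k) \<omega> - I \<omega>)\<^sup>2) \<partial>M)
           \<longlonglongrightarrow> 0))"

section \<open>The three versions of the Wiener bridge from 0 to b over [0, T]\<close>

definition bridge_av :: "(real \<Rightarrow> 'a \<Rightarrow> real) \<Rightarrow> real \<Rightarrow> real \<Rightarrow> real \<Rightarrow> 'a \<Rightarrow> real" where
  "bridge_av W T b t \<omega> = b * (t / T) + (W t \<omega> - t / T * W T \<omega>)"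

text \<open>
  The stochastic integral is determined only up to a null set for each \<open>t\<close>; as usual a version
  with almost surely continuous paths on \<open>[0, T)\<close> is meant. Continuity at \<open>T\<close> is not part of the
  definition.
\<close>

definition is_bridge_ir ::
    "'a measure \<Rightarrow> (real \<Rightarrow> 'a \<Rightarrow> real) \<Rightarrow> real \<Rightarrow> real \<Rightarrow> (real \<Rightarrow> 'a \<Rightarrow> real) \<Rightarrow> bool" where
  "is_bridge_ir M W T b B \<longleftrightarrow>
     (\<forall>t\<in>{0..<T}. \<exists>I. has_wiener_integral M W (\<lambda>s. (T - t) / (T - s)) 0 t I \<and>
        (\<forall>\<omega>\<in>space M. B t \<omega> = b * (t / T) + I \<omega>)) \<and>
     (\<forall>\<omega>\<in>space M. B T \<omega> = b) \<and>
     (AE \<omega> in M. continuous_on {0..<T} (\<lambda>t. B t \<omega>))"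

definition bridge_st :: "(real \<Rightarrow> 'a \<Rightarrow> real) \<Rightarrow> real \<Rightarrow> real \<Rightarrow> real \<Rightarrow> 'a \<Rightarrow> real" where
  "bridge_st W T b t \<omega> =
     (if t < T then b * (t / T) + (T - t) / T * W (t * T / (T - t)) \<omega> else b)"

section \<open>Path space\<close>

text \<open>
  \<open>C([0, T]; \<real>\<^sup>2)\<close> is represented inside the metric space of bounded continuous functions on the
  line (supremum distance): a path on \<open>[0, T]\<close> is extended by its endpoint values. On the null set
  where the paths are not continuous on \<open>[0, T]\<close>, the zero path is used.
\<close>

definition path_of :: "real \<Rightarrow> (real \<Rightarrow> real \<times> real) \<Rightarrow> (real \<Rightarrow>\<^sub>C (real \<times> real))" where
  "path_of T f = (if continuous_on {0..T} f then Bcontfun (ext_cont f 0 T) else 0)"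

lemma apply_path_of:
  assumes "continuous_on {0..T} f" "t \<in> {0..T}"
  shows "apply_bcontfun (path_of T f) t = f t"
proof -
  have "continuous_on UNIV (ext_cont f 0 T)"
    using assms(1) by (intro continuous_on_ext_cont) simp
  moreover have "bounded (range (ext_cont f 0 T))"
    unfolding ext_cont_def
    using compact_imp_bounded[OF compact_continuous_image[OF assms(1)]]
    by (intro clamp_bounded) simp
  ultimately show ?thesis
    using assms by (simp add: path_of_def Bcontfun_inverse bcontfun_def)
qed

definition joint_path ::
    "real \<Rightarrow> (real \<Rightarrow> 'a \<Rightarrow> real) \<Rightarrow> (real \<Rightarrow> 'a \<Rightarrow> real) \<Rightarrow> 'a \<Rightarrow> (real \<Rightarrow>\<^sub>C (real \<times> real))" where
  "joint_path T W B \<omega> = path_of T (\<lambda>t. (W t \<omega>, B t \<omega>))"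

section \<open>Conditional expectation given the value of a random variable\<close>

text \<open>
  \<open>K\<close> is a regular conditional distribution of the random element \<open>X\<close> given \<open>Z\<close> for which
  \<open>K d\<close> depends weakly continuously on \<open>d\<close>.
\<close>

definition is_continuous_cond_distr ::
    "'a measure \<Rightarrow> ('a \<Rightarrow> 'b :: metric_space) \<Rightarrow> ('a \<Rightarrow> real) \<Rightarrow> (real \<Rightarrow> 'b measure) \<Rightarrow> bool" where
  "is_continuous_cond_distr M X Z K \<longleftrightarrow>
     X \<in> M \<rightarrow>\<^sub>M borel \<and> Z \<in> borel_measurable M \<and>
     K \<in> borel \<rightarrow>\<^sub>M prob_algebra borel \<and>
     (\<forall>A\<in>sets borel. \<forall>C\<in>sets borel.
        measure M {\<omega> \<in> space M. X \<omega> \<in> A \<and> Z \<omega> \<in> C} =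
        (LINT d:C|distr M borel Z. measure (K d) A)) \<and>
     (\<forall>F :: 'b \<Rightarrow>\<^sub>C real.
        continuous_on UNIV (\<lambda>d. integral\<^sup>L (K d) (apply_bcontfun F)))"

definition cond_distr ::
    "'a measure \<Rightarrow> ('a \<Rightarrow> 'b :: metric_space) \<Rightarrow> ('a \<Rightarrow> real) \<Rightarrow> real \<Rightarrow> 'b measure" where
  "cond_distr M X Z = (THE K. is_continuous_cond_distr M X Z K)"

text \<open>
  \<open>has_cond_expectation M T W B F d v\<close>: the conditional expectation of the path functional
  \<open>F W B\<close> given \<open>W\<^sub>T = d\<close> exists and equals \<open>v\<close>. The completion of \<open>M\<close> is used because
  the paths of \<open>W\<close> and \<open>B\<close> are continuous only up to a null set that need not be in \<open>sets M\<close>.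
\<close>

definition has_cond_expectation ::
    "'a measure \<Rightarrow> real \<Rightarrow> (real \<Rightarrow> 'a \<Rightarrow> real) \<Rightarrow> (real \<Rightarrow> 'a \<Rightarrow> real) \<Rightarrow>
     ((real \<Rightarrow> real) \<Rightarrow> (real \<Rightarrow> real) \<Rightarrow> real) \<Rightarrow> real \<Rightarrow> real \<Rightarrow> bool" where
  "has_cond_expectation M T W B F d v \<longleftrightarrow>
     has_bochner_integral (cond_distr (completion M) (joint_path T W B) (W T) d)
       (\<lambda>x. F (\<lambda>t. fst (apply_bcontfun x t)) (\<lambda>t. snd (apply_bcontfun x t))) v"

end

theory Submission
  imports Defs
begin

text \<open>
  Put \<open>V\<^sub>r = W\<^sub>r - (min r T / T) W\<^sub>T\<close> for \<open>r \<ge> 0\<close>: up to time \<open>T\<close> this is the Wiener bridge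
  from 0 to 0, and after time \<open>T\<close> it is the increment \<open>W\<^sub>r - W\<^sub>T\<close>. The family \<open>V\<close> is independent of
  \<open>W\<^sub>T\<close>. Each of the three bridges \<open>B\<close> is an affine functional of the path of \<open>W\<close>, so that almost
  surely, for all \<open>t \<in> [0, T]\<close> at once,
  \<open>(W\<^sub>t, B\<^sub>t) = (V\<^sub>t, y\<^sub>t) + W\<^sub>T (t / T, h\<^sub>t)\<close>,
  where the path \<open>y\<close> is a functional of \<open>V\<close> and \<open>h\<close> is a deterministic continuous function. Hence
  the law of the random path \<open>(V, y) + d (t / T, h)\<close> is a regular conditional distribution
  given \<open>W\<^sub>T = d\<close>. It depends weakly continuously on \<open>d\<close>, and no other version does, because
  every interval has positive probability under the law of \<open>W\<^sub>T\<close>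
  (\<open>cond_distr_independent_shift\<close>, \<open>has_cond_expectation_regression\<close>).

  The conditional second moment of the error is therefore an ordinary second moment:
  \<open>V\<^sub>t + d t / T - y\<^sub>t - d h\<^sub>t = G\<^sub>t + m\<^sub>t\<close> with \<open>G\<^sub>t\<close> centred and linear in \<open>V\<close>, and \<open>m\<^sub>t\<close> a number,
  which gives \<open>E G\<^sub>t\<^sup>2 + m\<^sub>t\<^sup>2\<close>. The integrated errors follow from Fubini's theorem and antiderivatives.
  The decompositions are these.

  \<^item> Anticipative version: \<open>y\<^sub>t = V\<^sub>t + b t / T\<close> and \<open>h = 0\<close>, so \<open>G = 0\<close>.

  \<^item> Space-time transform: \<open>y\<^sub>t = ((T - t) / T) V\<^sub>r + b t / T\<close> with \<open>r = t T / (T - t)\<close>, and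
    \<open>h\<^sub>t = min t (T - t) / T\<close>. The two cases of the minimum, \<open>r \<le> T\<close> and \<open>r \<ge> T\<close>, are the source of
    the indicator of \<open>[T/2, T)\<close>. The path is continuous at \<open>T\<close> by the law of large numbers \<open>W\<^sub>u / u \<rightarrow> 0\<close>
    (\<open>strong_law\<close>).

  \<^item> Integral representation: integration by parts replaces the stochastic integral by
    \<open>W\<^sub>t - (T - t) \<integral>\<^sub>0\<^sup>t W\<^sub>s / (T - s)\<^sup>2 ds\<close> (\<open>wiener_integral_by_parts\<close>), which is a pathwise
    linear operator applied to \<open>W\<close>. This operator sends continuous paths to
    paths that tend to 0 at \<open>T\<close> (\<open>bridge_op_continuous_on\<close>). Here \<open>y - b t / T\<close> and \<open>h\<close> are its values
    at \<open>V\<close> and at \<open>s / T\<close>; the latter is \<open>h\<^sub>t = - ((T - t) / T) ln ((T - t) / T)\<close>, the source of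
    the logarithms.

  The independence of \<open>V\<close> and \<open>W\<^sub>T\<close> rests on a single fact about two variables: if \<open>X\<close> and \<open>Y\<close> are
  independent centred normal variables with variances \<open>s\<close> and \<open>r\<close>, then \<open>X + Y\<close> is independent of
  \<open>X / s - (X + Y) / (s + r)\<close> (\<open>indep_var_normal_sum_difference\<close>). Applied along a time grid, it
  exchanges one increment after the other for such a difference
  (\<open>indep_vars_bridge_increments\<close>).
\<close>

section \<open>Random paths\<close>

lemma ext_cont_bcontfun:
  fixes f :: "real \<Rightarrow> 'b::metric_space"
  assumes "continuous_on {0..T} f"
  shows "ext_cont f 0 T \<in> bcontfun"
proof -
  have "continuous_on UNIV (ext_cont f 0 T)"
    using assms by (intro continuous_on_ext_cont) simp
  moreover have "bounded (range (ext_cont f 0 T))"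
    unfolding ext_cont_def
    using compact_imp_bounded[OF compact_continuous_image[OF assms]]
    by (intro clamp_bounded) simp
  ultimately show ?thesis by (simp add: bcontfun_def)
qed

lemma apply_path_of_clamp:
  assumes "continuous_on {0..T} f"
  shows "apply_bcontfun (path_of T f) t = f (clamp 0 T t)"
  using ext_cont_bcontfun[OF assms]
  by (simp add: path_of_def Bcontfun_inverse assms ext_cont_def)

lemma clamp_mem_interval:
  fixes T :: real assumes "0 < T" shows "clamp 0 T t \<in> {0..T}"
  using clamp_in_interval[of 0 T t] assms by simp

lemma path_of_add_scaleR:
  assumes f: "continuous_on {0..T} f" and g: "continuous_on {0..T} g"
  shows "path_of T (\<lambda>t. f t + c *\<^sub>R g t) = path_of T f + c *\<^sub>R path_of T g"
proof (rule bcontfun_eqI)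
  fix t
  have "continuous_on {0..T} (\<lambda>t. f t + c *\<^sub>R g t)"
    using f g by (intro continuous_intros)
  thus "apply_bcontfun (path_of T (\<lambda>t. f t + c *\<^sub>R g t)) t = apply_bcontfun (path_of T f + c *\<^sub>R path_of T g) t"
    using f g by (simp add: apply_path_of_clamp)
qed

lemma path_of_cong:
  assumes "0 < T" "\<And>t. t \<in> {0..T} \<Longrightarrow> f t = g t"
  shows "path_of T f = path_of T g"
proof -
  have "continuous_on {0..T} f = continuous_on {0..T} g"
    using assms by (intro continuous_on_cong) auto
  moreover have "ext_cont f 0 T = ext_cont g 0 T"
    using assms clamp_mem_interval[of T] by (auto simp: ext_cont_def fun_eq_iff)
  ultimately show ?thesis by (simp add: path_of_def)
qed

text \<open>
  For a fixed profile \<open>u\<close> the path depends on the vector \<open>v\<close> in a Lipschitz way, hence continuously;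
  this makes finite combinations of profiles with random coefficients measurable.
\<close>

lemma continuous_on_scaled_profile:
  fixes u :: "real \<Rightarrow> real"
  assumes "continuous_on {0..T} u" "0 < T"
  shows "continuous_on UNIV (\<lambda>v :: real \<times> real. path_of T (\<lambda>t. u t *\<^sub>R v))"
proof -
  have c: "continuous_on {0..T} (\<lambda>t. u t *\<^sub>R v)" for v :: "real \<times> real"
    using assms by (intro continuous_intros)
  have "bounded (u ` {0..T})"
    by (intro compact_imp_bounded compact_continuous_image assms) simp
  then obtain C where C: "0 < C" "\<And>t. t \<in> {0..T} \<Longrightarrow> \<bar>u t\<bar> \<le> C"
    by (auto simp: bounded_pos)
  have "dist (path_of T (\<lambda>t. u t *\<^sub>R v)) (path_of T (\<lambda>t. u t *\<^sub>R w)) \<le> C * dist v w" for v w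
  proof (rule dist_bound)
    fix t
    have "dist (u (clamp 0 T t) *\<^sub>R v) (u (clamp 0 T t) *\<^sub>R w) = \<bar>u (clamp 0 T t)\<bar> * dist v w"
      by (simp add: dist_norm scaleR_diff_right[symmetric])
    also have "\<dots> \<le> C * dist v w"
      using C(2)[OF clamp_mem_interval[OF assms(2)]] by (intro mult_right_mono) auto
    finally show "dist (apply_bcontfun (path_of T (\<lambda>t. u t *\<^sub>R v)) t) (apply_bcontfun (path_of T (\<lambda>t. u t *\<^sub>R w)) t)
          \<le> C * dist v w"
      by (simp add: apply_path_of_clamp[OF c])
  qed
  hence "C-lipschitz_on UNIV (\<lambda>v. path_of T (\<lambda>t. u t *\<^sub>R v))"
    using C by (intro lipschitz_onI) auto
  thus ?thesis by (rule lipschitz_on_continuous_on)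
qed

text \<open>
  Uniform approximation by Bernstein polynomials: the values of \<open>f\<close> on a finite grid determine
  approximating paths, which converge in the supremum distance.
\<close>

lemma Bernstein_tendsto_path_of:
  fixes f :: "real \<Rightarrow> real \<times> real"
  assumes T: "0 < T" and f: "continuous_on {0..T} f"
  shows "(\<lambda>n. \<Sum>k\<le>n. path_of T (\<lambda>t. Bernstein n k (t / T) *\<^sub>R f (T * (k / n)))) \<longlonglongrightarrow> path_of T f"
    (is "?S \<longlonglongrightarrow> _")
proof (rule uniform_limit_tendsto_bcontfun, rule uniform_limitI)
  fix e :: real assume e: "0 < e"
  have cB: "continuous_on {0..T} (\<lambda>t. Bernstein n k (t / T) *\<^sub>R v)" for n k and v :: "real \<times> real"
    unfolding Bernstein_def using T by (intro continuous_intros) auto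
  have c: "continuous_on {0..1} (\<lambda>x. f (T * x))"
    by (rule continuous_on_compose2[OF f]) (use T in \<open>auto intro!: continuous_intros simp: mult_left_le\<close>)
  have c1: "continuous_on {0..1} (\<lambda>x. fst (f (T * x)))" and c2: "continuous_on {0..1} (\<lambda>x. snd (f (T * x)))"
    using c by (auto intro!: continuous_intros)
  obtain N1 where N1: "\<And>n x. N1 \<le> n \<Longrightarrow> x \<in> {0..1} \<Longrightarrow>
      \<bar>fst (f (T * x)) - (\<Sum>k\<le>n. fst (f (T * (k/n))) * Bernstein n k x)\<bar> < e / 2"
    using Bernstein_Weierstrass[OF c1, of "e/2"] e by auto
  obtain N2 where N2: "\<And>n x. N2 \<le> n \<Longrightarrow> x \<in> {0..1} \<Longrightarrow>
      \<bar>snd (f (T * x)) - (\<Sum>k\<le>n. snd (f (T * (k/n))) * Bernstein n k x)\<bar> < e / 2"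
    using Bernstein_Weierstrass[OF c2, of "e/2"] e by auto
  have "dist (apply_bcontfun (?S n) s) (apply_bcontfun (path_of T f) s) < e"
    if n: "max N1 N2 \<le> n" for n s
  proof -
    define x where "x = clamp 0 T s / T"
    have x: "x \<in> {0..1}" "T * x = clamp 0 T s"
      using clamp_mem_interval[OF T, of s] T by (auto simp: x_def divide_simps)
    have app: "apply_bcontfun (\<Sum>k\<in>A. g k) s = (\<Sum>k\<in>A. apply_bcontfun (g k) s)"
      for A :: "nat set" and g :: "nat \<Rightarrow> (real \<Rightarrow>\<^sub>C (real \<times> real))"
      by (induction A rule: infinite_finite_induct) auto
    have eq: "apply_bcontfun (?S n) s
       = (\<Sum>k\<le>n. Bernstein n k x *\<^sub>R f (T * (k / n)))"
      by (simp add: app apply_path_of_clamp[OF cB] x_def)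
    have "dist (\<Sum>k\<le>n. Bernstein n k x *\<^sub>R f (T * (k / n))) (f (T * x))
       \<le> \<bar>fst (f (T * x)) - (\<Sum>k\<le>n. fst (f (T * (k/n))) * Bernstein n k x)\<bar>
        + \<bar>snd (f (T * x)) - (\<Sum>k\<le>n. snd (f (T * (k/n))) * Bernstein n k x)\<bar>"
      unfolding dist_prod_def
      by (rule order.trans[OF sqrt_sum_squares_le_sum_abs])
         (simp add: fst_sum snd_sum dist_real_def mult.commute abs_minus_commute)
    also have "\<dots> < e"
      using N1[of n x] N2[of n x] n x by auto
    finally show ?thesis unfolding eq apply_path_of_clamp[OF f] x(2) .
  qed
  hence "\<forall>\<^sub>F n in sequentially. \<forall>s. dist (apply_bcontfun (?S n) s) (apply_bcontfun (path_of T f) s) < e"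
    by (intro eventually_sequentiallyI[of "max N1 N2"]) blast
  thus "\<forall>\<^sub>F n in sequentially. \<forall>s\<in>UNIV. dist (apply_bcontfun (?S n) s) (apply_bcontfun (path_of T f) s) < e"
    by simp
qed

text \<open>
  The space of bounded continuous functions on the line is not separable, so measurability for its
  Borel sets does not follow from the coordinates alone. Here it holds because the path is a limit of
  Bernstein approximations, and each of these is a continuous function of finitely many coordinates.
\<close>

lemma measurable_path_of:
  fixes f :: "real \<Rightarrow> 'c \<Rightarrow> real \<times> real"
  assumes T: "0 < T" and m: "\<And>t. t \<in> {0..T} \<Longrightarrow> f t \<in> borel_measurable N"
    and c: "\<And>\<omega>. \<omega> \<in> space N \<Longrightarrow> continuous_on {0..T} (\<lambda>t. f t \<omega>)"
  shows "(\<lambda>\<omega>. path_of T (\<lambda>t. f t \<omega>)) \<in> borel_measurable N"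
proof (rule borel_measurable_LIMSEQ_metric)
  fix \<omega> assume "\<omega> \<in> space N"
  from Bernstein_tendsto_path_of[OF T c[OF this]]
  show "(\<lambda>n. \<Sum>k\<le>n. path_of T (\<lambda>t. Bernstein n k (t / T) *\<^sub>R f (T * (k / n)) \<omega>)) \<longlonglongrightarrow> path_of T (\<lambda>t. f t \<omega>)" .
next
  fix n :: nat
  define G where "G = (\<lambda>v :: nat \<Rightarrow> real \<times> real. \<Sum>k\<le>n. path_of T (\<lambda>t. Bernstein n k (t / T) *\<^sub>R v k))"
  have "continuous_on UNIV G"
    unfolding G_def
  proof (intro continuous_on_sum)
    fix k
    have "continuous_on {0..T} (\<lambda>t. Bernstein n k (t / T))"
      unfolding Bernstein_def using T by (intro continuous_intros) auto
    from continuous_on_compose2[OF continuous_on_scaled_profile[OF this T], of UNIV "\<lambda>v. v k"]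
    show "continuous_on UNIV (\<lambda>v. path_of T (\<lambda>t. Bernstein n k (t / T) *\<^sub>R v k))"
      by simp
  qed
  hence G: "G \<in> borel_measurable borel" by (rule borel_measurable_continuous_onI)
  have "(\<lambda>\<omega>. (\<lambda>k. if k \<le> n then f (T * (k / n)) \<omega> else 0)) \<in> borel_measurable N"
  proof (rule measurable_coordinatewise_then_product)
    fix k
    show "(\<lambda>\<omega>. if k \<le> n then f (T * (k / n)) \<omega> else 0) \<in> borel_measurable N"
      using m[of "T * (k / n)"] T by (cases "k \<le> n") (auto simp: divide_simps)
  qed
  from measurable_compose[OF this G]
  show "(\<lambda>\<omega>. \<Sum>k\<le>n. path_of T (\<lambda>t. Bernstein n k (t / T) *\<^sub>R f (T * (k / n)) \<omega>)) \<in> borel_measurable N"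
    by (simp add: G_def)
qed

lemma measurable_apply_bcontfun [measurable]:
  fixes t :: "'x :: topological_space"
  shows "(\<lambda>x :: 'x \<Rightarrow>\<^sub>C 'y :: metric_space. apply_bcontfun x t) \<in> borel_measurable borel"
proof (rule borel_measurable_continuous_onI)
  have "1-lipschitz_on UNIV (\<lambda>x :: 'x \<Rightarrow>\<^sub>C 'y. apply_bcontfun x t)"
    by (intro lipschitz_onI) (auto simp: dist_bounded)
  thus "continuous_on UNIV (\<lambda>x :: 'x \<Rightarrow>\<^sub>C 'y. apply_bcontfun x t)"
    by (rule lipschitz_on_continuous_on)
qed

text \<open>
  A process with continuous paths is the pointwise limit of its values at the grid points below
  \<open>t\<close>, and each approximation involves countably many times only.
\<close>

lemma borel_measurable_pair_continuous_paths:
  fixes f :: "real \<Rightarrow> 'c \<Rightarrow> 'b :: metric_space"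
  assumes m: "\<And>t. f t \<in> borel_measurable N"
    and c: "\<And>\<omega>. \<omega> \<in> space N \<Longrightarrow> continuous_on UNIV (\<lambda>t. f t \<omega>)"
  shows "(\<lambda>(\<omega>, t). f t \<omega>) \<in> borel_measurable (N \<Otimes>\<^sub>M borel)"
proof (rule borel_measurable_LIMSEQ_metric)
  fix n :: nat
  have "(\<lambda>z. f (of_int (snd z) / (real n + 1)) (fst z)) \<in> borel_measurable (N \<Otimes>\<^sub>M count_space UNIV)"
    by (rule measurable_compose_countable'[where I=UNIV and f="\<lambda>i z. f (of_int i / (real n + 1)) (fst z)" and g=snd])
       (auto intro!: measurable_compose[OF measurable_fst m])
  moreover have "(\<lambda>(\<omega>, t :: real). (\<omega>, \<lfloor>(real n + 1) * t\<rfloor>)) \<in> N \<Otimes>\<^sub>M borel \<rightarrow>\<^sub>M N \<Otimes>\<^sub>M count_space UNIV"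
    by measurable
  ultimately have "(\<lambda>z. (\<lambda>z. f (of_int (snd z) / (real n + 1)) (fst z)) ((\<lambda>(\<omega>, t :: real). (\<omega>, \<lfloor>(real n + 1) * t\<rfloor>)) z)) \<in> borel_measurable (N \<Otimes>\<^sub>M borel)"
    by (rule measurable_compose[rotated])
  thus "(\<lambda>(\<omega>, t). f (of_int \<lfloor>(real n + 1) * t\<rfloor> / (real n + 1)) \<omega>) \<in> borel_measurable (N \<Otimes>\<^sub>M borel)"
    by (simp add: case_prod_beta')
next
  fix z :: "'c \<times> real" assume "z \<in> space (N \<Otimes>\<^sub>M borel)"
  then obtain \<omega> t where z: "z = (\<omega>, t)" "\<omega> \<in> space N" by (auto simp: space_pair_measure)
  have "(\<lambda>n. of_int \<lfloor>(real n + 1) * t\<rfloor> / (real n + 1)) \<longlonglongrightarrow> t"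
  proof (rule tendsto_sandwich)
    have "t - 1 / (real n + 1) \<le> of_int \<lfloor>(real n + 1) * t\<rfloor> / (real n + 1)" for n
    proof -
      have "(real n + 1) * t - 1 \<le> of_int \<lfloor>(real n + 1) * t\<rfloor>" by linarith
      hence "((real n + 1) * t - 1) / (real n + 1) \<le> of_int \<lfloor>(real n + 1) * t\<rfloor> / (real n + 1)"
        by (intro divide_right_mono) auto
      thus ?thesis by (simp add: diff_divide_distrib)
    qed
    thus "\<forall>\<^sub>F n in sequentially. t - 1 / (real n + 1) \<le> of_int \<lfloor>(real n + 1) * t\<rfloor> / (real n + 1)"
      by simp
    have "of_int \<lfloor>(real n + 1) * t\<rfloor> / (real n + 1) \<le> t" for n
    proof -
      have "of_int \<lfloor>(real n + 1) * t\<rfloor> \<le> (real n + 1) * t" by linarith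
      thus ?thesis by (simp add: field_simps)
    qed
    thus "\<forall>\<^sub>F n in sequentially. of_int \<lfloor>(real n + 1) * t\<rfloor> / (real n + 1) \<le> t" by simp
    have "(\<lambda>n. t - 1 / real (Suc n)) \<longlonglongrightarrow> t - 0"
      by (intro tendsto_diff tendsto_const LIMSEQ_Suc lim_1_over_n)
    thus "(\<lambda>n. t - 1 / (real n + 1)) \<longlonglongrightarrow> t" by (simp add: add.commute)
  qed auto
  moreover have "isCont (\<lambda>t. f t \<omega>) t"
    using c[OF z(2)] by (simp add: continuous_on_eq_continuous_at)
  ultimately have "(\<lambda>n. f (of_int \<lfloor>(real n + 1) * t\<rfloor> / (real n + 1)) \<omega>) \<longlonglongrightarrow> f t \<omega>"
    by (rule isCont_tendsto_compose[rotated])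
  thus "(\<lambda>n. case z of (\<omega>, t) \<Rightarrow> f (of_int \<lfloor>(real n + 1) * t\<rfloor> / (real n + 1)) \<omega>) \<longlonglongrightarrow> (case z of (\<omega>, t) \<Rightarrow> f t \<omega>)"
    by (simp add: z)
qed

section \<open>Weakly continuous conditional distributions\<close>

text \<open>
  Stated for intervals, since these suffice to compare continuous functions of the value of \<open>Z\<close>.
\<close>

definition full_support :: "'a measure \<Rightarrow> ('a \<Rightarrow> real) \<Rightarrow> bool" where
  "full_support M Z \<longleftrightarrow> (\<forall>a b. a < b \<longrightarrow> 0 < measure M (Z -` {a<..<b} \<inter> space M))"

lemma AE_eq_imp_eq_if_full_support:
  fixes g g' :: "real \<Rightarrow> real"
  assumes "full_support M Z" "Z \<in> borel_measurable M"
    and g: "continuous_on UNIV g" "continuous_on UNIV g'"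
    and ae: "AE d in distr M borel Z. g d = g' d"
  shows "g d = g' d"
proof (rule ccontr)
  assume ne: "g d \<noteq> g' d"
  have "open {d. g d \<noteq> g' d}"
    using g by (intro open_Collect_neq) auto
  then obtain e where e: "0 < e" "ball d e \<subseteq> {d. g d \<noteq> g' d}"
    using ne by (auto simp: open_contains_ball)
  have sub: "x \<notin> {d - e<..<d + e}" if "g x = g' x" for x
    using e(2) that by (auto simp: ball_def dist_real_def subset_eq)
  have "AE x in distr M borel Z. x \<notin> {d - e<..<d + e}"
    using ae by eventually_elim (rule sub)
  hence "AE x in M. Z x \<notin> {d - e<..<d + e}"
    using assms(2) by (subst (asm) AE_distr_iff) auto
  hence "measure M (Z -` {d - e<..<d + e} \<inter> space M) = 0"
    using assms(2) by (intro measure_eq_0_null_sets)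
      (simp add: AE_iff_null_sets vimage_def Int_def conj_commute)
  moreover have "0 < measure M (Z -` {d - e<..<d + e} \<inter> space M)"
    using assms(1) e(1) by (auto simp: full_support_def)
  ultimately show False by simp
qed

text \<open>
  The defining identity of a conditional distribution concerns indicators. It says that mixing the
  kernel over \<open>{Z \<in> C}\<close> gives the law of \<open>X\<close> on that event, so it extends to all nonnegative
  functions.
\<close>

lemma (in prob_space) nn_integral_cond_distr:
  fixes X :: "'a \<Rightarrow> 'b :: metric_space"
  assumes K: "is_continuous_cond_distr M X Z K"
    and C: "C \<in> sets borel" and u: "u \<in> borel_measurable borel"
  shows "(\<integral>\<^sup>+d. (\<integral>\<^sup>+x. u x \<partial>K d) * indicator C d \<partial>distr M borel Z)
       = (\<integral>\<^sup>+\<omega>. u (X \<omega>) * indicator C (Z \<omega>) \<partial>M)"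
proof -
  have [measurable]: "X \<in> borel_measurable M" "Z \<in> borel_measurable M" "C \<in> sets borel"
    and K1: "K \<in> borel \<rightarrow>\<^sub>M prob_algebra borel"
    using K C by (auto simp: is_continuous_cond_distr_def)
  note [measurable] = measurable_prob_algebraD[OF K1] u
  let ?P = "distr M borel Z"
  interpret P: prob_space ?P by (intro prob_space_distr) simp
  have Kp: "prob_space (K d)" "sets (K d) = sets borel" for d
    using measurable_space[OF K1, of d] by (auto simp: space_prob_algebra)
  let ?D = "density M (\<lambda>\<omega>. indicator C (Z \<omega>))"
  let ?N = "density ?P (indicator C)"
  have KN: "K \<in> ?N \<rightarrow>\<^sub>M subprob_algebra borel" by simp
  have "bind ?N K = distr ?D borel X"
  proof (rule measure_eqI)
    show "sets (bind ?N K) = sets (distr ?D borel X)"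
      by (subst sets_bind[where N=borel]) (auto simp: Kp)
    fix A assume "A \<in> sets (bind ?N K)"
    hence A[measurable]: "A \<in> sets borel"
      by (subst (asm) sets_bind[where N=borel]) (auto simp: Kp)
    have em: "(\<lambda>d. emeasure (K d) A) \<in> borel_measurable borel"
      by measurable
    have mm: "(\<lambda>d. measure (K d) A) \<in> borel_measurable borel"
      unfolding measure_def using em by measurable
    have eK: "emeasure (K d) A = ennreal (measure (K d) A)" for d
      using Kp(1)[of d] by (simp add: prob_space_def finite_measure.emeasure_eq_measure)
    have le1: "measure (K d) A \<le> 1" for d
      using Kp(1)[of d] by (simp add: prob_space.prob_le_1)
    have int: "integrable ?P (\<lambda>d. indicator C d * measure (K d) A)"
      using le1 mm by (intro P.integrable_const_bound[of _ 1]) (auto simp: indicator_def)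
    have "emeasure (bind ?N K) A = (\<integral>\<^sup>+d. emeasure (K d) A \<partial>?N)"
      by (rule emeasure_bind[OF _ KN A]) simp
    also have "\<dots> = (\<integral>\<^sup>+d. indicator C d * emeasure (K d) A \<partial>?P)"
      using em by (intro nn_integral_density) auto
    also have "\<dots> = (\<integral>\<^sup>+d. ennreal (indicator C d * measure (K d) A) \<partial>?P)"
      by (intro nn_integral_cong) (auto simp: eK indicator_def)
    also have "\<dots> = ennreal (\<integral>d. indicator C d * measure (K d) A \<partial>?P)"
      by (intro nn_integral_eq_integral int) auto
    also have "(\<integral>d. indicator C d * measure (K d) A \<partial>?P) = measure M {\<omega> \<in> space M. X \<omega> \<in> A \<and> Z \<omega> \<in> C}"
      using K A C unfolding is_continuous_cond_distr_def set_lebesgue_integral_def by simp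
    also have "ennreal \<dots> = emeasure M {\<omega> \<in> space M. X \<omega> \<in> A \<and> Z \<omega> \<in> C}"
      by (simp add: emeasure_eq_measure)
    also have "\<dots> = (\<integral>\<^sup>+\<omega>. indicator {\<omega> \<in> space M. X \<omega> \<in> A \<and> Z \<omega> \<in> C} \<omega> \<partial>M)"
      by (subst nn_integral_indicator) auto
    also have "\<dots> = (\<integral>\<^sup>+\<omega>. indicator C (Z \<omega>) * indicator (X -` A \<inter> space M) \<omega> \<partial>M)"
      by (intro nn_integral_cong) (auto simp: indicator_def)
    also have "\<dots> = emeasure ?D (X -` A \<inter> space M)"
      by (subst emeasure_density) auto
    also have "\<dots> = emeasure (distr ?D borel X) A"
      by (subst emeasure_distr) auto
    finally show "emeasure (bind ?N K) A = emeasure (distr ?D borel X) A" .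
  qed
  hence "(\<integral>\<^sup>+x. u x \<partial>bind ?N K) = (\<integral>\<^sup>+x. u x \<partial>distr ?D borel X)" by simp
  also have "(\<integral>\<^sup>+x. u x \<partial>bind ?N K) = (\<integral>\<^sup>+d. (\<integral>\<^sup>+x. u x \<partial>K d) \<partial>?N)"
    by (rule nn_integral_bind[OF u KN])
  also have "\<dots> = (\<integral>\<^sup>+d. indicator C d * (\<integral>\<^sup>+x. u x \<partial>K d) \<partial>?P)"
    by (intro nn_integral_density) (auto intro: measurable_compose[OF _ nn_integral_measurable_subprob_algebra])
  also have "(\<integral>\<^sup>+x. u x \<partial>distr ?D borel X) = (\<integral>\<^sup>+\<omega>. u (X \<omega>) \<partial>?D)"
    by (intro nn_integral_distr) auto
  also have "\<dots> = (\<integral>\<^sup>+\<omega>. indicator C (Z \<omega>) * u (X \<omega>) \<partial>M)"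
    by (intro nn_integral_density) auto
  finally show ?thesis by (simp add: mult.commute)
qed

text \<open>
  Closed sets generate the Borel sets, and the indicator of a closed set is the decreasing limit of
  the continuous functions \<open>max 0 (1 - n dist(x, A))\<close>.
\<close>

lemma measure_eqI_bounded_continuous:
  fixes \<mu> \<nu> :: "'b :: metric_space measure"
  assumes "prob_space \<mu>" "prob_space \<nu>" and s: "sets \<mu> = sets borel" "sets \<nu> = sets borel"
    and eq: "\<And>F :: 'b \<Rightarrow>\<^sub>C real. (\<And>x. 0 \<le> apply_bcontfun F x \<and> apply_bcontfun F x \<le> 1) \<Longrightarrow>
      integral\<^sup>L \<mu> (apply_bcontfun F) = integral\<^sup>L \<nu> (apply_bcontfun F)"
  shows "\<mu> = \<nu>"
proof -
  interpret \<mu>: prob_space \<mu> by fact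
  interpret \<nu>: prob_space \<nu> by fact
  have meas: "measure \<mu> A = measure \<nu> A" if A: "closed A" "A \<noteq> {}" for A :: "'b set"
  proof -
    define f where "f = (\<lambda>n x. max 0 (1 - real n * infdist x A))"
    have fc: "continuous_on UNIV (f n)" for n
      unfolding f_def by (intro continuous_intros)
    have f01: "0 \<le> f n x" "f n x \<le> 1" for n x
      using infdist_nonneg[of x A] by (auto simp: f_def)
    have fb: "f n \<in> bcontfun" for n
      using fc f01 by (intro bcontfun_normI[of _ 1]) auto
    have lim: "(\<lambda>n. f n x) \<longlonglongrightarrow> indicator A x" for x
    proof (cases "x \<in> A")
      case True
      hence "infdist x A = 0" by simp
      thus ?thesis using True by (simp add: f_def)
    next
      case False
      hence pos: "infdist x A > 0"
        using A infdist_pos_not_in_closed by blast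
      obtain N :: nat where N: "1 / infdist x A < real N" using reals_Archimedean2 by blast
      have "f n x = 0" if "N \<le> n" for n
      proof -
        have "1 / infdist x A < real n" using N that by linarith
        hence "1 < real n * infdist x A" using pos by (simp add: field_simps)
        thus ?thesis by (simp add: f_def)
      qed
      hence "\<forall>\<^sub>F n in sequentially. f n x = 0" by (auto simp: eventually_sequentially)
      thus ?thesis using False by (simp add: tendsto_eventually)
    qed
    have conv: "(\<lambda>n. integral\<^sup>L \<rho> (f n)) \<longlonglongrightarrow> measure \<rho> A"
      if "prob_space \<rho>" "sets \<rho> = sets borel" for \<rho> :: "'b measure"
    proof -
      interpret \<rho>: prob_space \<rho> by fact
      note [measurable_cong] = that(2)
      have [measurable]: "f n \<in> borel_measurable borel" for n
        by (rule borel_measurable_continuous_onI) (rule fc)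
      have [measurable]: "A \<in> sets borel" using A by simp
      have "(\<lambda>n. integral\<^sup>L \<rho> (f n)) \<longlonglongrightarrow> integral\<^sup>L \<rho> (indicator A)"
        using f01 by (intro integral_dominated_convergence[where w="\<lambda>_. 1"] AE_I2 lim) auto
      thus ?thesis using that(2) by (simp add: sets_eq_imp_space_eq)
    qed
    have "integral\<^sup>L \<mu> (f n) = integral\<^sup>L \<nu> (f n)" for n
      using eq[of "Bcontfun (f n)"] f01 by (simp add: Bcontfun_inverse[OF fb])
    thus ?thesis
      using LIMSEQ_unique[OF conv[OF assms(1) s(1)]] conv[OF assms(2) s(2)] by simp
  qed
  show ?thesis
  proof (rule measure_eqI_generator_eq[where E="Collect closed" and \<Omega>=UNIV and A="\<lambda>_. UNIV"])
    show "Int_stable (Collect closed :: 'b set set)" by (auto simp: Int_stable_def)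
    show "sets \<mu> = sigma_sets UNIV (Collect closed)" "sets \<nu> = sigma_sets UNIV (Collect closed)"
      by (simp_all add: s borel_eq_closed)
    show "emeasure \<mu> A = emeasure \<nu> A" if "A \<in> Collect closed" for A
      using meas[of A] that by (cases "A = {}") (auto simp: \<mu>.emeasure_eq_measure \<nu>.emeasure_eq_measure)
  qed auto
qed

text \<open>
  Two versions have the same integrals of a given continuous function for almost every \<open>d\<close>;
  continuity in \<open>d\<close> and full support remove the word almost.
\<close>

lemma (in prob_space) continuous_cond_distr_unique:
  fixes X :: "'a \<Rightarrow> 'b :: metric_space"
  assumes K: "is_continuous_cond_distr M X Z K" and K': "is_continuous_cond_distr M X Z K'"
    and supp: "full_support M Z"
  shows "K = K'"
proof
  fix d
  have m[measurable]: "Z \<in> borel_measurable M"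
    and K1: "K \<in> borel \<rightarrow>\<^sub>M prob_algebra borel" "K' \<in> borel \<rightarrow>\<^sub>M prob_algebra borel"
    using K K' by (auto simp: is_continuous_cond_distr_def)
  interpret P: prob_space "distr M borel Z" by (intro prob_space_distr) simp
  have Kp: "prob_space (K d)" "sets (K d) = sets borel" "prob_space (K' d)" "sets (K' d) = sets borel" for d
    using measurable_space[OF K1(1), of d] measurable_space[OF K1(2), of d]
    by (auto simp: space_prob_algebra)
  show "K d = K' d"
  proof (rule measure_eqI_bounded_continuous)
    fix F :: "'b \<Rightarrow>\<^sub>C real" assume F: "\<And>x. 0 \<le> apply_bcontfun F x \<and> apply_bcontfun F x \<le> 1"
    have Fm[measurable]: "apply_bcontfun F \<in> borel_measurable borel"
      by (intro borel_measurable_continuous_onI) simp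
    have ni: "(\<integral>\<^sup>+x. ennreal (apply_bcontfun F x) \<partial>\<rho>) = ennreal (integral\<^sup>L \<rho> (apply_bcontfun F))"
      if "prob_space \<rho>" "sets \<rho> = sets borel" for \<rho> :: "'b measure"
    proof -
      interpret \<rho>: prob_space \<rho> by fact
      note [measurable_cong] = that(2)
      have "integrable \<rho> (apply_bcontfun F)"
        using F by (intro \<rho>.integrable_const_bound[of _ 1]) auto
      thus ?thesis using F by (intro nn_integral_eq_integral) auto
    qed
    have "AE d in distr M borel Z. (\<integral>\<^sup>+x. ennreal (apply_bcontfun F x) \<partial>K d) = (\<integral>\<^sup>+x. ennreal (apply_bcontfun F x) \<partial>K' d)"
    proof (rule P.density_unique_finite_measure)
      show "(\<lambda>d. \<integral>\<^sup>+x. ennreal (apply_bcontfun F x) \<partial>K d) \<in> borel_measurable (distr M borel Z)"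
           "(\<lambda>d. \<integral>\<^sup>+x. ennreal (apply_bcontfun F x) \<partial>K' d) \<in> borel_measurable (distr M borel Z)"
        using measurable_prob_algebraD[OF K1(1)] measurable_prob_algebraD[OF K1(2)]
        by (auto intro!: measurable_compose[OF _ nn_integral_measurable_subprob_algebra])
    qed (auto simp: nn_integral_cond_distr[OF K] nn_integral_cond_distr[OF K'])
    hence "AE d in distr M borel Z. integral\<^sup>L (K d) (apply_bcontfun F) = integral\<^sup>L (K' d) (apply_bcontfun F)"
      using F by (simp add: ni Kp)
    from AE_eq_imp_eq_if_full_support[OF supp m _ _ this]
    show "integral\<^sup>L (K d) (apply_bcontfun F) = integral\<^sup>L (K' d) (apply_bcontfun F)"
      using K K' by (auto simp: is_continuous_cond_distr_def)
  qed (auto simp: Kp)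
qed

lemma measurable_completion_AE_eq:
  assumes "X' \<in> M \<rightarrow>\<^sub>M borel" and "AE \<omega> in M. X \<omega> = X' \<omega>"
  shows "X \<in> completion M \<rightarrow>\<^sub>M borel"
proof (rule measurableI)
  fix A :: "'b set" assume A: "A \<in> sets borel"
  show "X -` A \<inter> space (completion M) \<in> sets (completion M)"
  proof (rule completion.in_sets_AE)
    show "AE \<omega> in completion M. (\<omega> \<in> X' -` A \<inter> space M) = (\<omega> \<in> X -` A \<inter> space (completion M))"
      using AE_completion[OF assms(2)] by eventually_elim auto
    show "X' -` A \<inter> space M \<in> sets (completion M)"
      using assms(1) A by (intro sets_completionI_sets measurable_sets)
  qed auto
qed auto

text \<open>
  Independence of a sigma-algebra \<open>N\<close> and \<open>Z\<close>, expressed by the identity map into \<open>N\<close>: this makes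
  Fubini's theorem available for functions of a point and of \<open>Z\<close>.
\<close>

lemma (in prob_space) joint_distr_subalgebra:
  assumes N: "subalgebra M N" and Z[measurable]: "Z \<in> borel_measurable M"
    and indep: "indep_set (sets N) {Z -` C \<inter> space M |C. C \<in> sets borel}"
  shows "distr M (N \<Otimes>\<^sub>M borel) (\<lambda>\<omega>. (\<omega>, Z \<omega>)) = distr M N (\<lambda>\<omega>. \<omega>) \<Otimes>\<^sub>M distr M borel Z"
proof (rule pair_measure_eqI[symmetric])
  have idN: "(\<lambda>\<omega>. \<omega>) \<in> M \<rightarrow>\<^sub>M N" using N by (rule measurable_from_subalg) simp
  interpret Q: prob_space "distr M N (\<lambda>\<omega>. \<omega>)" by (intro prob_space_distr idN)
  interpret P: prob_space "distr M borel Z" by (intro prob_space_distr) simp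
  show "sigma_finite_measure (distr M N (\<lambda>\<omega>. \<omega>))" "sigma_finite_measure (distr M borel Z)" ..
  fix A C assume "A \<in> sets (distr M N (\<lambda>\<omega>. \<omega>))" "C \<in> sets (distr M borel Z)"
  hence A: "A \<in> sets N" and C: "C \<in> sets borel" by auto
  have AM: "A \<in> sets M" using A N by (auto simp: subalgebra_def)
  have ZC: "Z -` C \<inter> space M \<in> {Z -` C \<inter> space M |C. C \<in> sets borel}" using C by blast
  have "emeasure (distr M (N \<Otimes>\<^sub>M borel) (\<lambda>\<omega>. (\<omega>, Z \<omega>))) (A \<times> C) = emeasure M ((\<lambda>\<omega>. (\<omega>, Z \<omega>)) -` (A \<times> C) \<inter> space M)"
    using A C by (intro emeasure_distr measurable_Pair idN Z) auto
  also have "(\<lambda>\<omega>. (\<omega>, Z \<omega>)) -` (A \<times> C) \<inter> space M = A \<inter> (Z -` C \<inter> space M)"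
    using sets.sets_into_space[OF AM] by auto
  also have "emeasure M \<dots> = ennreal (prob A * prob (Z -` C \<inter> space M))"
    using indep_setD[OF indep A ZC] by (simp add: emeasure_eq_measure)
  also have "\<dots> = emeasure M (A \<inter> space M) * emeasure M (Z -` C \<inter> space M)"
    using sets.sets_into_space[OF AM] by (simp add: emeasure_eq_measure ennreal_mult Int_absorb2)
  also have "\<dots> = emeasure (distr M N (\<lambda>\<omega>. \<omega>)) A * emeasure (distr M borel Z) C"
    using A C idN by (simp add: emeasure_distr)
  finally show "emeasure (distr M N (\<lambda>\<omega>. \<omega>)) A * emeasure (distr M borel Z) C = emeasure (distr M (N \<Otimes>\<^sub>M borel) (\<lambda>\<omega>. (\<omega>, Z \<omega>))) (A \<times> C)"
    by simp
qed simp

text \<open>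
  If \<open>X = Y + Z h\<close> with \<open>Y\<close> measurable for a sigma-algebra independent of \<open>Z\<close>, then conditioning
  on \<open>Z = d\<close> replaces \<open>Z\<close> by \<open>d\<close> and leaves \<open>Y\<close> unchanged. The joint measurability assumption is
  made about the sum, since addition need not be measurable for the product of the Borel algebras
  of a nonseparable space.
\<close>

proposition (in prob_space) cond_distr_independent_shift:
  fixes X Y :: "'a \<Rightarrow> 'b :: real_normed_vector"
  assumes N: "subalgebra M N" and Z[measurable]: "Z \<in> borel_measurable M"
    and indep: "indep_set (sets N) {Z -` C \<inter> space M |C. C \<in> sets borel}"
    and Ym: "(\<lambda>(\<omega>, d). Y \<omega> + d *\<^sub>R h) \<in> borel_measurable (N \<Otimes>\<^sub>M borel)"
    and X: "AE \<omega> in M. X \<omega> = Y \<omega> + Z \<omega> *\<^sub>R h"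
    and supp: "full_support M Z"
  shows "cond_distr (completion M) X Z d = distr M borel (\<lambda>\<omega>. Y \<omega> + d *\<^sub>R h)"
proof -
  define K where "K = (\<lambda>d. distr M borel (\<lambda>\<omega>. Y \<omega> + d *\<^sub>R h))"
  let ?X = "\<lambda>\<omega>. Y \<omega> + Z \<omega> *\<^sub>R h"
  have idN: "(\<lambda>\<omega>. \<omega>) \<in> M \<rightarrow>\<^sub>M N" using N by (rule measurable_from_subalg) simp
  interpret C: prob_space "completion M"
    using emeasure_space_1 by (intro prob_spaceI) (simp add: emeasure_completion)
  have pair: "(\<lambda>(\<omega>, d). Y \<omega> + d *\<^sub>R h) \<in> borel_measurable (M \<Otimes>\<^sub>M borel)"
  proof -
    have "(\<lambda>z. (fst z, snd z)) \<in> M \<Otimes>\<^sub>M (borel :: real measure) \<rightarrow>\<^sub>M N \<Otimes>\<^sub>M borel"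
      by (intro measurable_Pair measurable_compose[OF measurable_fst idN]) auto
    from measurable_compose[OF this Ym] show ?thesis by (simp add: case_prod_beta')
  qed
  have Yd[measurable]: "(\<lambda>\<omega>. Y \<omega> + d *\<^sub>R h) \<in> borel_measurable M" for d
    using measurable_compose[OF measurable_Pair[OF measurable_ident_sets[OF refl] measurable_const[of d borel]] pair]
    by simp
  have X'[measurable]: "?X \<in> borel_measurable M"
    using measurable_compose[OF measurable_Pair[OF measurable_ident_sets[OF refl] Z] pair]
    by simp
  have Kp: "prob_space (K d)" for d
    unfolding K_def by (intro prob_space_distr) simp
  have Xc: "X \<in> completion M \<rightarrow>\<^sub>M borel"
    by (rule measurable_completion_AE_eq[OF X' X])
  have Zc[measurable]: "Z \<in> borel_measurable (completion M)"
    by (rule measurable_completion[OF Z])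
  have distrZ: "distr (completion M) borel Z = distr M borel Z"
    by (rule distr_completion[OF Z])
  have Km: "K \<in> borel \<rightarrow>\<^sub>M prob_algebra borel"
  proof (rule measurable_prob_algebraI)
    have "(\<lambda>d. distr ((\<lambda>_. M) d) borel ((\<lambda>d \<omega>. Y \<omega> + d *\<^sub>R h) d)) \<in> borel \<rightarrow>\<^sub>M subprob_algebra borel"
    proof (rule measurable_distr2)
      have "(\<lambda>z. (snd z, fst z)) \<in> (borel :: real measure) \<Otimes>\<^sub>M M \<rightarrow>\<^sub>M M \<Otimes>\<^sub>M borel" by measurable
      from measurable_compose[OF this pair]
      show "(\<lambda>(d, \<omega>). Y \<omega> + d *\<^sub>R h) \<in> borel \<Otimes>\<^sub>M M \<rightarrow>\<^sub>M borel"
        by (simp add: case_prod_beta')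
      show "(\<lambda>_. M) \<in> borel \<rightarrow>\<^sub>M subprob_algebra M"
        using prob_space_axioms by (intro measurable_const) (simp add: space_subprob_algebra prob_space_imp_subprob_space)
    qed
    thus "K \<in> borel \<rightarrow>\<^sub>M subprob_algebra borel" by (simp add: K_def)
  qed (rule Kp)
  have suppC: "full_support (completion M) Z"
    using supp Z by (simp add: full_support_def measurable_sets)
  have is_cd: "is_continuous_cond_distr (completion M) X Z K"
    unfolding is_continuous_cond_distr_def
  proof (intro conjI ballI allI Xc Zc Km)
    fix A :: "'b set" and C :: "real set" assume [measurable]: "A \<in> sets borel" "C \<in> sets borel"
    interpret P: prob_space "distr M borel Z" by (intro prob_space_distr) simp
    interpret Q: prob_space "distr M N (\<lambda>\<omega>. \<omega>)" by (intro prob_space_distr idN)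
    interpret QP: pair_sigma_finite "distr M N (\<lambda>\<omega>. \<omega>)" "distr M borel Z" ..
    have S[measurable]: "X -` A \<inter> space M \<in> sets (completion M)"
      using measurable_sets[OF Xc, of A] by simp
    have "measure (completion M) {\<omega> \<in> space (completion M). X \<omega> \<in> A \<and> Z \<omega> \<in> C}
        = measure (completion M) {\<omega> \<in> space M. ?X \<omega> \<in> A \<and> Z \<omega> \<in> C}"
    proof (rule C.finite_measure_eq_AE)
      show "AE \<omega> in completion M. (\<omega> \<in> {\<omega> \<in> space (completion M). X \<omega> \<in> A \<and> Z \<omega> \<in> C}) =
          (\<omega> \<in> {\<omega> \<in> space M. ?X \<omega> \<in> A \<and> Z \<omega> \<in> C})"
        using AE_completion[OF X] by eventually_elim auto
      have "{\<omega> \<in> space (completion M). X \<omega> \<in> A \<and> Z \<omega> \<in> C} =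
          (X -` A \<inter> space (completion M)) \<inter> (Z -` C \<inter> space (completion M))" by auto
      thus "{\<omega> \<in> space (completion M). X \<omega> \<in> A \<and> Z \<omega> \<in> C} \<in> sets (completion M)"
        using measurable_sets[OF Xc, of A] measurable_sets[OF Zc, of C] by auto
      show "{\<omega> \<in> space M. ?X \<omega> \<in> A \<and> Z \<omega> \<in> C} \<in> sets (completion M)"
        by (intro sets_completionI_sets) measurable
    qed
    also have "\<dots> = measure M {\<omega> \<in> space M. ?X \<omega> \<in> A \<and> Z \<omega> \<in> C}"
      by (intro measure_completion) measurable
    finally have eq1: "measure (completion M) {\<omega> \<in> space (completion M). X \<omega> \<in> A \<and> Z \<omega> \<in> C}
        = measure M {\<omega> \<in> space M. ?X \<omega> \<in> A \<and> Z \<omega> \<in> C}" .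
    define I where "I = (\<lambda>z. indicator A (Y (fst z) + snd z *\<^sub>R h) * indicator C (snd z) :: ennreal)"
    have I[measurable]: "I \<in> borel_measurable (N \<Otimes>\<^sub>M borel)"
    proof -
      have [measurable]: "(\<lambda>z. Y (fst z) + snd z *\<^sub>R h) \<in> borel_measurable (N \<Otimes>\<^sub>M borel)"
        using Ym by (simp add: case_prod_beta')
      show ?thesis unfolding I_def by measurable
    qed
    have pm: "(\<lambda>\<omega>. (\<omega>, Z \<omega>)) \<in> M \<rightarrow>\<^sub>M N \<Otimes>\<^sub>M borel"
      by (intro measurable_Pair idN Z)
    have KA: "(\<integral>\<^sup>+\<omega>. I (\<omega>, d) \<partial>distr M N (\<lambda>\<omega>. \<omega>)) = ennreal (indicator C d * measure (K d) A)" for d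
    proof -
      have "(\<integral>\<^sup>+\<omega>. I (\<omega>, d) \<partial>distr M N (\<lambda>\<omega>. \<omega>)) = (\<integral>\<^sup>+\<omega>. I (\<omega>, d) \<partial>M)"
        using idN by (intro nn_integral_distr measurable_compose[OF _ I] measurable_Pair) auto
      also have "\<dots> = (\<integral>\<^sup>+\<omega>. indicator ((\<lambda>\<omega>. Y \<omega> + d *\<^sub>R h) -` A \<inter> space M) \<omega> * indicator C d \<partial>M)"
        by (intro nn_integral_cong) (auto simp: I_def indicator_def)
      also have "\<dots> = emeasure (K d) A * indicator C d"
        by (simp add: nn_integral_multc K_def emeasure_distr)
      finally show ?thesis
        using Kp[of d] by (simp add: prob_space_def finite_measure.emeasure_eq_measure indicator_def)
    qed
    have "ennreal (measure M {\<omega> \<in> space M. ?X \<omega> \<in> A \<and> Z \<omega> \<in> C})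
        = (\<integral>\<^sup>+\<omega>. indicator {\<omega> \<in> space M. ?X \<omega> \<in> A \<and> Z \<omega> \<in> C} \<omega> \<partial>M)"
      by (subst nn_integral_indicator) (auto simp: emeasure_eq_measure)
    also have "\<dots> = (\<integral>\<^sup>+\<omega>. I (\<omega>, Z \<omega>) \<partial>M)"
      by (intro nn_integral_cong) (auto simp: I_def indicator_def)
    also have "\<dots> = (\<integral>\<^sup>+z. I z \<partial>distr M (N \<Otimes>\<^sub>M borel) (\<lambda>\<omega>. (\<omega>, Z \<omega>)))"
      using I by (intro nn_integral_distr[symmetric] pm) simp
    also have "\<dots> = (\<integral>\<^sup>+z. I z \<partial>(distr M N (\<lambda>\<omega>. \<omega>) \<Otimes>\<^sub>M distr M borel Z))"
      by (simp only: joint_distr_subalgebra[OF N Z indep])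
    also have "\<dots> = (\<integral>\<^sup>+d. (\<integral>\<^sup>+\<omega>. I (\<omega>, d) \<partial>distr M N (\<lambda>\<omega>. \<omega>)) \<partial>distr M borel Z)"
      using I by (intro QP.nn_integral_snd[symmetric]) simp
    also have "\<dots> = (\<integral>\<^sup>+d. ennreal (indicator C d * measure (K d) A) \<partial>distr M borel Z)"
      by (simp only: KA)
    also have "\<dots> = ennreal (\<integral>d. indicator C d * measure (K d) A \<partial>distr M borel Z)"
    proof (intro nn_integral_eq_integral P.integrable_const_bound[of _ 1] AE_I2)
      note [measurable] = measurable_prob_algebraD[OF Km]
      have "(\<lambda>d. emeasure (K d) A) \<in> borel_measurable borel" by measurable
      thus "(\<lambda>d. indicator C d * measure (K d) A) \<in> borel_measurable (distr M borel Z)"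
        unfolding measure_def by measurable
    qed (use Kp in \<open>auto simp: indicator_def prob_space.prob_le_1\<close>)
    finally have "measure M {\<omega> \<in> space M. ?X \<omega> \<in> A \<and> Z \<omega> \<in> C}
        = (\<integral>d. indicator C d * measure (K d) A \<partial>distr M borel Z)"
      by (subst (asm) ennreal_inj) (auto intro!: integral_nonneg)
    thus "measure (completion M) {\<omega> \<in> space (completion M). X \<omega> \<in> A \<and> Z \<omega> \<in> C} =
        (LINT d:C|distr (completion M) borel Z. measure (K d) A)"
      unfolding eq1 distrZ set_lebesgue_integral_def by simp
  next
    fix F :: "'b \<Rightarrow>\<^sub>C real"
    have Fm[measurable]: "apply_bcontfun F \<in> borel_measurable borel"
      by (intro borel_measurable_continuous_onI) simp
    obtain B where B: "\<And>x. norm (apply_bcontfun F x) \<le> B"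
      using bounded_apply_bcontfun[of F] by (auto simp: bounded_iff)
    have KF: "integral\<^sup>L (K d) (apply_bcontfun F) = (\<integral>\<omega>. apply_bcontfun F (Y \<omega> + d *\<^sub>R h) \<partial>M)" for d
      unfolding K_def by (subst integral_distr) auto
    have "(\<lambda>n. \<integral>\<omega>. apply_bcontfun F (Y \<omega> + ds n *\<^sub>R h) \<partial>M) \<longlonglongrightarrow> (\<integral>\<omega>. apply_bcontfun F (Y \<omega> + d *\<^sub>R h) \<partial>M)"
      if ds: "ds \<longlonglongrightarrow> d" for ds d
    proof (rule integral_dominated_convergence[where w="\<lambda>_. B"])
      show "AE \<omega> in M. (\<lambda>n. apply_bcontfun F (Y \<omega> + ds n *\<^sub>R h)) \<longlonglongrightarrow> apply_bcontfun F (Y \<omega> + d *\<^sub>R h)"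
        using ds by (intro AE_I2 continuous_on_tendsto_compose[of UNIV "apply_bcontfun F"] tendsto_intros) auto
    qed (use B in auto)
    thus "continuous_on UNIV (\<lambda>d. integral\<^sup>L (K d) (apply_bcontfun F))"
      unfolding KF continuous_on_sequentially by (auto simp: comp_def)
  qed
  have "cond_distr (completion M) X Z = K"
    unfolding cond_distr_def
    by (rule the_equality[where P = "is_continuous_cond_distr (completion M) X Z", OF is_cd]) (rule C.continuous_cond_distr_unique[OF _ is_cd suppC])
  thus ?thesis by (simp add: K_def)
qed

section \<open>The Wiener bridge is independent of its endpoint\<close>

text \<open>
  Completing the square: the joint density of \<open>X\<close> and \<open>u = X + Y\<close> is the density of \<open>u\<close> times the
  density of \<open>X\<close> given \<open>u\<close>, a normal density around the regression value \<open>s u / (s + r)\<close>.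
\<close>

lemma normal_density_mult_shift:
  assumes "0 < s" "0 < r"
  shows "normal_density 0 (sqrt s) x * normal_density 0 (sqrt r) (u - x)
    = normal_density 0 (sqrt (s + r)) u * normal_density 0 (sqrt (s * r / (s + r))) (x - s * u / (s + r))"
proof -
  have e: "- x\<^sup>2 / (2 * s) + (- (u - x)\<^sup>2 / (2 * r))
     = - u\<^sup>2 / (2 * (s + r)) + (- (x - s * u / (s + r))\<^sup>2 / (2 * (s * r / (s + r))))"
proof -
  define y where "y = x - s * u / (s + r)"
  have x: "x = y + s * u / (s + r)" by (simp add: y_def)
  define v where "v = u / (s + r)"
  have u: "u = (s + r) * v" "s * u / (s + r) = s * v" using assms by (simp_all add: v_def)
  have 0: "x = y + s * v" using x u(2) by simp
  moreover have "u - x = r * v - y" unfolding 0 using u(1) by (simp add: algebra_simps)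
  ultimately have 1: "x = y + s * v" "u - x = r * v - y" by auto
  have a: "x\<^sup>2 / (2 * s) = y\<^sup>2 / (2 * s) + y * v + s * v\<^sup>2 / 2"
    using assms unfolding 1(1) by (simp add: power2_eq_square add_divide_distrib algebra_simps)
  have b: "(u - x)\<^sup>2 / (2 * r) = y\<^sup>2 / (2 * r) - y * v + r * v\<^sup>2 / 2"
    using assms unfolding 1(2) by (simp add: power2_eq_square add_divide_distrib diff_divide_distrib algebra_simps)
  have c: "u\<^sup>2 / (2 * (s + r)) = (s + r) * v\<^sup>2 / 2"
  proof -
    have "(p * v)\<^sup>2 / (2 * p) = p * v\<^sup>2 / 2" if "p \<noteq> 0" for p :: real
      using that by (simp add: power2_eq_square)
    moreover have "s + r \<noteq> 0" using assms by simp
    ultimately show ?thesis unfolding u(1) by blast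
  qed
  have d: "y\<^sup>2 / (2 * (s * r / (s + r))) = y\<^sup>2 / (2 * s) + y\<^sup>2 / (2 * r)"
    using assms by (simp add: field_simps)
  have "x\<^sup>2 / (2 * s) + (u - x)\<^sup>2 / (2 * r) = u\<^sup>2 / (2 * (s + r)) + y\<^sup>2 / (2 * (s * r / (s + r)))"
    unfolding a b c d by (simp add: distrib_right add_divide_distrib)
  hence "- (x\<^sup>2 / (2 * s)) + - ((u - x)\<^sup>2 / (2 * r)) = - (u\<^sup>2 / (2 * (s + r))) + - (y\<^sup>2 / (2 * (s * r / (s + r))))"
    by linarith
  thus ?thesis unfolding y_def[symmetric] minus_divide_left .
qed
  have c: "sqrt (2 * pi * s) * sqrt (2 * pi * r) = sqrt (2 * pi * (s + r)) * sqrt (2 * pi * (s * r / (s + r)))"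
proof -
  have "sqrt (2 * pi * s) * sqrt (2 * pi * r) = sqrt ((2 * pi * s) * (2 * pi * r))"
    by (rule real_sqrt_mult[symmetric])
  also have "(2 * pi * s) * (2 * pi * r) = (2 * pi * (s + r)) * (2 * pi * (s * r / (s + r)))"
    using assms by (simp add: field_simps)
  also have "sqrt \<dots> = sqrt (2 * pi * (s + r)) * sqrt (2 * pi * (s * r / (s + r)))"
    by (rule real_sqrt_mult)
  finally show ?thesis .
qed
  have "normal_density 0 (sqrt s) x * normal_density 0 (sqrt r) (u - x)
     = 1 / (sqrt (2 * pi * s) * sqrt (2 * pi * r)) * exp (- x\<^sup>2 / (2 * s) + (- (u - x)\<^sup>2 / (2 * r)))"
    using assms unfolding normal_density_def exp_add by simp
  also have "\<dots> = normal_density 0 (sqrt (s + r)) u * normal_density 0 (sqrt (s * r / (s + r))) (x - s * u / (s + r))"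
    unfolding e c unfolding normal_density_def exp_add using assms by simp
  finally show ?thesis .
qed

lemma measurable_shear_product:
  fixes \<phi> \<psi> :: "real \<Rightarrow> real" and s r :: real
  assumes s: "0 < s" and r: "0 < r" and "A \<in> sets borel" "C \<in> sets borel"
    and "\<phi> \<in> borel_measurable borel" "\<psi> \<in> borel_measurable borel"
  shows "(\<lambda>(x, u). ennreal (\<phi> u * \<psi> (x - s * u / (s + r))) * (indicator C ((x - s * u / (s + r)) / s) * indicator A u))
          \<in> borel_measurable (lborel \<Otimes>\<^sub>M lborel)"
proof -
  let ?L = "lborel \<Otimes>\<^sub>M lborel :: (real \<times> real) measure"
  have m: "(\<lambda>z :: real \<times> real. fst z - s * snd z / (s + r)) \<in> borel_measurable ?L"
    unfolding lborel_prod measurable_lborel2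
    using s r by (intro borel_measurable_continuous_onI continuous_intros) auto
  have m2: "snd \<in> borel_measurable ?L"
    unfolding lborel_prod measurable_lborel2 by (intro borel_measurable_continuous_onI continuous_intros)
  have m3: "(\<lambda>z :: real \<times> real. (fst z - s * snd z / (s + r)) / s) \<in> borel_measurable ?L"
    by (intro borel_measurable_divide m borel_measurable_const)
  have "(\<lambda>z. ennreal (\<phi> (snd z) * \<psi> (fst z - s * snd z / (s + r))) * (indicator C ((fst z - s * snd z / (s + r)) / s) * indicator A (snd z)))
    \<in> borel_measurable ?L"
    by (intro borel_measurable_times_ennreal measurable_compose[OF _ measurable_ennreal] borel_measurable_times
        measurable_compose[OF m2] measurable_compose[OF m] measurable_compose[OF m3] borel_measurable_indicator) fact+
  thus ?thesis by (simp only: case_prod_beta')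
qed

lemma (in prob_space) indep_varI_prod:
  assumes X[measurable]: "X \<in> M \<rightarrow>\<^sub>M S" and Y[measurable]: "Y \<in> M \<rightarrow>\<^sub>M N"
    and eq: "\<And>A C. A \<in> sets S \<Longrightarrow> C \<in> sets N \<Longrightarrow>
      prob (X -` A \<inter> Y -` C \<inter> space M) = prob (X -` A \<inter> space M) * prob (Y -` C \<inter> space M)"
  shows "indep_var S X N Y"
proof -
  have *: "indep_sets (case_bool {X -` A \<inter> space M |A. A \<in> sets S} {Y -` A \<inter> space M |A. A \<in> sets N}) UNIV"
    unfolding indep_set_def[symmetric] indep_sets2_eq
  proof (intro conjI ballI)
    fix a b assume "a \<in> {X -` A \<inter> space M |A. A \<in> sets S}" "b \<in> {Y -` A \<inter> space M |A. A \<in> sets N}"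
    then obtain A C where AC: "A \<in> sets S" "C \<in> sets N" "a = X -` A \<inter> space M" "b = Y -` C \<inter> space M" by auto
    have "a \<inter> b = X -` A \<inter> Y -` C \<inter> space M" using AC by auto
    thus "prob (a \<inter> b) = prob a * prob b" using eq[OF AC(1,2)] AC(3,4) by simp
  qed auto
  have "(\<lambda>i. {case_bool X Y i -` A \<inter> space M |A. A \<in> sets (case_bool S N i)})
     = case_bool {X -` A \<inter> space M |A. A \<in> sets S} {Y -` A \<inter> space M |A. A \<in> sets N}"
    by (auto simp: fun_eq_iff split: bool.split)
  thus ?thesis using * X Y
    unfolding indep_var_def indep_vars_def2 by (auto split: bool.split)
qed

text \<open>
  In the coordinates \<open>u = x + y\<close> and \<open>x\<close> the difference is \<open>(x - s u / (s + r)) / s\<close>, and the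
  joint density factors by \<open>normal_density_mult_shift\<close>. For fixed \<open>u\<close>, translating \<open>x\<close> removes
  \<open>u\<close> from the inner integral, so the joint law is a product.
\<close>

lemma (in prob_space) indep_var_normal_sum_difference:
  assumes s: "0 < s" and r: "0 < r" and ind: "indep_var borel X borel Y"
    and X: "distributed M lborel X (normal_density 0 (sqrt s))"
    and Y: "distributed M lborel Y (normal_density 0 (sqrt r))"
  shows "indep_var borel (\<lambda>\<omega>. X \<omega> / s - (X \<omega> + Y \<omega>) / (s + r)) borel (\<lambda>\<omega>. X \<omega> + Y \<omega>)"
proof (rule indep_varI_prod)
  have m[measurable]: "X \<in> borel_measurable M" "Y \<in> borel_measurable M"
    using ind by (auto dest: indep_var_rv1 indep_var_rv2)
  show "(\<lambda>\<omega>. X \<omega> / s - (X \<omega> + Y \<omega>) / (s + r)) \<in> borel_measurable M" "(\<lambda>\<omega>. X \<omega> + Y \<omega>) \<in> borel_measurable M"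
    by measurable
  let ?D = "\<lambda>\<omega>. X \<omega> / s - (X \<omega> + Y \<omega>) / (s + r)" and ?S = "\<lambda>\<omega>. X \<omega> + Y \<omega>"
  let ?p = "normal_density 0 (sqrt s)" and ?q = "normal_density 0 (sqrt r)"
  let ?P = "normal_density 0 (sqrt (s + r))" and ?Q = "normal_density 0 (sqrt (s * r / (s + r)))"
  \<comment> \<open>the two factors of the joint law of the difference and the sum\<close>
  define \<kappa> where "\<kappa> = (\<lambda>C :: real set. \<integral>\<^sup>+x. indicator C (x / s) * ennreal (?Q x) \<partial>lborel)"
  define \<Lambda> where "\<Lambda> = (\<lambda>A :: real set. \<integral>\<^sup>+u. indicator A u * ennreal (?P u) \<partial>lborel)"
  have joint: "distributed M (lborel \<Otimes>\<^sub>M lborel) (\<lambda>\<omega>. (X \<omega>, Y \<omega>))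
      (\<lambda>(x, y). ennreal (?p x) * ennreal (?q y))"
  proof (rule distributed_joint_indep[OF _ _ X Y])
    show "indep_var lborel X lborel Y"
      using ind unfolding indep_var_eq by simp
  qed (rule lborel.sigma_finite_measure_axioms)+
  have key: "emeasure M (?D -` C \<inter> ?S -` A \<inter> space M) = \<kappa> C * \<Lambda> A"
    if [measurable]: "A \<in> sets borel" "C \<in> sets borel" for A C :: "real set"
  proof -
    let ?E = "{z :: real \<times> real. fst z / s - (fst z + snd z) / (s + r) \<in> C \<and> fst z + snd z \<in> A}"
    have E: "?E \<in> sets (lborel \<Otimes>\<^sub>M lborel)"
    proof -
      have "{z \<in> space (lborel \<Otimes>\<^sub>M lborel). fst z / s - (fst z + snd z) / (s + r) \<in> C \<and> fst z + snd z \<in> A} \<in> sets (lborel \<Otimes>\<^sub>M lborel)"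
        by measurable
      thus ?thesis by (simp add: space_pair_measure)
    qed
    have "?D -` C \<inter> ?S -` A \<inter> space M = (\<lambda>\<omega>. (X \<omega>, Y \<omega>)) -` ?E \<inter> space M" by auto
    hence "emeasure M (?D -` C \<inter> ?S -` A \<inter> space M)
       = (\<integral>\<^sup>+z. (case z of (x, y) \<Rightarrow> ennreal (?p x) * ennreal (?q y)) * indicator ?E z \<partial>(lborel \<Otimes>\<^sub>M lborel))"
      using distributed_emeasure[OF joint E] by simp
    also have "\<dots> = (\<integral>\<^sup>+x. (\<integral>\<^sup>+y. ennreal (?p x * ?q y)
         * (indicator C (x / s - (x + y) / (s + r)) * indicator A (x + y)) \<partial>lborel) \<partial>lborel)"
      using E by (subst lborel.nn_integral_fst[symmetric])
        (auto simp: ennreal_mult indicator_def intro!: nn_integral_cong)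
    also have "\<dots> = (\<integral>\<^sup>+x. (\<integral>\<^sup>+u. ennreal (?p x * ?q (u - x))
         * (indicator C (x / s - u / (s + r)) * indicator A u) \<partial>lborel) \<partial>lborel)"
    proof (rule nn_integral_cong)
      fix x :: real
      show "(\<integral>\<^sup>+y. ennreal (?p x * ?q y)
         * (indicator C (x / s - (x + y) / (s + r)) * indicator A (x + y)) \<partial>lborel)
       = (\<integral>\<^sup>+u. ennreal (?p x * ?q (u - x))
         * (indicator C (x / s - u / (s + r)) * indicator A u) \<partial>lborel)"
        by (subst nn_integral_real_affine[where c=1 and t="-x"]) (auto simp: algebra_simps)
    qed
    also have "\<dots> = (\<integral>\<^sup>+x. (\<integral>\<^sup>+u. ennreal (?P u * ?Q (x - s * u / (s + r)))
         * (indicator C ((x - s * u / (s + r)) / s) * indicator A u) \<partial>lborel) \<partial>lborel)"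
    proof (intro nn_integral_cong)
      fix x u :: real
      have "x / s - u / (s + r) = (x - s * u / (s + r)) / s"
        using s r by (simp add: field_simps)
      thus "ennreal (?p x * ?q (u - x))
         * (indicator C (x / s - u / (s + r)) * indicator A u)
        = ennreal (?P u * ?Q (x - s * u / (s + r)))
         * (indicator C ((x - s * u / (s + r)) / s) * indicator A u)"
        by (simp only: normal_density_mult_shift[OF s r])
    qed
    also have "\<dots> = (\<integral>\<^sup>+u. (\<integral>\<^sup>+x. ennreal (?P u * ?Q (x - s * u / (s + r)))
         * (indicator C ((x - s * u / (s + r)) / s) * indicator A u) \<partial>lborel) \<partial>lborel)"
    proof -
      define f where "f = (\<lambda>x u. ennreal (?P u * ?Q (x - s * u / (s + r)))
         * (indicator C ((x - s * u / (s + r)) / s) * indicator A u :: ennreal))"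
      have "case_prod f \<in> borel_measurable (lborel \<Otimes>\<^sub>M lborel)"
        unfolding f_def by (rule measurable_shear_product[OF s r that borel_measurable_normal_density borel_measurable_normal_density])
      from lborel_pair.Fubini'[OF this, symmetric] show ?thesis unfolding f_def .
    qed
    also have "\<dots> = (\<integral>\<^sup>+u. (indicator A u * ennreal (?P u)) *
        (\<integral>\<^sup>+x. indicator C ((x - s * u / (s + r)) / s) * ennreal (?Q (x - s * u / (s + r))) \<partial>lborel) \<partial>lborel)"
    proof (intro nn_integral_cong)
      fix u
      show "(\<integral>\<^sup>+x. ennreal (?P u * ?Q (x - s * u / (s + r)))
         * (indicator C ((x - s * u / (s + r)) / s) * indicator A u) \<partial>lborel)
        = (indicator A u * ennreal (?P u)) *
        (\<integral>\<^sup>+x. indicator C ((x - s * u / (s + r)) / s) * ennreal (?Q (x - s * u / (s + r))) \<partial>lborel)"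
        by (subst nn_integral_cmult[symmetric]) (auto intro!: nn_integral_cong simp: ennreal_mult ac_simps)
    qed
    also have "\<dots> = (\<integral>\<^sup>+u. (indicator A u * ennreal (?P u)) * \<kappa> C \<partial>lborel)"
    proof (intro nn_integral_cong arg_cong2[where f="(*)"] refl)
      fix u
      show "(\<integral>\<^sup>+x. indicator C ((x - s * u / (s + r)) / s) * ennreal (?Q (x - s * u / (s + r))) \<partial>lborel) = \<kappa> C"
        unfolding \<kappa>_def
        by (subst nn_integral_real_affine[where c=1 and t="s * u / (s + r)"]) auto
    qed
    also have "\<dots> = \<kappa> C * \<Lambda> A"
      unfolding \<Lambda>_def by (subst nn_integral_multc) (auto simp: mult.commute)
    finally show ?thesis .
  qed
  fix C A :: "real set" assume [measurable]: "C \<in> sets borel" "A \<in> sets borel"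
  \<comment> \<open>a joint law of product form splits into its marginals once the total mass is 1\<close>
  have 1: "\<kappa> UNIV * \<Lambda> UNIV = 1"
    using key[of UNIV UNIV] emeasure_space_1 by simp
  have "emeasure M (?D -` C \<inter> ?S -` A \<inter> space M) = (\<kappa> C * \<Lambda> UNIV) * (\<kappa> UNIV * \<Lambda> A)"
  proof -
    have "(\<kappa> C * \<Lambda> UNIV) * (\<kappa> UNIV * \<Lambda> A) = (\<kappa> C * \<Lambda> A) * (\<kappa> UNIV * \<Lambda> UNIV)"
      by (simp add: ac_simps)
    thus ?thesis using key[of A C] 1 by simp
  qed
  also have "\<dots> = emeasure M (?D -` C \<inter> space M) * emeasure M (?S -` A \<inter> space M)"
    using key[of UNIV C] key[of A UNIV] by simp
  finally show "prob (?D -` C \<inter> ?S -` A \<inter> space M) = prob (?D -` C \<inter> space M) * prob (?S -` A \<inter> space M)"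
    by (simp add: emeasure_eq_measure ennreal_mult[symmetric])
qed

text \<open>
  In an independent family two members may be replaced by two independent functions of them, as the
  pair is independent of the remaining members.
\<close>

lemma (in prob_space) indep_vars_replace_pair:
  fixes \<xi> :: "'i \<Rightarrow> 'a \<Rightarrow> real"
  assumes ind: "indep_vars (\<lambda>_. borel) \<xi> I" and fin: "finite I" and ab: "a \<in> I" "b \<in> I" "a \<noteq> b"
    and F[measurable]: "F \<in> borel_measurable (borel \<Otimes>\<^sub>M borel)" and G[measurable]: "G \<in> borel_measurable (borel \<Otimes>\<^sub>M borel)"
    and FG: "indep_var borel (\<lambda>\<omega>. F (\<xi> a \<omega>, \<xi> b \<omega>)) borel (\<lambda>\<omega>. G (\<xi> a \<omega>, \<xi> b \<omega>))"
  shows "indep_vars (\<lambda>_. borel) (\<xi>(a := \<lambda>\<omega>. F (\<xi> a \<omega>, \<xi> b \<omega>), b := \<lambda>\<omega>. G (\<xi> a \<omega>, \<xi> b \<omega>))) I"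
    (is "indep_vars _ ?\<eta> I")
proof -
  have m: "\<xi> i \<in> borel_measurable M" if "i \<in> I" for i
    using ind that by (auto simp: indep_vars_def2)
  note [measurable] = m[OF ab(1)] m[OF ab(2)]
  have m': "?\<eta> i \<in> borel_measurable M" if "i \<in> I" for i
    using m[OF that] by (simp add: fun_upd_def)
  define R where "R = I - {a, b}"
  have R: "finite R" "I = insert a (insert b R)" "a \<notin> R" "b \<notin> R" using fin ab by (auto simp: R_def)
  have Rind: "indep_vars (\<lambda>_. borel) \<xi> R" by (rule indep_vars_subset[OF ind]) (auto simp: R_def)
  have ind2: "indep_var (PiM {a, b} (\<lambda>_. borel)) (\<lambda>\<omega>. restrict (\<lambda>i. \<xi> i \<omega>) {a, b}) (PiM R (\<lambda>_. borel)) (\<lambda>\<omega>. restrict (\<lambda>i. \<xi> i \<omega>) R)"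
    by (rule indep_var_restrict[OF ind]) (use ab in \<open>auto simp: R_def\<close>)
  have prodR: "prob {\<omega> \<in> space M. \<forall>i\<in>R. \<xi> i \<omega> \<in> B i} = (\<Prod>i\<in>R. prob (\<xi> i -` B i \<inter> space M))"
    if "\<And>i. i \<in> R \<Longrightarrow> B i \<in> sets borel" for B
  proof (cases "R = {}")
    case True thus ?thesis by (simp add: prob_space)
  next
    case False
    have "{\<omega> \<in> space M. \<forall>i\<in>R. \<xi> i \<omega> \<in> B i} = (\<Inter>i\<in>R. \<xi> i -` B i \<inter> space M)"
      using False by auto
    thus ?thesis using indep_varsD_finite[OF Rind False R(1), of B] that by simp
  qed
  have "indep_sets (\<lambda>i. {?\<eta> i -` A \<inter> space M |A. A \<in> sets borel}) I"
  proof (subst indep_sets_finite)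
    show "I \<noteq> {}" "finite I" using ab fin by auto
    show "{?\<eta> i -` A \<inter> space M |A. A \<in> sets borel} \<subseteq> events" if "i \<in> I" for i
      using measurable_sets[OF m'[OF that]] by blast
    show "space M \<in> {?\<eta> i -` A \<inter> space M |A. A \<in> sets borel}" if "i \<in> I" for i
      by (rule CollectI, rule exI[of _ UNIV]) auto
    show "\<forall>A\<in>Pi I (\<lambda>i. {?\<eta> i -` A \<inter> space M |A. A \<in> sets borel}). prob (\<Inter>j\<in>I. A j) = (\<Prod>j\<in>I. prob (A j))"
    proof
      fix A assume A: "A \<in> Pi I (\<lambda>i. {?\<eta> i -` A \<inter> space M |A. A \<in> sets borel})"
      have "\<forall>i\<in>I. \<exists>B. B \<in> sets borel \<and> A i = ?\<eta> i -` B \<inter> space M"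
      proof
        fix i assume "i \<in> I"
        from Pi_mem[OF A this] show "\<exists>B. B \<in> sets borel \<and> A i = ?\<eta> i -` B \<inter> space M" by blast
      qed
      from bchoice[OF this] obtain B where
        B: "\<And>i. i \<in> I \<Longrightarrow> B i \<in> sets borel" "\<And>i. i \<in> I \<Longrightarrow> A i = ?\<eta> i -` B i \<inter> space M"
        by blast
      have [measurable]: "B a \<in> sets borel" "B b \<in> sets borel" using B ab by auto
      define E1 where "E1 = {x \<in> space (PiM {a, b} (\<lambda>_. borel :: real measure)). F (x a, x b) \<in> B a \<and> G (x a, x b) \<in> B b}"
      define E2 where "E2 = {x \<in> space (PiM R (\<lambda>_. borel :: real measure)). \<forall>i\<in>R. x i \<in> B i}"
      have E1: "E1 \<in> sets (PiM {a, b} (\<lambda>_. borel))" unfolding E1_def by measurable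
      have E2: "E2 \<in> sets (PiM R (\<lambda>_. borel))"
      proof -
        have "E2 = Pi\<^sub>E R B" by (auto simp: E2_def space_PiM PiE_def Pi_def extensional_def)
        thus ?thesis using R(1) B(1) by (auto intro!: sets_PiM_I_finite simp: R_def)
      qed
      have "(\<Inter>j\<in>I. A j) = (\<lambda>\<omega>. (restrict (\<lambda>i. \<xi> i \<omega>) {a, b}, restrict (\<lambda>i. \<xi> i \<omega>) R)) -` (E1 \<times> E2) \<inter> space M"
        (is "_ = ?R")
      proof (rule set_eqI)
        fix \<omega>
        have "\<omega> \<in> (\<Inter>j\<in>I. A j) \<longleftrightarrow> (\<omega> \<in> A a \<and> \<omega> \<in> A b \<and> (\<forall>i\<in>R. \<omega> \<in> A i))"
          unfolding R(2) by auto
        also have "\<omega> \<in> A a \<longleftrightarrow> \<omega> \<in> space M \<and> F (\<xi> a \<omega>, \<xi> b \<omega>) \<in> B a"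
          using B(2)[OF ab(1)] ab by auto
        also have "\<omega> \<in> A b \<longleftrightarrow> \<omega> \<in> space M \<and> G (\<xi> a \<omega>, \<xi> b \<omega>) \<in> B b"
          using B(2)[OF ab(2)] ab by auto
        also have "(\<forall>i\<in>R. \<omega> \<in> A i) \<longleftrightarrow> (\<forall>i\<in>R. \<omega> \<in> space M \<and> \<xi> i \<omega> \<in> B i)"
          using B(2) by (intro ball_cong refl) (auto simp: R_def)
        finally show "\<omega> \<in> (\<Inter>j\<in>I. A j) \<longleftrightarrow> \<omega> \<in> ?R"
          by (auto simp: E1_def E2_def space_PiM)
      qed
      hence "prob (\<Inter>j\<in>I. A j) = prob ((\<lambda>\<omega>. restrict (\<lambda>i. \<xi> i \<omega>) {a, b}) -` E1 \<inter> space M) * prob ((\<lambda>\<omega>. restrict (\<lambda>i. \<xi> i \<omega>) R) -` E2 \<inter> space M)"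
        using indep_varD[OF ind2 E1 E2] by simp
      also have "(\<lambda>\<omega>. restrict (\<lambda>i. \<xi> i \<omega>) {a, b}) -` E1 \<inter> space M
          = {\<omega> \<in> space M. F (\<xi> a \<omega>, \<xi> b \<omega>) \<in> B a \<and> G (\<xi> a \<omega>, \<xi> b \<omega>) \<in> B b}"
        by (auto simp: E1_def space_PiM)
      also have "prob \<dots> = prob (A a) * prob (A b)"
        using prob_indep_random_variable[OF FG, of "B a" "B b"] B(2)[OF ab(1)] B(2)[OF ab(2)] ab
        by (simp add: vimage_def Int_def conj_commute)
      also have "(\<lambda>\<omega>. restrict (\<lambda>i. \<xi> i \<omega>) R) -` E2 \<inter> space M = {\<omega> \<in> space M. \<forall>i\<in>R. \<xi> i \<omega> \<in> B i}"
        by (auto simp: E2_def space_PiM)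
      also have "prob \<dots> = (\<Prod>i\<in>R. prob (\<xi> i -` B i \<inter> space M))"
        using B(1) by (intro prodR) (auto simp: R_def)
      also have "\<dots> = (\<Prod>i\<in>R. prob (A i))"
        using B(2) by (intro prod.cong refl arg_cong[where f=prob]) (auto simp: R_def)
      finally show "prob (\<Inter>j\<in>I. A j) = (\<Prod>j\<in>I. prob (A j))"
        unfolding R(2) using R(1,3,4) ab(3) by simp
    qed
  qed
  thus ?thesis using m' unfolding indep_vars_def2 by blast
qed

lemma (in prob_space) indep_vars_imp_indep_var:
  assumes ind: "indep_vars (\<lambda>_. N) \<xi> I" and ab: "a \<in> I" "b \<in> I" "a \<noteq> b"
  shows "indep_var N (\<xi> a) N (\<xi> b)"
proof (rule indep_varI_prod)
  show "\<xi> a \<in> M \<rightarrow>\<^sub>M N" "\<xi> b \<in> M \<rightarrow>\<^sub>M N" using ind ab by (auto simp: indep_vars_def2)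
  fix A C assume AC: "A \<in> sets N" "C \<in> sets N"
  have "prob (\<Inter>i\<in>{a, b}. \<xi> i -` (if i = a then A else C) \<inter> space M)
      = (\<Prod>i\<in>{a, b}. prob (\<xi> i -` (if i = a then A else C) \<inter> space M))"
    using ab AC by (intro indep_varsD[OF ind]) auto
  moreover have "(\<Inter>i\<in>{a, b}. \<xi> i -` (if i = a then A else C) \<inter> space M) = \<xi> a -` A \<inter> \<xi> b -` C \<inter> space M"
    using ab by auto
  ultimately show "prob (\<xi> a -` A \<inter> \<xi> b -` C \<inter> space M) = prob (\<xi> a -` A \<inter> space M) * prob (\<xi> b -` C \<inter> space M)"
    using ab by simp
qed

text \<open>
  The value of \<open>W\<^sub>0\<close> is subtracted because it is zero only almost surely.
\<close>

definition bridge_part :: "real \<Rightarrow> (real \<Rightarrow> 'a \<Rightarrow> real) \<Rightarrow> real \<Rightarrow> 'a \<Rightarrow> real" where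
  "bridge_part T W r \<omega> = (W r \<omega> - W 0 \<omega>) - min r T / T * (W T \<omega> - W 0 \<omega>)"

context wiener_process
begin

text \<open>
  Start with the increments along the grid. In step \<open>k\<close> the sum \<open>S\<^sub>k\<close> of the first \<open>k\<close> increments
  and the next increment are replaced by \<open>S\<^sub>k / p\<^sub>k - S\<^sub>k\<^sub>+\<^sub>1 / p\<^sub>k\<^sub>+\<^sub>1\<close> and \<open>S\<^sub>k\<^sub>+\<^sub>1\<close>. The
  family with index \<open>k\<close> contains \<open>S\<^sub>k\<close> itself, and it is still independent.
\<close>

lemma indep_vars_bridge_increments:
  fixes p :: "nat \<Rightarrow> real" and k N :: nat
  defines "\<xi> \<equiv> \<lambda>k i. if Suc i < k
      then (\<lambda>\<omega>. (W (p (Suc i)) \<omega> - W (p 0) \<omega>) / p (Suc i) - (W (p (Suc (Suc i))) \<omega> - W (p 0) \<omega>) / p (Suc (Suc i)))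
      else if Suc i = k then (\<lambda>\<omega>. W (p k) \<omega> - W (p 0) \<omega>)
      else (\<lambda>\<omega>. W (p (Suc i)) \<omega> - W (p i) \<omega>)"
  assumes p0: "p 0 = 0" and p: "\<And>i j. i < j \<Longrightarrow> j \<le> N \<Longrightarrow> p i < p j"
    and k: "1 \<le> k" "k \<le> N"
  shows "indep_vars (\<lambda>_. borel) (\<xi> k) {..<N}"
  using k
proof (induction k rule: nat_induct_at_least)
  case base
  have "\<xi> 1 = (\<lambda>i \<omega>. W (p (Suc i)) \<omega> - W (p i) \<omega>)"
    by (auto simp: \<xi>_def fun_eq_iff)
  thus ?case using W_indep_increments[of p N] p p0 by simp
next
  case (Suc k)
  have IH: "indep_vars (\<lambda>_. borel) (\<xi> k) {..<N}" using Suc by simp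
  obtain a where a: "k = Suc a" using Suc by (cases k) auto
  have ab: "a \<in> {..<N}" "k \<in> {..<N}" "a \<noteq> k" using Suc a by auto
  have xa: "\<xi> k a = (\<lambda>\<omega>. W (p k) \<omega> - W (p 0) \<omega>)" and xk: "\<xi> k k = (\<lambda>\<omega>. W (p (Suc k)) \<omega> - W (p k) \<omega>)"
    using a by (auto simp: \<xi>_def fun_eq_iff)
  have pk: "0 < p k" "p k < p (Suc k)" using p[of 0 k] p[of k "Suc k"] Suc p0 by auto
  define F where "F = (\<lambda>z :: real \<times> real. fst z / p k - (fst z + snd z) / (p k + (p (Suc k) - p k)))"
  define G where "G = (\<lambda>z :: real \<times> real. fst z + snd z)"
  have "indep_vars (\<lambda>_. borel) ((\<xi> k)(a := \<lambda>\<omega>. F (\<xi> k a \<omega>, \<xi> k k \<omega>), k := \<lambda>\<omega>. G (\<xi> k a \<omega>, \<xi> k k \<omega>))) {..<N}"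
  proof (rule indep_vars_replace_pair[OF IH _ ab])
    show "F \<in> borel_measurable (borel \<Otimes>\<^sub>M borel)" "G \<in> borel_measurable (borel \<Otimes>\<^sub>M borel)"
      unfolding F_def G_def by measurable
    have "distributed M lborel (\<xi> k a) (normal_density 0 (sqrt (p k)))"
      using W_increment[of 0 "p k"] pk p0 unfolding xa by simp
    moreover have "distributed M lborel (\<xi> k k) (normal_density 0 (sqrt (p (Suc k) - p k)))"
      using W_increment[of "p k" "p (Suc k)"] pk unfolding xk by simp
    ultimately show "indep_var borel (\<lambda>\<omega>. F (\<xi> k a \<omega>, \<xi> k k \<omega>)) borel (\<lambda>\<omega>. G (\<xi> k a \<omega>, \<xi> k k \<omega>))"
      unfolding F_def G_def fst_conv snd_conv using pk
      by (intro indep_var_normal_sum_difference indep_vars_imp_indep_var[OF IH ab]) auto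
  qed auto
  also have "(\<xi> k)(a := \<lambda>\<omega>. F (\<xi> k a \<omega>, \<xi> k k \<omega>), k := \<lambda>\<omega>. G (\<xi> k a \<omega>, \<xi> k k \<omega>)) = \<xi> (Suc k)"
    unfolding xa xk by (auto simp: fun_eq_iff F_def G_def \<xi>_def a)
  finally show ?case .
qed

text \<open>
  Take a grid that contains 0, \<open>T\<close> and the times in \<open>J\<close>. Up to \<open>T\<close> the bridge is
  \<open>p\<^sub>k (S\<^sub>k / p\<^sub>k - S\<^sub>n / p\<^sub>n)\<close>, a telescoping sum of the differences above, and after \<open>T\<close> it is a sum
  of increments; neither involves the member \<open>S\<^sub>n = W\<^sub>T - W\<^sub>0\<close> of the independent family.
\<close>

lemma bridge_part_indep_finite:
  fixes J :: "real set" and B :: "real \<Rightarrow> real set"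
  assumes T: "0 < T" and J: "finite J" "J \<subseteq> {0..}" and B: "\<And>j. B j \<in> sets borel" and C: "C \<in> sets borel"
  shows "prob {\<omega> \<in> space M. (\<forall>j\<in>J. bridge_part T W j \<omega> \<in> B j) \<and> W T \<omega> - W 0 \<omega> \<in> C}
    = prob {\<omega> \<in> space M. \<forall>j\<in>J. bridge_part T W j \<omega> \<in> B j} * prob {\<omega> \<in> space M. W T \<omega> - W 0 \<omega> \<in> C}"
proof -
  \<comment> \<open>the grid: \<open>p n = T\<close> for some \<open>n \<ge> 1\<close>\<close>
  define L where "L = sorted_list_of_set (insert 0 (insert T J))"
  define p where "p = (\<lambda>i. L ! i)"
  define N where "N = length L - 1"
  have setL: "set L = insert 0 (insert T J)" using J(1) unfolding L_def by (intro set_sorted_list_of_set) simp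
  have "sorted_wrt (<) L" unfolding L_def by (rule strict_sorted_list_of_set)
  hence p: "p i < p j" if "i < j" "j \<le> N" for i j
    using that by (auto simp: p_def N_def sorted_wrt_iff_nth_less)
  have len: "length L = Suc N"
    using setL by (cases L) (auto simp: N_def)
  have ex: "\<exists>k\<le>N. x = p k" if "x \<in> insert 0 (insert T J)" for x
    using that unfolding setL[symmetric] in_set_conv_nth p_def len by (auto simp: less_Suc_eq_le)
  have p0: "p 0 = 0"
  proof -
    obtain k where k: "k \<le> N" "0 = p k" using ex[of 0] by auto
    have "p 0 \<in> set L" using len by (simp add: p_def)
    hence "0 \<le> p 0" using setL J T by auto
    thus ?thesis using p[of 0 k] k by (cases "k = 0") auto
  qed
  obtain n where n: "n \<le> N" "T = p n" using ex[of T] by auto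
  have n1: "1 \<le> n" using n p0 T by (cases n) auto
  have pos: "0 < p k" if "1 \<le> k" "k \<le> N" for k using p[of 0 k] that p0 by auto
  define \<xi> where "\<xi> = (\<lambda>i. if Suc i < n
      then (\<lambda>\<omega>. (W (p (Suc i)) \<omega> - W (p 0) \<omega>) / p (Suc i) - (W (p (Suc (Suc i))) \<omega> - W (p 0) \<omega>) / p (Suc (Suc i)))
      else if Suc i = n then (\<lambda>\<omega>. W (p n) \<omega> - W (p 0) \<omega>)
      else (\<lambda>\<omega>. W (p (Suc i)) \<omega> - W (p i) \<omega>))"
  have ind: "indep_vars (\<lambda>_. borel) \<xi> {..<N}"
    using indep_vars_bridge_increments[of p N n, OF p0 p n1 n(1)] by (simp add: \<xi>_def)
  define R where "R = {..<N} - {n - 1}"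
  define \<Phi> where "\<Phi> = (\<lambda>k (x :: nat \<Rightarrow> real). if k \<le> n then p k * (\<Sum>i\<in>{k - 1..<n - 1}. x i) else (\<Sum>i\<in>{n..<k}. x i))"
  have sum_m: "(\<lambda>x. \<Sum>i\<in>S. x i) \<in> borel_measurable (PiM R (\<lambda>_. borel :: real measure))" if "S \<subseteq> R" for S
  proof -
    have "(\<lambda>x. x i) \<in> borel_measurable (PiM R (\<lambda>_. borel :: real measure))" if "i \<in> S" for i
      using that \<open>S \<subseteq> R\<close> by (intro measurable_component_singleton) auto
    thus ?thesis using borel_measurable_sum[of S "\<lambda>i x. x i" "PiM R (\<lambda>_. borel :: real measure)"] by simp
  qed
  have \<Phi>m: "\<Phi> k \<in> borel_measurable (PiM R (\<lambda>_. borel))" if "k \<le> N" for k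
  proof (cases "k \<le> n")
    case True
    have "(\<lambda>x. p k * (\<Sum>i\<in>{k - 1..<n - 1}. x i)) \<in> borel_measurable (PiM R (\<lambda>_. borel))"
      using n n1 by (intro borel_measurable_times borel_measurable_const sum_m) (auto simp: R_def)
    thus ?thesis using True by (simp add: \<Phi>_def)
  next
    case False
    have "(\<lambda>x. \<Sum>i\<in>{n..<k}. x i) \<in> borel_measurable (PiM R (\<lambda>_. borel :: real measure))"
      using n n1 that by (intro sum_m) (auto simp: R_def)
    thus ?thesis using False by (simp add: \<Phi>_def)
  qed
  have V: "bridge_part T W (p k) \<omega> = \<Phi> k (restrict (\<lambda>i. \<xi> i \<omega>) R)" if k: "k \<le> N" for k \<omega>
  proof (cases "k \<le> n")
    case True
    have le: "p k \<le> p n" using True p[of k n] n by (cases "k = n") auto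
    show ?thesis
    proof (cases "k = 0")
      case True
      thus ?thesis using T by (simp add: \<Phi>_def p0 bridge_part_def)
    next
      case False
      have "\<Phi> k (restrict (\<lambda>i. \<xi> i \<omega>) R) = p k * (\<Sum>i\<in>{k - 1..<n - 1}. restrict (\<lambda>i. \<xi> i \<omega>) R i)"
        using True by (simp add: \<Phi>_def)
      also have "(\<Sum>i\<in>{k - 1..<n - 1}. restrict (\<lambda>i. \<xi> i \<omega>) R i)
          = (\<Sum>i\<in>{k - 1..<n - 1}. (- ((W (p (Suc (Suc i))) \<omega> - W (p 0) \<omega>) / p (Suc (Suc i)))) - (- ((W (p (Suc i)) \<omega> - W (p 0) \<omega>) / p (Suc i))))"
        using n by (intro sum.cong refl) (auto simp: R_def \<xi>_def)
      also have "\<dots> = - ((W (p (Suc (n - 1))) \<omega> - W (p 0) \<omega>) / p (Suc (n - 1))) - (- ((W (p (Suc (k - 1))) \<omega> - W (p 0) \<omega>) / p (Suc (k - 1))))"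
        using True by (intro sum_Suc_diff'[where f="\<lambda>i. - ((W (p (Suc i)) \<omega> - W (p 0) \<omega>) / p (Suc i))"]) auto
      also have "p k * \<dots> = bridge_part T W (p k) \<omega>"
        using False n1 pos[of k] k le n by (simp add: bridge_part_def p0 min_def field_simps)
      finally show ?thesis ..
    qed
  next
    case False
    have le: "p n < p k" using False p[of n k] k by auto
    have "\<Phi> k (restrict (\<lambda>i. \<xi> i \<omega>) R) = (\<Sum>i\<in>{n..<k}. restrict (\<lambda>i. \<xi> i \<omega>) R i)"
      using False by (simp add: \<Phi>_def)
    also have "\<dots> = (\<Sum>i\<in>{n..<k}. W (p (Suc i)) \<omega> - W (p i) \<omega>)"
      using n n1 k by (intro sum.cong refl) (auto simp: R_def \<xi>_def)
    also have "\<dots> = W (p k) \<omega> - W (p n) \<omega>"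
      using False by (intro sum_Suc_diff'[where f="\<lambda>i. W (p i) \<omega>"]) auto
    also have "\<dots> = bridge_part T W (p k) \<omega>"
      using le n T by (simp add: bridge_part_def)
    finally show ?thesis ..
  qed
  obtain \<kappa> where \<kappa>: "\<And>j. j \<in> J \<Longrightarrow> \<kappa> j \<le> N \<and> j = p (\<kappa> j)"
    using ex by (metis insertCI)
  have ind2: "indep_var (PiM R (\<lambda>_. borel)) (\<lambda>\<omega>. restrict (\<lambda>i. \<xi> i \<omega>) R) (PiM {n - 1} (\<lambda>_. borel)) (\<lambda>\<omega>. restrict (\<lambda>i. \<xi> i \<omega>) {n - 1})"
    by (rule indep_var_restrict[OF ind]) (use n n1 in \<open>auto simp: R_def\<close>)
  define E1 where "E1 = {x \<in> space (PiM R (\<lambda>_. borel :: real measure)). \<forall>j\<in>J. \<Phi> (\<kappa> j) x \<in> B j}"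
  define E2 where "E2 = {x \<in> space (PiM {n - 1} (\<lambda>_. borel :: real measure)). x (n - 1) \<in> C}"
  have E1: "E1 \<in> sets (PiM R (\<lambda>_. borel))"
    unfolding E1_def
  proof (rule sets.sets_Collect_finite_All[OF _ J(1)])
    fix j assume "j \<in> J"
    from measurable_sets[OF \<Phi>m B, of "\<kappa> j" j] \<kappa>[OF this]
    show "{x \<in> space (PiM R (\<lambda>_. borel)). \<Phi> (\<kappa> j) x \<in> B j} \<in> sets (PiM R (\<lambda>_. borel))"
      by (simp add: vimage_def Int_def conj_commute)
  qed
  have E2: "E2 \<in> sets (PiM {n - 1} (\<lambda>_. borel))"
    unfolding E2_def using C by measurable
  have xn: "\<xi> (n - 1) \<omega> = W T \<omega> - W 0 \<omega>" for \<omega> using n1 n p0 by (simp add: \<xi>_def)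
  have V': "bridge_part T W j \<omega> = \<Phi> (\<kappa> j) (restrict (\<lambda>i. \<xi> i \<omega>) R)" if "j \<in> J" for j \<omega>
    using V[of "\<kappa> j" \<omega>] \<kappa>[OF that] by simp
  have e1: "(\<lambda>\<omega>. restrict (\<lambda>i. \<xi> i \<omega>) R) -` E1 \<inter> space M = {\<omega> \<in> space M. \<forall>j\<in>J. bridge_part T W j \<omega> \<in> B j}"
    by (auto simp: E1_def space_PiM V')
  have e2: "(\<lambda>\<omega>. restrict (\<lambda>i. \<xi> i \<omega>) {n - 1}) -` E2 \<inter> space M = {\<omega> \<in> space M. W T \<omega> - W 0 \<omega> \<in> C}"
    by (auto simp: E2_def space_PiM xn[unfolded One_nat_def])
  have e3: "(\<lambda>\<omega>. (restrict (\<lambda>i. \<xi> i \<omega>) R, restrict (\<lambda>i. \<xi> i \<omega>) {n - 1})) -` (E1 \<times> E2) \<inter> space M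
     = {\<omega> \<in> space M. (\<forall>j\<in>J. bridge_part T W j \<omega> \<in> B j) \<and> W T \<omega> - W 0 \<omega> \<in> C}"
    using e1 e2 by blast
  show ?thesis using indep_varD[OF ind2 E1 E2] unfolding e1 e2 e3 .
qed

end

section \<open>Moments and the strong law for the Wiener process\<close>

text \<open>
  A dyadic point of level \<open>m + 1\<close> has a neighbour of level \<open>m\<close>. Adding the steps over all levels
  gives the geometric series with sum 11.
\<close>

lemma dyadic_chaining:
  fixes g :: "real \<Rightarrow> real"
  assumes c: "0 \<le> c" and step: "\<And>m j :: nat. j < 2 ^ m \<Longrightarrow> \<bar>g ((real j + 1) / 2 ^ m) - g (real j / 2 ^ m)\<bar> \<le> c * (10 / 11) ^ m"
    and cont: "continuous_on {0..1} g" and s: "s \<in> {0..1}"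
  shows "\<bar>g s - g 0\<bar> \<le> 11 * c"
proof -
  have dy: "\<bar>g (real j / 2 ^ m) - g 0\<bar> \<le> c * (\<Sum>i\<le>m. (10 / 11) ^ i)" if "j \<le> 2 ^ m" for m j :: nat
    using that
  proof (induction m arbitrary: j)
    case 0
    hence "j = 0 \<or> j = 1" by auto
    thus ?case using step[of 0 0] c by auto
  next
    case (Suc m)
    show ?case
    proof (cases "even j")
      case True
      then obtain i where i: "j = 2 * i" by blast
      have "\<bar>g (real i / 2 ^ m) - g 0\<bar> \<le> c * (\<Sum>i\<le>m. (10 / 11) ^ i)"
        using Suc i by auto
      also have "\<dots> \<le> c * (\<Sum>i\<le>Suc m. (10 / 11) ^ i)"
        using c by (intro mult_left_mono) auto
      finally show ?thesis by (simp add: i)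
    next
      case False
      then obtain i where i: "j = 2 * i + 1" using oddE by blast
      have le: "i \<le> 2 ^ m" "2 * i < 2 ^ Suc m" using Suc.prems i by auto
      have "\<bar>g (real j / 2 ^ Suc m) - g 0\<bar> \<le> \<bar>g ((real (2 * i) + 1) / 2 ^ Suc m) - g (real (2 * i) / 2 ^ Suc m)\<bar> + \<bar>g (real i / 2 ^ m) - g 0\<bar>"
        by (simp add: i add.commute)
      also have "\<dots> \<le> c * (10 / 11) ^ Suc m + c * (\<Sum>i\<le>m. (10 / 11) ^ i)"
        by (intro add_mono step le(2) Suc.IH le(1))
      also have "\<dots> = c * (\<Sum>i\<le>Suc m. (10 / 11) ^ i)"
        by (simp add: algebra_simps)
      finally show ?thesis .
    qed
  qed
  have geo: "(\<Sum>i\<le>m. (10 / 11 :: real) ^ i) \<le> 11" for m :: nat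
  proof -
    have "(\<Sum>i<Suc m. (10 / 11 :: real) ^ i) \<le> (\<Sum>i. (10 / 11) ^ i)"
      by (intro sum_le_suminf summable_geometric) auto
    also have "\<dots> = 11" by (subst suminf_geometric) auto
    finally show ?thesis by (simp add: lessThan_Suc_atMost)
  qed
  have dy11: "\<bar>g (real j / 2 ^ m) - g 0\<bar> \<le> 11 * c" if "j \<le> 2 ^ m" for m j :: nat
    using dy[OF that] mult_left_mono[OF geo[of m] c] by simp
  define a where "a = (\<lambda>m. real (nat \<lfloor>2 ^ m * s\<rfloor>) / 2 ^ m)"
  have ale: "nat \<lfloor>2 ^ m * s\<rfloor> \<le> 2 ^ m" for m
  proof -
    have "real (nat \<lfloor>2 ^ m * s\<rfloor>) \<le> 2 ^ m * s" using s by (intro of_nat_floor) auto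
    also have "\<dots> \<le> 2 ^ m * 1" using s by (intro mult_left_mono) auto
    finally have "real (nat \<lfloor>2 ^ m * s\<rfloor>) \<le> real (2 ^ m)" by simp
    thus ?thesis by (simp only: of_nat_le_iff)
  qed
  have aeq: "a m = of_int \<lfloor>2 ^ m * s\<rfloor> / 2 ^ m" for m
    using s by (simp add: a_def)
  have a01: "a m \<in> {0..1}" for m
    using ale[of m] unfolding a_def by (simp add: divide_le_eq flip: of_nat_le_iff)
  have "a \<longlonglongrightarrow> s"
  proof (rule tendsto_sandwich)
    have "s - 1 / 2 ^ m \<le> a m" for m
    proof -
      have "2 ^ m * s - 1 \<le> of_int \<lfloor>2 ^ m * s\<rfloor>" by linarith
      hence "(2 ^ m * s - 1) / 2 ^ m \<le> a m" unfolding aeq by (intro divide_right_mono) auto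
      thus ?thesis by (simp add: diff_divide_distrib)
    qed
    thus "\<forall>\<^sub>F m in sequentially. s - 1 / 2 ^ m \<le> a m" by simp
    have "a m \<le> s" for m
    proof -
      have "of_int \<lfloor>2 ^ m * s\<rfloor> \<le> 2 ^ m * s" by linarith
      thus ?thesis unfolding aeq by (simp add: divide_le_eq mult.commute)
    qed
    thus "\<forall>\<^sub>F m in sequentially. a m \<le> s" by simp
    have "(\<lambda>m. s - (1 / 2) ^ m) \<longlonglongrightarrow> s - 0"
      by (intro tendsto_diff tendsto_const LIMSEQ_power_zero) auto
    thus "(\<lambda>m. s - 1 / 2 ^ m) \<longlonglongrightarrow> s" by (simp add: power_divide)
  qed auto
  hence "(\<lambda>m. g (a m)) \<longlonglongrightarrow> g s"
    using s a01 by (intro continuous_on_tendsto_compose[OF cont]) auto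
  hence "(\<lambda>m. \<bar>g (a m) - g 0\<bar>) \<longlonglongrightarrow> \<bar>g s - g 0\<bar>"
    by (intro tendsto_intros)
  thus ?thesis
    by (rule LIMSEQ_le_const2) (use dy11[OF ale] in \<open>auto simp: a_def\<close>)
qed

context wiener_process
begin

lemma increment_moment:
  assumes "0 \<le> s" "s \<le> t"
  shows "has_bochner_integral M (\<lambda>\<omega>. W t \<omega> - W s \<omega>) 0"
    and "has_bochner_integral M (\<lambda>\<omega>. (W t \<omega> - W s \<omega>)\<^sup>2) (t - s)"
    and "has_bochner_integral M (\<lambda>\<omega>. (W t \<omega> - W s \<omega>) ^ 4) (3 * (t - s)\<^sup>2)"
proof -
  let ?g = "normal_density 0 (sqrt (t - s))"
  have *: "has_bochner_integral M (\<lambda>\<omega>. (W t \<omega> - W s \<omega>) ^ k) v"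
    if st: "s < t" and h: "has_bochner_integral lborel (\<lambda>x. ?g x * (x - 0) ^ k) v" for k v
  proof -
    have D: "distributed M lborel (\<lambda>\<omega>. W t \<omega> - W s \<omega>) ?g" using W_increment assms st by simp
    have "integrable M (\<lambda>\<omega>. (W t \<omega> - W s \<omega>) ^ k)"
      using h by (subst distributed_integrable[OF D, symmetric]) (auto simp: has_bochner_integral_iff)
    moreover have "integral\<^sup>L M (\<lambda>\<omega>. (W t \<omega> - W s \<omega>) ^ k) = v"
      using h by (subst distributed_integral[OF D, symmetric]) (auto simp: has_bochner_integral_iff)
    ultimately show ?thesis by (simp add: has_bochner_integral_iff)
  qed
  show "has_bochner_integral M (\<lambda>\<omega>. W t \<omega> - W s \<omega>) 0"
  proof (cases "s = t")
    case False
    thus ?thesis using *[of 1 0] normal_moment_odd[of "sqrt (t - s)" 0 0] assms by simp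
  qed (simp add: has_bochner_integral_zero)
  show "has_bochner_integral M (\<lambda>\<omega>. (W t \<omega> - W s \<omega>)\<^sup>2) (t - s)"
  proof (cases "s = t")
    case False
    have "fact (2 * 1) / ((2 / (sqrt (t - s))\<^sup>2) ^ 1 * fact 1) = t - s"
      using assms by (simp add: field_simps)
    thus ?thesis using False *[of 2 "t - s"] normal_moment_even[of "sqrt (t - s)" 0 1] assms by (simp add: diff_divide_distrib)
  qed (simp add: has_bochner_integral_zero)
  show "has_bochner_integral M (\<lambda>\<omega>. (W t \<omega> - W s \<omega>) ^ 4) (3 * (t - s)\<^sup>2)"
  proof (cases "s = t")
    case False
    hence "fact (2 * 2) / ((2 / (sqrt (t - s))\<^sup>2) ^ 2 * fact 2) = 3 * (t - s)\<^sup>2"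
      using assms by (simp add: fact_numeral power_divide)
    thus ?thesis using False *[of 4 "3 * (t - s)\<^sup>2"] normal_moment_even[of "sqrt (t - s)" 0 2] assms by simp
  qed (simp add: has_bochner_integral_zero)
qed

lemma W_mean:
  assumes "0 \<le> t" shows "has_bochner_integral M (W t) 0"
proof -
  have "AE \<omega> in M. W t \<omega> - W 0 \<omega> = W t \<omega>" using W_zero by eventually_elim simp
  thus ?thesis using increment_moment(1)[of 0 t] assms W_measurable
    by (subst has_bochner_integral_cong_AE[where g="\<lambda>\<omega>. W t \<omega> - W 0 \<omega>"]) auto
qed

lemma W_square:
  assumes "0 \<le> t" shows "has_bochner_integral M (\<lambda>\<omega>. (W t \<omega>)\<^sup>2) t"
proof -
  have "AE \<omega> in M. (W t \<omega>)\<^sup>2 = (W t \<omega> - W 0 \<omega>)\<^sup>2" using W_zero by eventually_elim simp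
  thus ?thesis using increment_moment(2)[of 0 t] assms W_measurable
    by (subst has_bochner_integral_cong_AE[where g="\<lambda>\<omega>. (W t \<omega> - W 0 \<omega>)\<^sup>2"]) auto
qed

text \<open>
  Polarization reduces the covariance to the variances of increments.
\<close>

lemma W_covariance:
  assumes "0 \<le> s" "0 \<le> t" shows "has_bochner_integral M (\<lambda>\<omega>. W s \<omega> * W t \<omega>) (min s t)"
proof -
  have *: "has_bochner_integral M (\<lambda>\<omega>. W s \<omega> * W t \<omega>) s" if "0 \<le> s" "s \<le> t" for s t
  proof -
    have "has_bochner_integral M (\<lambda>\<omega>. ((W s \<omega>)\<^sup>2 + (W t \<omega>)\<^sup>2 - (W t \<omega> - W s \<omega>)\<^sup>2) / 2) ((s + t - (t - s)) / 2)"
      using that by (intro has_bochner_integral_divide has_bochner_integral_diff has_bochner_integral_add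
        W_square increment_moment) auto
    thus ?thesis by (simp add: power2_diff mult.commute)
  qed
  show ?thesis
  proof (cases "s \<le> t")
    case True thus ?thesis using *[of s t] assms by (simp add: min_def)
  next
    case False thus ?thesis using *[of t s] assms by (simp add: min_def mult.commute)
  qed
qed

lemma nn_integral_increment_4:
  assumes "0 \<le> s" "s \<le> t" "0 \<le> c"
  shows "(\<integral>\<^sup>+\<omega>. ennreal (((W t \<omega> - W s \<omega>) * c) ^ 4) \<partial>M) = ennreal (3 * (t - s)\<^sup>2 * c ^ 4)"
proof -
  have "has_bochner_integral M (\<lambda>\<omega>. ((W t \<omega> - W s \<omega>) * c) ^ 4) (3 * (t - s)\<^sup>2 * c ^ 4)"
    using increment_moment(3)[OF assms(1,2)] by (auto simp: power_mult_distrib intro!: has_bochner_integral_mult_left)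
  thus ?thesis
    by (subst nn_integral_eq_integral) (auto simp: has_bochner_integral_iff)
qed

text \<open>
  Let \<open>A\<^sub>n\<close> collect the fourth powers of \<open>W\<^sub>n / (n + 1)\<close> and of the dyadic increments of level \<open>m\<close> in
  \<open>[n, n + 1]\<close>, divided by \<open>n + 1\<close> and weighted by \<open>(11/10)\<^sup>m\<close>. By the Gaussian fourth moment the
  expectation of \<open>A\<^sub>n\<close> is of order \<open>1 / n\<^sup>2\<close>, so the series of the \<open>A\<^sub>n\<close> converges and \<open>A\<^sub>n\<close> tends to 0.
  Chaining turns small \<open>A\<^sub>n\<close> into the bound \<open>|W\<^sub>u| \<le> \<epsilon> u\<close>, up to a constant, for all \<open>u \<in> [n, n + 1]\<close>.
\<close>

theorem strong_law:
  "AE \<omega> in M. ((\<lambda>u. W u \<omega> / u) \<longlongrightarrow> 0) at_top"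
proof -
  define \<Delta> where "\<Delta> = (\<lambda>(n :: nat) (m :: nat) (j :: nat) \<omega>.
      (W (real n + (real j + 1) / 2 ^ m) \<omega> - W (real n + real j / 2 ^ m) \<omega>) * ((11 / 10) ^ m / (real n + 1)))"
  define \<Gamma> where "\<Gamma> = (\<lambda>(n :: nat) \<omega>. (W (real n) \<omega> - W 0 \<omega>) * (1 / (real n + 1)))"
  define A where "A = (\<lambda>n \<omega>. ennreal ((\<Gamma> n \<omega>) ^ 4) + (\<Sum>m. \<Sum>j<2 ^ m. ennreal ((\<Delta> n m j \<omega>) ^ 4)))"
  have m: "\<Delta> n m j \<in> borel_measurable M" "\<Gamma> n \<in> borel_measurable M" for n m j
    unfolding \<Delta>_def \<Gamma>_def by (intro borel_measurable_times borel_measurable_diff W_measurable; simp)+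
  note [measurable] = m
  \<comment> \<open>\<open>q = (11/10)\<^sup>4 / 2 < 1\<close>: level \<open>m\<close> has \<open>2\<^sup>m\<close> increments with fourth moment \<open>3 / 4\<^sup>m\<close> each\<close>
  define q :: real where "q = 14641 / 20000"
  have D4: "(\<integral>\<^sup>+\<omega>. ennreal ((\<Delta> n m j \<omega>) ^ 4) \<partial>M) = ennreal (3 * (1 / (real n + 1)) ^ 4 * q ^ m / 2 ^ m)" for n m j
  proof -
    have "(\<integral>\<^sup>+\<omega>. ennreal ((\<Delta> n m j \<omega>) ^ 4) \<partial>M) = ennreal (3 * ((real n + (real j + 1) / 2 ^ m) - (real n + real j / 2 ^ m))\<^sup>2 * ((11 / 10) ^ m / (real n + 1)) ^ 4)"
      unfolding \<Delta>_def prod.case by (rule nn_integral_increment_4) (auto simp: divide_right_mono)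
    also have "(real n + (real j + 1) / 2 ^ m) - (real n + real j / 2 ^ m) = 1 / 2 ^ m"
      by (simp add: add_divide_distrib)
    also have "3 * (1 / 2 ^ m)\<^sup>2 * ((11 / 10) ^ m / (real n + 1)) ^ 4 = 3 * (1 / (real n + 1)) ^ 4 * (((11 / 10) ^ m) ^ 4 * (1 / 2 ^ m)\<^sup>2)"
      by (simp add: power_divide power_mult_distrib)
    also have "((11 / 10 :: real) ^ m) ^ 4 * (1 / 2 ^ m)\<^sup>2 = ((11 / 10) ^ 4 * (1 / 2)) ^ m / 2 ^ m"
    proof -
      have "((11 / 10 :: real) ^ m) ^ 4 = ((11 / 10) ^ 4) ^ m"
        by (simp only: power_mult[symmetric] mult.commute)
      moreover have "(1 / 2 ^ m :: real)\<^sup>2 = (1 / 2) ^ m / 2 ^ m"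
        by (simp add: power2_eq_square power_divide)
      ultimately show ?thesis unfolding power_mult_distrib by simp
    qed
    also have "(11 / 10 :: real) ^ 4 * (1 / 2) = q" by (simp add: power_divide q_def)
    finally show ?thesis by simp
  qed
  have EA: "(\<integral>\<^sup>+\<omega>. A n \<omega> \<partial>M) \<le> ennreal (15 * (1 / (real (Suc n))\<^sup>2))" for n
  proof -
    define K where "K = 3 * (1 / (real n + 1)) ^ 4"
    have K: "0 \<le> K" by (simp add: K_def)
    have q: "0 \<le> q" "q < 1" "1 / (1 - q) \<le> 4" by (auto simp: q_def)
    have sum: "(\<Sum>j<(2 :: nat) ^ m. ennreal (K * q ^ m / 2 ^ m)) = ennreal (K * q ^ m)" for m :: nat
    proof -
      have "(\<Sum>j<(2 :: nat) ^ m. ennreal (K * q ^ m / 2 ^ m)) = ennreal (\<Sum>j<(2 :: nat) ^ m. K * q ^ m / 2 ^ m)"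
        using K q by (intro sum_ennreal) auto
      thus ?thesis by simp
    qed
    have "(\<integral>\<^sup>+\<omega>. A n \<omega> \<partial>M) = (\<integral>\<^sup>+\<omega>. ennreal ((\<Gamma> n \<omega>) ^ 4) \<partial>M) + (\<Sum>m. \<Sum>j<2 ^ m. (\<integral>\<^sup>+\<omega>. ennreal ((\<Delta> n m j \<omega>) ^ 4) \<partial>M))"
      unfolding A_def by (subst nn_integral_add, simp, simp, subst nn_integral_suminf, simp, subst nn_integral_sum) auto
    also have "(\<Sum>m. \<Sum>j<2 ^ m. (\<integral>\<^sup>+\<omega>. ennreal ((\<Delta> n m j \<omega>) ^ 4) \<partial>M)) = (\<Sum>m. ennreal (K * q ^ m))"
      unfolding D4 K_def[symmetric] sum ..
    also have "\<dots> = ennreal (K * (1 / (1 - q)))"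
      using K q by (intro suminf_ennreal_eq sums_mult geometric_sums) auto
    also have "(\<integral>\<^sup>+\<omega>. ennreal ((\<Gamma> n \<omega>) ^ 4) \<partial>M) = ennreal (3 * (real n - 0)\<^sup>2 * (1 / (real n + 1)) ^ 4)"
      unfolding \<Gamma>_def by (rule nn_integral_increment_4) auto
    also have "ennreal (3 * (real n - 0)\<^sup>2 * (1 / (real n + 1)) ^ 4) + ennreal (K * (1 / (1 - q)))
        = ennreal (3 * (real n - 0)\<^sup>2 * (1 / (real n + 1)) ^ 4 + K * (1 / (1 - q)))"
      using K q by (intro ennreal_plus[symmetric]) auto
    also have "\<dots> \<le> ennreal (15 * (1 / (real (Suc n))\<^sup>2))"
    proof (rule ennreal_leI)
      define z where "z = real n + 1"
      have z: "1 \<le> z" by (simp add: z_def)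
      have "3 * (real n - 0)\<^sup>2 * (1 / (real n + 1)) ^ 4 = 3 * (real n)\<^sup>2 * (1 / z) ^ 4"
        by (simp add: z_def)
      also have "\<dots> \<le> 3 * z\<^sup>2 * (1 / z) ^ 4"
        by (intro mult_right_mono mult_left_mono power_mono) (auto simp: z_def)
      also have "\<dots> = 3 * (1 / z\<^sup>2)" using z by (simp add: power_divide power2_eq_square power4_eq_xxxx)
      finally have 1: "3 * (real n - 0)\<^sup>2 * (1 / (real n + 1)) ^ 4 \<le> 3 * (1 / z\<^sup>2)" .
      have "K * (1 / (1 - q)) \<le> K * 4" using K q by (intro mult_left_mono)
      also have "\<dots> = 12 * (1 / z ^ 4)" by (simp add: K_def z_def power_divide)
      also have "\<dots> \<le> 12 * (1 / z\<^sup>2)"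
        using z by (intro mult_left_mono divide_left_mono power_increasing) auto
      finally show "3 * (real n - 0)\<^sup>2 * (1 / (real n + 1)) ^ 4 + K * (1 / (1 - q)) \<le> 15 * (1 / (real (Suc n))\<^sup>2)"
        using 1 by (simp add: z_def add.commute)
    qed
    finally show ?thesis .
  qed
  have Am[measurable]: "A n \<in> borel_measurable M" for n unfolding A_def by measurable
  have "summable (\<lambda>n. 1 / (real (Suc n))\<^sup>2)"
    using inverse_power_summable[of 2, where 'a=real] by (subst summable_Suc_iff) (simp add: inverse_eq_divide)
  hence "summable (\<lambda>n. 15 * (1 / (real (Suc n))\<^sup>2))" by (rule summable_mult)
  hence fin: "(\<Sum>n. ennreal (15 * (1 / (real (Suc n))\<^sup>2))) \<noteq> \<infinity>"
    by (subst suminf_ennreal2) auto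
  have "(\<integral>\<^sup>+\<omega>. (\<Sum>n. A n \<omega>) \<partial>M) = (\<Sum>n. \<integral>\<^sup>+\<omega>. A n \<omega> \<partial>M)"
    by (rule nn_integral_suminf) simp
  also have "\<dots> \<le> (\<Sum>n. ennreal (15 * (1 / (real (Suc n))\<^sup>2)))"
    by (intro suminf_le EA summableI)
  finally have "(\<integral>\<^sup>+\<omega>. (\<Sum>n. A n \<omega>) \<partial>M) \<noteq> \<infinity>" using fin by (auto simp: top_unique)
  hence "AE \<omega> in M. (\<Sum>n. A n \<omega>) \<noteq> \<infinity>"
    by (intro nn_integral_PInf_AE) auto
  with W_zero W_continuous show ?thesis
  proof eventually_elim
    case (elim \<omega>)
    have A_le: "A n \<omega> \<le> (\<Sum>n. A n \<omega>)" for n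
      using sum_le_suminf[of "\<lambda>n. A n \<omega>" "{n}"] by (simp add: summableI)
    define a where "a = (\<lambda>n. enn2real (A n \<omega>))"
    have a: "A n \<omega> = ennreal (a n)" for n
      using A_le[of n] elim(3) unfolding a_def
      by (subst ennreal_enn2real) (auto simp: less_top top_unique)
    have "summable a"
      using elim(3) unfolding a by (intro summable_suminf_not_top) (auto simp: a_def)
    hence a0: "a \<longlonglongrightarrow> 0" by (rule summable_LIMSEQ_zero)
    have G: "(\<Gamma> n \<omega>) ^ 4 \<le> a n" for n
    proof -
      have "ennreal ((\<Gamma> n \<omega>) ^ 4) \<le> A n \<omega>" unfolding A_def by simp
      thus ?thesis unfolding a by (simp add: a_def)
    qed
    have D: "(\<Delta> n m j \<omega>) ^ 4 \<le> a n" if "j < 2 ^ m" for n m j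
    proof -
      have "ennreal ((\<Delta> n m j \<omega>) ^ 4) \<le> (\<Sum>j<2 ^ m. ennreal ((\<Delta> n m j \<omega>) ^ 4))"
        using that member_le_sum[of j "{..<2 ^ m}" "\<lambda>j. ennreal ((\<Delta> n m j \<omega>) ^ 4)"] by simp
      also have "\<dots> \<le> (\<Sum>m. \<Sum>j<2 ^ m. ennreal ((\<Delta> n m j \<omega>) ^ 4))"
        using sum_le_suminf[of "\<lambda>m. \<Sum>j<2 ^ m. ennreal ((\<Delta> n m j \<omega>) ^ 4)" "{m}"] by (simp add: summableI)
      also have "\<dots> \<le> A n \<omega>" unfolding A_def by simp
      finally show ?thesis unfolding a by (simp add: a_def)
    qed
    show ?case
    proof (rule tendstoI)
      fix e :: real assume e: "0 < e"
      define \<epsilon> where "\<epsilon> = e / 25"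
      have \<epsilon>: "0 < \<epsilon>" using e by (simp add: \<epsilon>_def)
      have "\<forall>\<^sub>F n in sequentially. a n < \<epsilon> ^ 4"
        using a0 \<epsilon> by (intro order_tendstoD) auto
      then obtain N where N: "\<And>n. N \<le> n \<Longrightarrow> a n < \<epsilon> ^ 4" by (auto simp: eventually_sequentially)
      have root: "\<bar>x\<bar> \<le> \<epsilon>" if "x ^ 4 \<le> a n" "N \<le> n" for x n
      proof -
        have "\<bar>x\<bar> ^ 4 \<le> \<epsilon> ^ 4" using that N[of n] by simp
        thus ?thesis using \<epsilon> power_mono_iff[of "\<bar>x\<bar>" \<epsilon> 4] by simp
      qed
      have bound: "\<bar>W u \<omega>\<bar> \<le> 24 * \<epsilon> * u" if u: "max 1 (real N) \<le> u" for u
      proof -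
        define n where "n = nat \<lfloor>u\<rfloor>"
        have "1 \<le> \<lfloor>u\<rfloor>" using u by simp
        hence "1 \<le> n" unfolding n_def by linarith
        moreover have "real n \<le> u" "u \<le> real n + 1" "N \<le> n" using u unfolding n_def by linarith+
        ultimately have n: "real n \<le> u" "u \<le> real n + 1" "N \<le> n" "1 \<le> real n" by simp_all
        define g where "g = (\<lambda>s. W (real n + s) \<omega>)"
        have "\<bar>g (u - n) - g 0\<bar> \<le> 11 * (\<epsilon> * (real n + 1))"
        proof (rule dyadic_chaining)
          show "continuous_on {0..1} g" unfolding g_def
            by (rule continuous_on_compose2[OF elim(2)]) (auto intro!: continuous_intros)
          fix m j :: nat assume "j < 2 ^ m"
          from root[OF D[OF this] n(3)] have "\<bar>\<Delta> n m j \<omega>\<bar> \<le> \<epsilon>" .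
          hence "\<bar>g ((real j + 1) / 2 ^ m) - g (real j / 2 ^ m)\<bar> * ((11 / 10) ^ m / (real n + 1)) \<le> \<epsilon>"
            by (simp add: \<Delta>_def g_def abs_mult)
          hence "\<bar>g ((real j + 1) / 2 ^ m) - g (real j / 2 ^ m)\<bar> \<le> \<epsilon> / ((11 / 10) ^ m / (real n + 1))"
            by (subst pos_le_divide_eq) auto
          thus "\<bar>g ((real j + 1) / 2 ^ m) - g (real j / 2 ^ m)\<bar> \<le> \<epsilon> * (real n + 1) * (10 / 11) ^ m"
            by (simp add: power_divide ac_simps)
        qed (use \<epsilon> n in auto)
        moreover have "\<bar>W (real n) \<omega>\<bar> \<le> \<epsilon> * (real n + 1)"
        proof -
          have "\<bar>\<Gamma> n \<omega>\<bar> \<le> \<epsilon>" using root[OF G n(3)] .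
          thus ?thesis using elim(1) by (simp add: \<Gamma>_def abs_mult divide_le_eq)
        qed
        ultimately have "\<bar>W u \<omega>\<bar> \<le> 12 * (\<epsilon> * (real n + 1))" by (simp add: g_def)
        also have "\<dots> \<le> 12 * (\<epsilon> * (2 * u))" using n \<epsilon> by (intro mult_left_mono) auto
        finally show ?thesis by simp
      qed
      show "\<forall>\<^sub>F u in at_top. dist (W u \<omega> / u) 0 < e"
        using eventually_ge_at_top[of "max 1 (real N)"]
      proof eventually_elim
        case (elim u)
        have "\<bar>W u \<omega>\<bar> / u \<le> 24 * \<epsilon>" using bound[OF elim] elim by (simp add: divide_le_eq)
        moreover have "24 * \<epsilon> < e" using e by (simp add: \<epsilon>_def)
        moreover have "dist (W u \<omega> / u) 0 = \<bar>W u \<omega>\<bar> / u" using elim by simp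
        ultimately show ?case by linarith
      qed
    qed
  qed
qed

end

section \<open>Time integrals of processes\<close>

text \<open>
  Fubini's theorem for a process on \<open>[0, t]\<close>. The hypotheses concern times before \<open>t\<close>, as the error
  formulas of the bridges hold before \<open>T\<close>; the end point is a null set.
\<close>

lemma (in prob_space) has_bochner_integral_process_integral:
  fixes Z :: "real \<Rightarrow> 'a \<Rightarrow> real"
  assumes meas: "(\<lambda>(\<omega>, s). Z s \<omega>) \<in> borel_measurable (M \<Otimes>\<^sub>M borel)"
    and mean: "\<And>s. 0 \<le> s \<Longrightarrow> s < t \<Longrightarrow> has_bochner_integral M (Z s) (e s)"
    and bound: "\<And>s. 0 \<le> s \<Longrightarrow> s < t \<Longrightarrow> (\<integral>\<omega>. \<bar>Z s \<omega>\<bar> \<partial>M) \<le> C"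
  shows "has_bochner_integral M (\<lambda>\<omega>. LBINT s:{0..t}. Z s \<omega>) (LBINT s:{0..t}. e s)"
proof -
  define f where "f = (\<lambda>s \<omega>. indicator {0..<t} s * Z s \<omega>)"
  interpret L: pair_sigma_finite lborel M ..
  have "(\<lambda>z. (snd z, fst z)) \<in> lborel \<Otimes>\<^sub>M M \<rightarrow>\<^sub>M M \<Otimes>\<^sub>M (borel :: real measure)"
    by (intro measurable_Pair) auto
  from measurable_compose[OF this meas] have Zm[measurable]: "(\<lambda>z. Z (fst z) (snd z)) \<in> borel_measurable (lborel \<Otimes>\<^sub>M M)"
    by (simp add: case_prod_beta')
  have fm: "case_prod f \<in> borel_measurable (lborel \<Otimes>\<^sub>M M)"
    unfolding f_def case_prod_beta' by measurable
  have "(\<integral>\<^sup>+z. ennreal (norm (case_prod f z)) \<partial>(lborel \<Otimes>\<^sub>M M)) = (\<integral>\<^sup>+s. (\<integral>\<^sup>+\<omega>. ennreal (norm (f s \<omega>)) \<partial>M) \<partial>lborel)"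
    using fm by (subst nn_integral_fst[symmetric]) (auto simp: case_prod_beta')
  also have "\<dots> \<le> (\<integral>\<^sup>+s. ennreal (max 0 C) * indicator {0..t} s \<partial>lborel)"
  proof (rule nn_integral_mono)
    fix s :: real
    show "(\<integral>\<^sup>+\<omega>. ennreal (norm (f s \<omega>)) \<partial>M) \<le> ennreal (max 0 C) * indicator {0..t} s"
    proof (cases "0 \<le> s \<and> s < t")
      case True
      have "integrable M (\<lambda>\<omega>. \<bar>Z s \<omega>\<bar>)"
        using mean[of s] True by (auto simp: has_bochner_integral_iff)
      hence "(\<integral>\<^sup>+\<omega>. ennreal (norm (f s \<omega>)) \<partial>M) = ennreal (\<integral>\<omega>. \<bar>Z s \<omega>\<bar> \<partial>M)"
        using True by (subst nn_integral_eq_integral[symmetric]) (auto simp: f_def)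
      also have "\<dots> \<le> ennreal (max 0 C)"
        using bound[of s] True by (intro ennreal_leI) auto
      finally show ?thesis using True by simp
    qed (auto simp: f_def)
  qed
  also have "\<dots> < \<infinity>"
    by (subst nn_integral_cmult_indicator) (auto simp: ennreal_mult_less_top emeasure_lborel_Icc_eq)
  finally have int: "integrable (lborel \<Otimes>\<^sub>M M) (case_prod f)"
    using fm by (intro integrableI_bounded) auto
  have AEs: "AE s in lborel. s \<noteq> t" by (rule AE_lborel_singleton)
  have inner: "(\<integral>s. f s \<omega> \<partial>lborel) = (LBINT s:{0..t}. Z s \<omega>)" if "\<omega> \<in> space M" for \<omega>
    unfolding set_lebesgue_integral_def
  proof (rule integral_cong_AE)
    have [measurable]: "(\<lambda>s. Z s \<omega>) \<in> borel_measurable lborel"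
      using measurable_compose[OF measurable_Pair[OF measurable_const[OF that] measurable_ident_sets[OF sets_lborel]] meas]
      by simp
    show "(\<lambda>s. f s \<omega>) \<in> borel_measurable lborel" "(\<lambda>s. indicator {0..t} s *\<^sub>R Z s \<omega>) \<in> borel_measurable lborel"
      unfolding f_def by measurable
    show "AE s in lborel. f s \<omega> = indicator {0..t} s *\<^sub>R Z s \<omega>"
      using AEs by eventually_elim (auto simp: f_def indicator_def)
  qed
  have outer: "(\<integral>s. (\<integral>\<omega>. f s \<omega> \<partial>M) \<partial>lborel) = (LBINT s:{0..t}. e s)"
  proof -
    have eq: "(\<integral>\<omega>. f s \<omega> \<partial>M) = indicator {0..<t} s * e s" for s
      using mean[of s] by (auto simp: f_def indicator_def has_bochner_integral_iff)
    have "(\<lambda>s. \<integral>\<omega>. f s \<omega> \<partial>M) \<in> borel_measurable lborel"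
      using fm by (intro borel_measurable_lebesgue_integral) auto
    hence [measurable]: "(\<lambda>s. indicator {0..<t} s * e s) \<in> borel_measurable lborel" unfolding eq .
    have "(\<integral>s. (\<integral>\<omega>. f s \<omega> \<partial>M) \<partial>lborel) = (\<integral>s. indicator {0..<t} s * e s \<partial>lborel)"
      unfolding eq ..
    also have "\<dots> = (\<integral>s. indicator {0..<t} s * e s + indicator {t} s * (if 0 \<le> t then e t else 0) \<partial>lborel)"
    proof (rule integral_cong_AE)
      show "(\<lambda>s. indicator {0..<t} s * e s) \<in> borel_measurable lborel"
        "(\<lambda>s. indicator {0..<t} s * e s + indicator {t} s * (if 0 \<le> t then e t else 0)) \<in> borel_measurable lborel"
        by measurable
      show "AE s in lborel. indicator {0..<t} s * e s = indicator {0..<t} s * e s + indicator {t} s * (if 0 \<le> t then e t else 0)"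
        using AEs by eventually_elim simp
    qed
    also have "\<dots> = (LBINT s:{0..t}. e s)"
      unfolding set_lebesgue_integral_def by (intro Bochner_Integration.integral_cong) (auto simp: indicator_def)
    finally show ?thesis .
  qed
  have "integrable M (\<lambda>\<omega>. \<integral>s. f s \<omega> \<partial>lborel)" using L.integrable_snd[OF int] .
  moreover have "(\<integral>\<omega>. (\<integral>s. f s \<omega> \<partial>lborel) \<partial>M) = (\<integral>s. (\<integral>\<omega>. f s \<omega> \<partial>M) \<partial>lborel)"
    by (rule L.Fubini_integral[OF int])
  ultimately have "has_bochner_integral M (\<lambda>\<omega>. \<integral>s. f s \<omega> \<partial>lborel) (LBINT s:{0..t}. e s)"
    unfolding outer by (simp add: has_bochner_integral_iff)
  thus ?thesis by (subst has_bochner_integral_cong[OF refl inner[symmetric] refl]) auto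
qed

text \<open>
  The coefficients of this quadratic expansion depend on the products \<open>D\<^sub>i D\<^sub>j\<close>, \<open>D\<^sub>i R\<close> and \<open>R\<^sup>2\<close> only.
  It is used both for increments of \<open>W\<close> and for indicators of intervals, whose products have the
  same integrals.
\<close>

lemma has_bochner_integral_square_linear_combination:
  fixes D :: "nat \<Rightarrow> 'a \<Rightarrow> real"
  assumes D: "\<And>i j. i < n \<Longrightarrow> j < n \<Longrightarrow> has_bochner_integral N (\<lambda>x. D i x * D j x) (a i j)"
    and DR: "\<And>i. i < n \<Longrightarrow> has_bochner_integral N (\<lambda>x. D i x * R x) (v i)"
    and R: "has_bochner_integral N (\<lambda>x. (R x)\<^sup>2) e"
  shows "has_bochner_integral N (\<lambda>x. ((\<Sum>i<n. c i * D i x) - R x)\<^sup>2)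
    ((\<Sum>i<n. \<Sum>j<n. c i * c j * a i j) - 2 * (\<Sum>i<n. c i * v i) + e)"
proof -
  have eq: "((\<Sum>i<n. c i * D i x) - R x)\<^sup>2
     = (\<Sum>i<n. \<Sum>j<n. c i * c j * (D i x * D j x)) - 2 * (\<Sum>i<n. c i * (D i x * R x)) + (R x)\<^sup>2" for x
  proof -
    have "(\<Sum>i<n. c i * D i x) * (\<Sum>i<n. c i * D i x) = (\<Sum>i<n. \<Sum>j<n. c i * c j * (D i x * D j x))"
      by (simp add: sum_product ac_simps)
    moreover have "(\<Sum>i<n. c i * D i x) * R x = (\<Sum>i<n. c i * (D i x * R x))"
      unfolding sum_distrib_right by (simp add: mult.assoc)
    moreover have "(A - B)\<^sup>2 = A * A - 2 * (A * B) + B\<^sup>2" for A B :: real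
      by (simp add: power2_eq_square algebra_simps)
    ultimately show ?thesis by (simp only:)
  qed
  show ?thesis unfolding eq
    by (intro has_bochner_integral_add has_bochner_integral_diff has_bochner_integral_sum
        has_bochner_integral_mult_right R D DR) auto
qed

text \<open>
  A version \<open>w\<close> of \<open>W\<close> without exceptional points: all its paths are continuous and of sublinear
  growth. Its times range over all reals, so that no boundary has to be treated.
\<close>

locale continuous_wiener = wiener_process M W for M :: "'a measure" and W +
  fixes w :: "real \<Rightarrow> 'a \<Rightarrow> real"
  assumes w_measurable: "\<And>t. w t \<in> borel_measurable M"
    and w_continuous: "\<And>\<omega>. \<omega> \<in> space M \<Longrightarrow> continuous_on UNIV (\<lambda>t. w t \<omega>)"
    and w_sublinear: "\<And>\<omega>. \<omega> \<in> space M \<Longrightarrow> ((\<lambda>u. w u \<omega> / u) \<longlongrightarrow> 0) at_top"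
    and w_AE: "AE \<omega> in M. \<forall>t\<ge>0. w t \<omega> = W t \<omega>"
begin

lemma w_covariance:
  assumes "0 \<le> s" "0 \<le> t" shows "has_bochner_integral M (\<lambda>\<omega>. w s \<omega> * w t \<omega>) (min s t)"
proof -
  have ae: "AE \<omega> in M. w s \<omega> * w t \<omega> = W s \<omega> * W t \<omega>"
    using w_AE by eventually_elim (use assms in auto)
  show ?thesis
    using W_covariance[OF assms] w_measurable W_measurable assms
    by (subst has_bochner_integral_cong_AE[OF _ _ ae]) auto
qed

lemma w_mean:
  assumes "0 \<le> t" shows "has_bochner_integral M (w t) 0"
proof -
  have ae: "AE \<omega> in M. w t \<omega> = W t \<omega>"
    using w_AE by eventually_elim (use assms in auto)
  show ?thesis
    using W_mean[OF assms] w_measurable W_measurable assms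
    by (subst has_bochner_integral_cong_AE[OF _ _ ae]) auto
qed

lemma w_joint_measurable: "(\<lambda>(\<omega>, t). w t \<omega>) \<in> borel_measurable (M \<Otimes>\<^sub>M borel)"
  by (intro borel_measurable_pair_continuous_paths w_measurable w_continuous)

lemma w_product_bound:
  assumes "0 \<le> s" "0 \<le> u" shows "(\<integral>\<omega>. \<bar>w s \<omega> * w u \<omega>\<bar> \<partial>M) \<le> s + u"
proof -
  have "(\<integral>\<omega>. \<bar>w s \<omega> * w u \<omega>\<bar> \<partial>M) \<le> (\<integral>\<omega>. w s \<omega> * w s \<omega> + w u \<omega> * w u \<omega> \<partial>M)"
  proof (rule integral_mono)
    show "integrable M (\<lambda>\<omega>. \<bar>w s \<omega> * w u \<omega>\<bar>)" "integrable M (\<lambda>\<omega>. w s \<omega> * w s \<omega> + w u \<omega> * w u \<omega>)"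
      using w_covariance[OF assms] w_covariance[OF assms(1) assms(1)] w_covariance[OF assms(2) assms(2)]
      by (auto simp: has_bochner_integral_iff)
    fix \<omega>
    have "0 \<le> (\<bar>w s \<omega>\<bar> - \<bar>w u \<omega>\<bar>)\<^sup>2" by simp
    hence "0 \<le> (w s \<omega>)\<^sup>2 + (w u \<omega>)\<^sup>2 - 2 * \<bar>w s \<omega>\<bar> * \<bar>w u \<omega>\<bar>"
      unfolding power2_diff by simp
    hence "2 * (\<bar>w s \<omega>\<bar> * \<bar>w u \<omega>\<bar>) \<le> w s \<omega> * w s \<omega> + w u \<omega> * w u \<omega>"
      by (simp add: power2_eq_square)
    moreover have "0 \<le> \<bar>w s \<omega>\<bar> * \<bar>w u \<omega>\<bar>" by simp
    ultimately show "\<bar>w s \<omega> * w u \<omega>\<bar> \<le> w s \<omega> * w s \<omega> + w u \<omega> * w u \<omega>"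
      unfolding abs_mult by linarith
  qed
  also have "\<dots> = s + u"
    using has_bochner_integral_add[OF w_covariance[OF assms(1) assms(1)] w_covariance[OF assms(2) assms(2)]]
    by (simp add: has_bochner_integral_iff)
  finally show ?thesis .
qed

end

section \<open>The pathwise form of the integral representation\<close>

text \<open>
  The kernel \<open>1 / (T - s)\<close> of the integral representation has the derivative \<open>1 / (T - s)\<^sup>2\<close>, which is
  the weight that integration by parts produces.
\<close>

definition wint :: "real \<Rightarrow> (real \<Rightarrow> real) \<Rightarrow> real \<Rightarrow> real" where
  "wint T k r = integral {0..r} (\<lambda>s. k s / (T - s)\<^sup>2)"

text \<open>
  Formally this is \<open>\<integral>\<^sub>0\<^sup>t ((T - t) / (T - s)) dk(s)\<close> for \<open>k(0) = 0\<close>, integrated by parts, with its limit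
  0 at the time \<open>T\<close>.
\<close>

definition bridge_op :: "real \<Rightarrow> (real \<Rightarrow> real) \<Rightarrow> real \<Rightarrow> real" where
  "bridge_op T k t = (if t < T then k t - (T - t) * wint T k t else 0)"

lemma continuous_on_weight:
  fixes k :: "real \<Rightarrow> real"
  assumes "continuous_on {0..r} k" "r < T"
  shows "continuous_on {0..r} (\<lambda>s. k s / (T - s)\<^sup>2)"
  using assms by (intro continuous_intros) auto

lemma wint_DERIV_within:
  assumes "continuous_on {0..t} k" "t < T" "r \<in> {0..t}"
  shows "(wint T k has_real_derivative k r / (T - r)\<^sup>2) (at r within {0..t})"
  unfolding wint_def
  by (rule integral_has_real_derivative[OF continuous_on_weight]) (use assms in auto)

lemma wint_DERIV:
  assumes "continuous_on {0..<T} k" "0 < r" "r < T"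
  shows "(wint T k has_real_derivative k r / (T - r)\<^sup>2) (at r)"
proof -
  define t where "t = (r + T) / 2"
  have t: "r < t" "t < T" using assms by (auto simp: t_def)
  have "(wint T k has_real_derivative k r / (T - r)\<^sup>2) (at r within {0..t})"
    by (rule wint_DERIV_within) (use assms t in \<open>auto intro: continuous_on_subset\<close>)
  hence "(wint T k has_real_derivative k r / (T - r)\<^sup>2) (at r within {0<..<t})"
    by (rule DERIV_subset) auto
  thus ?thesis using assms t by (subst (asm) at_within_open) auto
qed

lemma wint_continuous_on:
  assumes "continuous_on {0..t} k" "t < T"
  shows "continuous_on {0..t} (wint T k)"
  by (rule DERIV_continuous_on[OF wint_DERIV_within[OF assms]])

lemma wint_continuous_on_lessThan:
  assumes "continuous_on {0..<T} k"
  shows "continuous_on {0..<T} (wint T k)"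
proof (unfold continuous_on_eq_continuous_within, intro ballI)
  fix r assume r: "r \<in> {0..<T}"
  define t where "t = (r + T) / 2"
  have t: "r < t" "t < T" using r by (auto simp: t_def)
  have "continuous_on {0..t} (wint T k)"
    by (rule wint_continuous_on) (use assms t in \<open>auto intro: continuous_on_subset\<close>)
  hence "continuous (at r within {0..t}) (wint T k)"
    using r t by (simp add: continuous_on_eq_continuous_within)
  moreover have "at r within {0..t} = at r within {0..<T}"
    by (rule at_within_nhd[where S="{..<t}"]) (use r t in auto)
  ultimately show "continuous (at r within {0..<T}) (wint T k)" by (simp add: continuous_within)
qed

lemma wint_linear:
  assumes "continuous_on {0..r} k" "continuous_on {0..r} l" "r < T"
  shows "wint T (\<lambda>s. k s + c * l s) r = wint T k r + c * wint T l r"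
proof -
  have i: "(\<lambda>s. k s / (T - s)\<^sup>2) integrable_on {0..r}" "(\<lambda>s. l s / (T - s)\<^sup>2) integrable_on {0..r}"
    using assms by (auto intro!: integrable_continuous_real continuous_on_weight)
  have "(\<lambda>s. (k s + c * l s) / (T - s)\<^sup>2) = (\<lambda>s. k s / (T - s)\<^sup>2 + c * (l s / (T - s)\<^sup>2))"
    by (simp add: add_divide_distrib)
  hence "wint T (\<lambda>s. k s + c * l s) r = integral {0..r} (\<lambda>s. k s / (T - s)\<^sup>2 + c * (l s / (T - s)\<^sup>2))"
    by (simp add: wint_def)
  also have "\<dots> = integral {0..r} (\<lambda>s. k s / (T - s)\<^sup>2) + integral {0..r} (\<lambda>s. c * (l s / (T - s)\<^sup>2))"
    by (intro Henstock_Kurzweil_Integration.integral_add i integrable_on_mult_right)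
  also have "integral {0..r} (\<lambda>s. c * (l s / (T - s)\<^sup>2)) = c * integral {0..r} (\<lambda>s. l s / (T - s)\<^sup>2)"
    by (rule Henstock_Kurzweil_Integration.integral_mult_right)
  finally show ?thesis unfolding wint_def .
qed

lemma wint_cong: "(\<And>s. s \<in> {0..r} \<Longrightarrow> k s = l s) \<Longrightarrow> wint T k r = wint T l r"
  unfolding wint_def by (intro Henstock_Kurzweil_Integration.integral_cong) auto

lemma set_integral_eq_wint:
  assumes "continuous_on {0..r} k" "r < T"
  shows "(LBINT s:{0..r}. k s / (T - s)\<^sup>2) = wint T k r"
  unfolding wint_def
  by (intro set_borel_integral_eq_integral(2) borel_integrable_atLeastAtMost' continuous_on_weight assms)

text \<open>
  By L'Hospital's rule, as \<open>1 / (T - t)\<close> is the integral of the weight up to a constant.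
\<close>

lemma wint_scaled_tendsto:
  assumes k: "continuous_on {0..T} k" and T: "0 < T"
  shows "((\<lambda>t. (T - t) * wint T k t) \<longlongrightarrow> k T) (at_left T)"
proof -
  have ev: "\<forall>\<^sub>F t in at_left T. 0 < t \<and> t < T"
    using T by (intro eventually_conj) (auto simp: eventually_at_left_field intro!: exI[of _ 0])
  have "((\<lambda>t. wint T k t / (1 / (T - t))) \<longlongrightarrow> k T) (at_left T)"
  proof (rule lhopital_left_at_top[where f'="\<lambda>t. k t / (T - t)\<^sup>2" and g'="\<lambda>t. 1 / (T - t)\<^sup>2"])
    have "((\<lambda>t. T - t) \<longlongrightarrow> T - T) (at_left T)" by (intro tendsto_intros)
    hence "filterlim (\<lambda>t. T - t) (at_right 0) (at_left T)"
      unfolding filterlim_at by (auto intro: eventually_mono[OF ev])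
    from filterlim_compose[OF filterlim_inverse_at_top_right this]
    show "LIM t at_left T. 1 / (T - t) :> at_top" by (simp add: inverse_eq_divide)
    show "\<forall>\<^sub>F t in at_left T. 1 / (T - t)\<^sup>2 \<noteq> 0" using ev by eventually_elim auto
    show "\<forall>\<^sub>F t in at_left T. (wint T k has_real_derivative k t / (T - t)\<^sup>2) (at t)"
      using ev
    proof eventually_elim
      case (elim t)
      show ?case by (rule wint_DERIV) (use elim k in \<open>auto intro: continuous_on_subset\<close>)
    qed
    show "\<forall>\<^sub>F t in at_left T. ((\<lambda>t. 1 / (T - t)) has_real_derivative 1 / (T - t)\<^sup>2) (at t)"
      using ev
    proof eventually_elim
      case (elim t)
      thus ?case by (auto intro!: derivative_eq_intros simp: power2_eq_square)
    qed
    have "(k \<longlongrightarrow> k T) (at T within {0..T})"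
      using k T by (simp add: continuous_on_def)
    hence "(k \<longlongrightarrow> k T) (at_left T)"
      using T by (simp add: at_within_Icc_at_left)
    moreover have "\<forall>\<^sub>F t in at_left T. k t / (T - t)\<^sup>2 / (1 / (T - t)\<^sup>2) = k t"
      using ev by eventually_elim simp
    ultimately show "((\<lambda>t. k t / (T - t)\<^sup>2 / (1 / (T - t)\<^sup>2)) \<longlongrightarrow> k T) (at_left T)"
      by (simp add: filterlim_cong)
  qed
  thus ?thesis by (simp add: mult.commute)
qed

lemma bridge_op_continuous_on:
  assumes k: "continuous_on {0..T} k" and T: "0 < T"
  shows "continuous_on {0..T} (bridge_op T k)"
proof (unfold continuous_on_def, intro ballI)
  fix t assume t: "t \<in> {0..T}"
  show "(bridge_op T k \<longlongrightarrow> bridge_op T k t) (at t within {0..T})"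
  proof (cases "t < T")
    case True
    have c: "continuous_on {0..<T} (\<lambda>t. k t - (T - t) * wint T k t)"
      by (intro continuous_intros wint_continuous_on_lessThan continuous_on_subset[OF k]) auto
    hence "((\<lambda>t. k t - (T - t) * wint T k t) \<longlongrightarrow> k t - (T - t) * wint T k t) (at t within {0..<T})"
      using t True by (simp add: continuous_on_def)
    moreover have "at t within {0..<T} = at t within {0..T}"
      by (rule at_within_nhd[where S="{..<T}"]) (use t True in auto)
    moreover have "\<forall>\<^sub>F s in at t within {0..T}. k s - (T - s) * wint T k s = bridge_op T k s"
      unfolding eventually_at_topological
      by (rule exI[of _ "{..<T}"]) (use True in \<open>auto simp: bridge_op_def\<close>)
    ultimately have "(bridge_op T k \<longlongrightarrow> k t - (T - t) * wint T k t) (at t within {0..T})"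
      by (simp add: tendsto_cong)
    thus ?thesis using True by (simp add: bridge_op_def)
  next
    case False
    hence t': "t = T" using t by simp
    have "(k \<longlongrightarrow> k T) (at T within {0..T})"
      using k T by (simp add: continuous_on_def)
    hence kt: "(k \<longlongrightarrow> k T) (at_left T)"
      using T by (simp add: at_within_Icc_at_left)
    have "((\<lambda>t. k t - (T - t) * wint T k t) \<longlongrightarrow> k T - k T) (at_left T)"
      by (intro tendsto_diff kt wint_scaled_tendsto k T)
    moreover have "\<forall>\<^sub>F t in at_left T. k t - (T - t) * wint T k t = bridge_op T k t"
      by (auto simp: eventually_at_left_field bridge_op_def intro!: exI[of _ 0] T)
    ultimately have "(bridge_op T k \<longlongrightarrow> k T - k T) (at_left T)"
      by (rule tendsto_cong[THEN iffD1, rotated])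
    hence "(bridge_op T k \<longlongrightarrow> 0) (at_left T)" by simp
    thus ?thesis using T unfolding t' by (simp add: at_within_Icc_at_left bridge_op_def)
  qed
qed

lemma bridge_op_linear:
  assumes "continuous_on {0..T} k" "continuous_on {0..T} l" "0 \<le> t"
  shows "bridge_op T (\<lambda>s. k s + c * l s) t = bridge_op T k t + c * bridge_op T l t"
proof (cases "t < T")
  case True
  have "wint T (\<lambda>s. k s + c * l s) t = wint T k t + c * wint T l t"
    by (rule wint_linear) (use True assms in \<open>auto intro: continuous_on_subset\<close>)
  thus ?thesis using True by (simp add: bridge_op_def algebra_simps)
qed (simp add: bridge_op_def)

lemma measurable_wint:
  fixes w :: "real \<Rightarrow> 'c \<Rightarrow> real"
  assumes m: "\<And>t. w t \<in> borel_measurable N"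
    and c: "\<And>\<omega>. \<omega> \<in> space N \<Longrightarrow> continuous_on UNIV (\<lambda>t. w t \<omega>)" and r: "r < T"
  shows "(\<lambda>\<omega>. wint T (\<lambda>s. w s \<omega>) r) \<in> borel_measurable N"
proof -
  have "(\<lambda>(\<omega>, s). w s \<omega>) \<in> borel_measurable (N \<Otimes>\<^sub>M borel)"
    by (rule borel_measurable_pair_continuous_paths[OF m c])
  hence "(\<lambda>(\<omega>, s). w s \<omega>) \<in> borel_measurable (N \<Otimes>\<^sub>M lborel)"
    by (simp cong: measurable_cong_sets sets_pair_measure_cong)
  hence [measurable]: "(\<lambda>z. w (snd z) (fst z)) \<in> borel_measurable (N \<Otimes>\<^sub>M lborel)"
    by (simp add: case_prod_beta')
  have "(\<lambda>\<omega>. LBINT s:{0..r}. w s \<omega> / (T - s)\<^sup>2) \<in> borel_measurable N"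
    unfolding set_lebesgue_integral_def
    by (rule lborel.borel_measurable_lebesgue_integral) (unfold case_prod_beta', measurable)
  moreover have "(LBINT s:{0..r}. w s \<omega> / (T - s)\<^sup>2) = wint T (\<lambda>s. w s \<omega>) r" if "\<omega> \<in> space N" for \<omega>
    by (rule set_integral_eq_wint) (use c[OF that] r in \<open>auto intro: continuous_on_subset\<close>)
  ultimately show ?thesis by (simp cong: measurable_cong)
qed

lemma wint_identity:
  assumes "0 \<le> r" "r < T"
  shows "wint T (\<lambda>s. s) r = r / (T - r) + ln ((T - r) / T)"
proof -
  have "((\<lambda>s. s / (T - s)\<^sup>2) has_integral (r / (T - r) + ln ((T - r) / T)) - (0 / (T - 0) + ln ((T - 0) / T))) {0..r}"
  proof (rule fundamental_theorem_of_calculus)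
    fix s assume s: "s \<in> {0..r}"
    have "((\<lambda>s. s / (T - s) + ln ((T - s) / T)) has_real_derivative s / (T - s)\<^sup>2) (at s)"
    proof -
      have "((\<lambda>s. s / (T - s)) has_real_derivative T / (T - s)\<^sup>2) (at s)"
        using s assms by (auto intro!: derivative_eq_intros simp: power2_eq_square)
      moreover have "((\<lambda>s. ln ((T - s) / T)) has_real_derivative - (1 / (T - s))) (at s)"
        using s assms by (auto intro!: derivative_eq_intros simp: field_simps)
      ultimately have "((\<lambda>s. s / (T - s) + ln ((T - s) / T)) has_real_derivative T / (T - s)\<^sup>2 + - (1 / (T - s))) (at s)"
        by (rule DERIV_add)
      moreover have "T / (T - s)\<^sup>2 + - (1 / (T - s)) = s / (T - s)\<^sup>2"
        using s assms by (simp add: divide_simps power2_eq_square)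
      ultimately show ?thesis by simp
    qed
    thus "((\<lambda>s. s / (T - s) + ln ((T - s) / T)) has_vector_derivative s / (T - s)\<^sup>2) (at s within {0..r})"
      by (simp add: has_real_derivative_iff_has_vector_derivative has_vector_derivative_at_within)
  qed (use assms in auto)
  thus ?thesis using assms by (simp add: wint_def integral_unique)
qed

text \<open>
  The covariance of the weighted integral with \<open>W\<^sub>u\<close>, since \<open>min s u\<close> is the covariance of \<open>W\<close>.
\<close>

lemma wint_min:
  assumes "0 \<le> u" "u \<le> t" "t < T"
  shows "wint T (\<lambda>s. min s u) t = ln ((T - u) / T) + u / (T - t)"
proof -
  have c: "(\<lambda>s. min s u / (T - s)\<^sup>2) integrable_on {0..t}"
    using assms by (intro integrable_continuous_real continuous_on_weight continuous_intros) auto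
  have "wint T (\<lambda>s. min s u) t = integral {0..u} (\<lambda>s. min s u / (T - s)\<^sup>2) + integral {u..t} (\<lambda>s. min s u / (T - s)\<^sup>2)"
    unfolding wint_def using assms c by (intro Henstock_Kurzweil_Integration.integral_combine[symmetric]) auto
  also have "integral {0..u} (\<lambda>s. min s u / (T - s)\<^sup>2) = wint T (\<lambda>s. s) u"
    unfolding wint_def by (intro Henstock_Kurzweil_Integration.integral_cong) auto
  also have "\<dots> = u / (T - u) + ln ((T - u) / T)" using assms by (intro wint_identity) auto
  also have "integral {u..t} (\<lambda>s. min s u / (T - s)\<^sup>2) = integral {u..t} (\<lambda>s. u / (T - s)\<^sup>2)"
    by (intro Henstock_Kurzweil_Integration.integral_cong) auto
  also have "\<dots> = u / (T - t) - u / (T - u)"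
  proof (rule integral_unique, rule fundamental_theorem_of_calculus)
    fix s assume s: "s \<in> {u..t}"
    have "((\<lambda>s. u / (T - s)) has_real_derivative u / (T - s)\<^sup>2) (at s)"
      using s assms by (auto intro!: derivative_eq_intros simp: power2_eq_square)
    thus "((\<lambda>s. u / (T - s)) has_vector_derivative u / (T - s)\<^sup>2) (at s within {u..t})"
      by (simp add: has_real_derivative_iff_has_vector_derivative has_vector_derivative_at_within)
  qed (use assms in auto)
  finally show ?thesis by simp
qed

text \<open>
  Half the second moment of the weighted integral of \<open>W\<close>; see \<open>J_square\<close>.
\<close>

lemma wint_wint_identity:
  assumes "0 \<le> t" "t < T"
  shows "wint T (\<lambda>r. wint T (\<lambda>s. s) r) t = wint T (\<lambda>s. s) t / (T - t) - t\<^sup>2 / (2 * T * (T - t)\<^sup>2)"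
proof -
  let ?\<Psi> = "\<lambda>r. wint T (\<lambda>s. s) r / (T - r) - r\<^sup>2 / (2 * T * (T - r)\<^sup>2)"
  have "((\<lambda>r. wint T (\<lambda>s. s) r / (T - r)\<^sup>2) has_integral ?\<Psi> t - ?\<Psi> 0) {0..t}"
  proof (rule fundamental_theorem_of_calculus)
    fix r assume r: "r \<in> {0..t}"
    have [derivative_intros]: "(wint T (\<lambda>s. s) has_real_derivative r / (T - r)\<^sup>2) (at r within {0..t})"
      using r assms by (intro wint_DERIV_within continuous_intros) auto
    have d1: "((\<lambda>r. wint T (\<lambda>s. s) r / (T - r)) has_real_derivative (r / (T - r)\<^sup>2 * (T - r) - wint T (\<lambda>s. s) r * (- 1)) / ((T - r) * (T - r))) (at r within {0..t})"
      using r assms by (auto intro!: derivative_eq_intros)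
    have d2: "((\<lambda>r. r\<^sup>2 / (2 * T * (T - r)\<^sup>2)) has_real_derivative (r / (T - r) ^ 3)) (at r)"
      using r assms by (auto intro!: derivative_eq_intros simp: divide_simps) (simp add: algebra_simps power2_eq_square power3_eq_cube)?
    have "(?\<Psi> has_real_derivative (r / (T - r)\<^sup>2 * (T - r) - wint T (\<lambda>s. s) r * (- 1)) / ((T - r) * (T - r)) - r / (T - r) ^ 3) (at r within {0..t})"
      by (rule DERIV_diff[OF d1 has_field_derivative_at_within[OF d2]])
    moreover have "(r / (T - r)\<^sup>2 * (T - r) - wint T (\<lambda>s. s) r * (- 1)) / ((T - r) * (T - r)) - r / (T - r) ^ 3 = wint T (\<lambda>s. s) r / (T - r)\<^sup>2"
      using r assms by (simp add: add_divide_distrib power2_eq_square power3_eq_cube)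
    ultimately show "(?\<Psi> has_vector_derivative wint T (\<lambda>s. s) r / (T - r)\<^sup>2) (at r within {0..t})"
      by (simp add: has_real_derivative_iff_has_vector_derivative)
  qed (use assms in auto)
  thus ?thesis using assms by (simp add: wint_def[of T "wint T (\<lambda>s. s)"] integral_unique) (simp add: wint_def)
qed

section \<open>Integration by parts for the stochastic integral\<close>

lemma wint_mult_right: "wint T (\<lambda>s. k s * c) r = wint T k r * c"
  unfolding wint_def by (simp flip: Henstock_Kurzweil_Integration.integral_mult_left)

lemma abs_wint_le:
  assumes k: "continuous_on {0..r} k" and l: "continuous_on {0..r} l" and r: "r < T"
    and le: "\<And>s. s \<in> {0..r} \<Longrightarrow> \<bar>k s\<bar> \<le> l s"
  shows "\<bar>wint T k r\<bar> \<le> wint T l r"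
proof -
  have "norm (integral {0..r} (\<lambda>s. k s / (T - s)\<^sup>2)) \<le> integral {0..r} (\<lambda>s. l s / (T - s)\<^sup>2)"
    by (rule integral_norm_bound_integral)
      (use le in \<open>auto intro!: integrable_continuous_real continuous_on_weight k l r divide_right_mono\<close>)
  thus ?thesis by (simp add: wint_def)
qed

lemma wint_le_bound:
  assumes k: "continuous_on {0..r} k" and r: "0 \<le> r" "r \<le> t" "t < T" and C: "0 \<le> C" "\<And>s. s \<in> {0..r} \<Longrightarrow> k s \<le> C"
  shows "wint T k r \<le> t * (C / (T - t)\<^sup>2)"
proof -
  have "integral {0..r} (\<lambda>s. k s / (T - s)\<^sup>2) \<le> integral {0..r} (\<lambda>s. C / (T - t)\<^sup>2)"
  proof (rule integral_le)
    fix s assume s: "s \<in> {0..r}"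
    have "k s / (T - s)\<^sup>2 \<le> C / (T - s)\<^sup>2" using C(2)[OF s] by (intro divide_right_mono) auto
    also have "\<dots> \<le> C / (T - t)\<^sup>2" using s r C by (intro divide_left_mono power_mono) auto
    finally show "k s / (T - s)\<^sup>2 \<le> C / (T - t)\<^sup>2" .
  qed (use r in \<open>auto intro!: integrable_continuous_real continuous_on_weight k\<close>)
  also have "\<dots> = r * (C / (T - t)\<^sup>2)" using r by simp
  also have "\<dots> \<le> t * (C / (T - t)\<^sup>2)" using r C by (intro mult_right_mono) auto
  finally show ?thesis by (simp add: wint_def)
qed

lemma (in prob_space) has_bochner_integral_wint:
  assumes "(\<lambda>(\<omega>, s). Z s \<omega>) \<in> borel_measurable (M \<Otimes>\<^sub>M borel)"
    and cont: "\<And>\<omega>. \<omega> \<in> space M \<Longrightarrow> continuous_on {0..r} (\<lambda>s. Z s \<omega>)"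
    and mean: "\<And>s. 0 \<le> s \<Longrightarrow> s \<le> r \<Longrightarrow> has_bochner_integral M (Z s) (e s)"
    and e: "continuous_on {0..r} e"
    and bound: "\<And>s. 0 \<le> s \<Longrightarrow> s \<le> r \<Longrightarrow> (\<integral>\<omega>. \<bar>Z s \<omega>\<bar> \<partial>M) \<le> C"
    and r: "r < T"
  shows "has_bochner_integral M (\<lambda>\<omega>. wint T (\<lambda>s. Z s \<omega>) r) (wint T e r)"
proof -
  have [measurable]: "(\<lambda>z. Z (snd z) (fst z)) \<in> borel_measurable (M \<Otimes>\<^sub>M borel)"
    using assms(1) by (simp add: case_prod_beta')
  have "has_bochner_integral M (\<lambda>\<omega>. LBINT s:{0..r}. Z s \<omega> / (T - s)\<^sup>2) (LBINT s:{0..r}. e s / (T - s)\<^sup>2)"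
  proof (rule has_bochner_integral_process_integral)
    show "(\<lambda>(\<omega>, s). Z s \<omega> / (T - s)\<^sup>2) \<in> borel_measurable (M \<Otimes>\<^sub>M borel)"
      unfolding case_prod_beta' by measurable
    fix s assume s: "0 \<le> s" "s < r"
    show "has_bochner_integral M (\<lambda>\<omega>. Z s \<omega> / (T - s)\<^sup>2) (e s / (T - s)\<^sup>2)"
      using s by (intro has_bochner_integral_divide mean) auto
    have "(\<integral>\<omega>. \<bar>Z s \<omega> / (T - s)\<^sup>2\<bar> \<partial>M) = (\<integral>\<omega>. \<bar>Z s \<omega>\<bar> \<partial>M) / (T - s)\<^sup>2"
      by (simp add: abs_divide)
    also have "\<dots> \<le> max 0 C / (T - s)\<^sup>2"
      using bound[of s] s by (intro divide_right_mono) auto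
    also have "\<dots> \<le> max 0 C / (T - r)\<^sup>2"
      using s r by (intro divide_left_mono power_mono) auto
    finally show "(\<integral>\<omega>. \<bar>Z s \<omega> / (T - s)\<^sup>2\<bar> \<partial>M) \<le> max 0 C / (T - r)\<^sup>2" .
  qed
  also have "(LBINT s:{0..r}. e s / (T - s)\<^sup>2) = wint T e r"
    by (rule set_integral_eq_wint[OF e r])
  finally show ?thesis
    using set_integral_eq_wint[OF cont r]
    by (subst (asm) has_bochner_integral_cong[where g="\<lambda>\<omega>. wint T (\<lambda>s. Z s \<omega>) r"]) auto
qed

context continuous_wiener
begin

abbreviation J :: "real \<Rightarrow> real \<Rightarrow> 'a \<Rightarrow> real" where
  "J T r \<omega> \<equiv> wint T (\<lambda>s. w s \<omega>) r"

lemma w_continuous_on: "\<omega> \<in> space M \<Longrightarrow> continuous_on S (\<lambda>t. w t \<omega>)"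
  using w_continuous continuous_on_subset by blast

lemma J_measurable: "r < T \<Longrightarrow> J T r \<in> borel_measurable M"
  by (intro measurable_wint w_measurable w_continuous)

lemma J_w_product:
  assumes "r < T" "0 \<le> u"
  shows "has_bochner_integral M (\<lambda>\<omega>. J T r \<omega> * w u \<omega>) (wint T (\<lambda>s. min s u) r)"
proof -
  have [measurable]: "(\<lambda>z. w (snd z) (fst z)) \<in> borel_measurable (M \<Otimes>\<^sub>M borel)" "w u \<in> borel_measurable M"
    using w_joint_measurable w_measurable by (simp_all add: case_prod_beta')
  have "has_bochner_integral M (\<lambda>\<omega>. wint T (\<lambda>s. w s \<omega> * w u \<omega>) r) (wint T (\<lambda>s. min s u) r)"
  proof (rule has_bochner_integral_wint)
    show "(\<lambda>(\<omega>, s). w s \<omega> * w u \<omega>) \<in> borel_measurable (M \<Otimes>\<^sub>M borel)"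
      unfolding case_prod_beta' by measurable
    fix s assume s: "0 \<le> s" "s \<le> r"
    show "has_bochner_integral M (\<lambda>\<omega>. w s \<omega> * w u \<omega>) (min s u)"
      by (rule w_covariance) (use s assms in auto)
    show "(\<integral>\<omega>. \<bar>w s \<omega> * w u \<omega>\<bar> \<partial>M) \<le> r + u"
      using w_product_bound[of s u] s assms by simp
  qed (use assms in \<open>auto intro!: continuous_intros w_continuous_on\<close>)
  thus ?thesis by (simp add: wint_mult_right)
qed

text \<open>
  By \<open>2 |x y| \<le> x\<^sup>2 + y\<^sup>2\<close> under the time integral. The bound is uniform in \<open>r\<close>, as Fubini's theorem
  for the second moment needs it.
\<close>

lemma w_J_abs_bound:
  assumes "0 \<le> r" "r \<le> t" "t < T"
  shows "(\<integral>\<omega>. \<bar>w r \<omega> * J T r \<omega>\<bar> \<partial>M) \<le> t * (2 * t / (T - t)\<^sup>2)"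
proof -
  have [measurable]: "(\<lambda>z. w (snd z) (fst z)) \<in> borel_measurable (M \<Otimes>\<^sub>M borel)" "w r \<in> borel_measurable M"
    using w_joint_measurable w_measurable by (simp_all add: case_prod_beta')
  have h: "has_bochner_integral M (\<lambda>\<omega>. wint T (\<lambda>s. w s \<omega> * w s \<omega> + w r \<omega> * w r \<omega>) r) (wint T (\<lambda>s. min s s + min r r) r)"
  proof (rule has_bochner_integral_wint)
    show "(\<lambda>(\<omega>, s). w s \<omega> * w s \<omega> + w r \<omega> * w r \<omega>) \<in> borel_measurable (M \<Otimes>\<^sub>M borel)"
      unfolding case_prod_beta' by measurable
    fix s assume s: "0 \<le> s" "s \<le> r"
    show hs: "has_bochner_integral M (\<lambda>\<omega>. w s \<omega> * w s \<omega> + w r \<omega> * w r \<omega>) (min s s + min r r)"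
      by (intro has_bochner_integral_add w_covariance) (use s assms in auto)
    have "(\<integral>\<omega>. \<bar>w s \<omega> * w s \<omega> + w r \<omega> * w r \<omega>\<bar> \<partial>M) = (\<integral>\<omega>. w s \<omega> * w s \<omega> + w r \<omega> * w r \<omega> \<partial>M)"
      by simp
    also have "\<dots> \<le> r + r" using hs s by (simp add: has_bochner_integral_iff)
    finally show "(\<integral>\<omega>. \<bar>w s \<omega> * w s \<omega> + w r \<omega> * w r \<omega>\<bar> \<partial>M) \<le> r + r" .
  qed (use assms in \<open>auto intro!: continuous_intros w_continuous_on\<close>)
  have "(\<integral>\<omega>. \<bar>w r \<omega> * J T r \<omega>\<bar> \<partial>M) \<le> (\<integral>\<omega>. wint T (\<lambda>s. w s \<omega> * w s \<omega> + w r \<omega> * w r \<omega>) r \<partial>M)"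
  proof (rule integral_mono)
    show "integrable M (\<lambda>\<omega>. \<bar>w r \<omega> * J T r \<omega>\<bar>)"
      using J_w_product[of r T r] assms by (auto simp: has_bochner_integral_iff mult.commute)
    show "integrable M (\<lambda>\<omega>. wint T (\<lambda>s. w s \<omega> * w s \<omega> + w r \<omega> * w r \<omega>) r)"
      using h by (simp add: has_bochner_integral_iff)
    fix \<omega> assume \<omega>: "\<omega> \<in> space M"
    have "\<bar>w r \<omega> * J T r \<omega>\<bar> = \<bar>wint T (\<lambda>s. w s \<omega> * w r \<omega>) r\<bar>"
      by (simp add: wint_mult_right mult.commute)
    also have "\<dots> \<le> wint T (\<lambda>s. w s \<omega> * w s \<omega> + w r \<omega> * w r \<omega>) r"
    proof (rule abs_wint_le)
      fix s
      have "0 \<le> (\<bar>w s \<omega>\<bar> - \<bar>w r \<omega>\<bar>)\<^sup>2" by simp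
      hence "0 \<le> (w s \<omega>)\<^sup>2 + (w r \<omega>)\<^sup>2 - 2 * \<bar>w s \<omega>\<bar> * \<bar>w r \<omega>\<bar>"
        unfolding power2_diff by simp
      hence "2 * (\<bar>w s \<omega>\<bar> * \<bar>w r \<omega>\<bar>) \<le> w s \<omega> * w s \<omega> + w r \<omega> * w r \<omega>"
        by (simp add: power2_eq_square)
      moreover have "0 \<le> \<bar>w s \<omega>\<bar> * \<bar>w r \<omega>\<bar>" by simp
      ultimately show "\<bar>w s \<omega> * w r \<omega>\<bar> \<le> w s \<omega> * w s \<omega> + w r \<omega> * w r \<omega>"
        unfolding abs_mult by linarith
    qed (use assms \<omega> in \<open>auto intro!: continuous_intros w_continuous_on\<close>)
    finally show "\<bar>w r \<omega> * J T r \<omega>\<bar> \<le> wint T (\<lambda>s. w s \<omega> * w s \<omega> + w r \<omega> * w r \<omega>) r" .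
  qed
  also have "\<dots> = wint T (\<lambda>s. s + r) r" using h by (simp add: has_bochner_integral_iff)
  also have "\<dots> \<le> t * (2 * t / (T - t)\<^sup>2)"
    by (rule wint_le_bound) (use assms in \<open>auto intro!: continuous_intros\<close>)
  finally show ?thesis .
qed

text \<open>
  The path \<open>J\<close> is continuously differentiable, so \<open>J\<^sub>t\<^sup>2\<close> is twice the weighted integral of
  \<open>w\<^sub>r J\<^sub>r\<close>. This reduces the second moment to two applications of Fubini's theorem in one
  time variable.
\<close>

lemma J_square:
  assumes "0 \<le> t" "t < T"
  shows "has_bochner_integral M (\<lambda>\<omega>. (J T t \<omega>)\<^sup>2) (2 * wint T (wint T (\<lambda>s. s)) t)"
proof -
  \<comment> \<open>the times are clamped to \<open>[0, t]\<close>, so that the paths are continuous on the whole line\<close>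
  define Jc where "Jc = (\<lambda>r \<omega>. J T (max 0 (min r t)) \<omega>)"
  have Jc: "Jc r \<omega> = J T r \<omega>" if "0 \<le> r" "r \<le> t" for r \<omega> using that by (simp add: Jc_def)
  have Jcont: "continuous_on {0..t} (\<lambda>r. J T r \<omega>)" if "\<omega> \<in> space M" for \<omega>
    by (rule wint_continuous_on) (use assms that in \<open>auto intro!: w_continuous_on\<close>)
  have "(\<lambda>(\<omega>, r). Jc r \<omega>) \<in> borel_measurable (M \<Otimes>\<^sub>M borel)"
  proof (rule borel_measurable_pair_continuous_paths)
    show "Jc r \<in> borel_measurable M" for r
      unfolding Jc_def using assms by (intro J_measurable) auto
    show "continuous_on UNIV (\<lambda>r. Jc r \<omega>)" if "\<omega> \<in> space M" for \<omega>
      unfolding Jc_def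
      by (rule continuous_on_compose2[OF Jcont[OF that]]) (use assms in \<open>auto intro!: continuous_intros\<close>)
  qed
  hence [measurable]: "(\<lambda>z. Jc (snd z) (fst z)) \<in> borel_measurable (M \<Otimes>\<^sub>M borel)"
    "(\<lambda>z. w (snd z) (fst z)) \<in> borel_measurable (M \<Otimes>\<^sub>M borel)"
    using w_joint_measurable by (simp_all add: case_prod_beta')
  have "has_bochner_integral M (\<lambda>\<omega>. wint T (\<lambda>r. w r \<omega> * Jc r \<omega>) t) (wint T (wint T (\<lambda>s. s)) t)"
  proof (rule has_bochner_integral_wint)
    show "(\<lambda>(\<omega>, s). w s \<omega> * Jc s \<omega>) \<in> borel_measurable (M \<Otimes>\<^sub>M borel)"
      unfolding case_prod_beta' by measurable
    show "continuous_on {0..t} (\<lambda>s. w s \<omega> * Jc s \<omega>)" if "\<omega> \<in> space M" for \<omega>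
    proof -
      have "continuous_on {0..t} (\<lambda>s. w s \<omega> * J T s \<omega>)"
        by (intro continuous_on_mult w_continuous_on Jcont that)
      thus ?thesis
        by (subst continuous_on_cong[OF refl, where g="\<lambda>s. w s \<omega> * J T s \<omega>"]) (auto simp: Jc)
    qed
    show "continuous_on {0..t} (wint T (\<lambda>s. s))"
      by (intro wint_continuous_on continuous_intros assms)
    fix s assume s: "0 \<le> s" "s \<le> t"
    have "wint T (\<lambda>u. min u s) s = wint T (\<lambda>u. u) s" by (rule wint_cong) auto
    thus "has_bochner_integral M (\<lambda>\<omega>. w s \<omega> * Jc s \<omega>) (wint T (\<lambda>u. u) s)"
      using J_w_product[of s T s] s assms by (simp add: Jc mult.commute)
    show "(\<integral>\<omega>. \<bar>w s \<omega> * Jc s \<omega>\<bar> \<partial>M) \<le> t * (2 * t / (T - t)\<^sup>2)"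
      using w_J_abs_bound[of s t T] s assms by (simp add: Jc)
  qed (rule assms)
  hence "has_bochner_integral M (\<lambda>\<omega>. 2 * wint T (\<lambda>r. w r \<omega> * Jc r \<omega>) t) (2 * wint T (wint T (\<lambda>s. s)) t)"
    by (rule has_bochner_integral_mult_right)
  moreover have "2 * wint T (\<lambda>r. w r \<omega> * Jc r \<omega>) t = (J T t \<omega>)\<^sup>2" if \<omega>: "\<omega> \<in> space M" for \<omega>
  proof -
    have "((\<lambda>r. 2 * J T r \<omega> * (w r \<omega> / (T - r)\<^sup>2)) has_integral (J T t \<omega>)\<^sup>2 - (J T 0 \<omega>)\<^sup>2) {0..t}"
    proof (rule fundamental_theorem_of_calculus[OF assms(1)])
      fix r assume r: "r \<in> {0..t}"
      have "((\<lambda>r. J T r \<omega>) has_real_derivative w r \<omega> / (T - r)\<^sup>2) (at r within {0..t})"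
        by (rule wint_DERIV_within) (use r assms \<omega> in \<open>auto intro!: w_continuous_on\<close>)
      from DERIV_power[OF this, of 2]
      show "((\<lambda>r. (J T r \<omega>)\<^sup>2) has_vector_derivative 2 * J T r \<omega> * (w r \<omega> / (T - r)\<^sup>2)) (at r within {0..t})"
        by (simp add: has_real_derivative_iff_has_vector_derivative mult_ac)
    qed
    moreover have "J T 0 \<omega> = 0" by (simp add: wint_def)
    ultimately have "(J T t \<omega>)\<^sup>2 = integral {0..t} (\<lambda>r. 2 * J T r \<omega> * (w r \<omega> / (T - r)\<^sup>2))"
      by (simp add: integral_unique)
    also have "\<dots> = integral {0..t} (\<lambda>r. 2 * (w r \<omega> * Jc r \<omega> / (T - r)\<^sup>2))"
      by (intro Henstock_Kurzweil_Integration.integral_cong) (simp add: Jc)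
    also have "\<dots> = 2 * wint T (\<lambda>r. w r \<omega> * Jc r \<omega>) t"
      unfolding wint_def by (rule Henstock_Kurzweil_Integration.integral_mult_right)
    finally show ?thesis ..
  qed
  ultimately show ?thesis by (subst (asm) has_bochner_integral_cong[OF refl _ refl]) auto
qed

end

text \<open>
  The covariance of two increments is the length of the overlap of their intervals.
\<close>

lemma min_diff_overlap:
  fixes a b c d :: real
  assumes "a \<le> b" "c \<le> d"
  shows "min b d - min b c - min a d + min a c = max 0 (min b d - max a c)"
  using assms by (auto simp: min_def max_def)

lemma grid_monotone:
  fixes p :: "nat \<Rightarrow> real"
  assumes "\<forall>i<n. p i \<le> p (Suc i)" "i \<le> j" "j \<le> n"
  shows "p i \<le> p j"
  using assms(2,3)
proof (induction j rule: dec_induct)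
  case (step k)
  thus ?case using assms(1) order_trans[of "p i" "p k" "p (Suc k)"] by auto
qed simp

lemma has_bochner_integral_reciprocal_Ioc:
  fixes u v T c :: real
  assumes "u \<le> v" "v < T"
  shows "has_bochner_integral lborel (\<lambda>s. indicator {u<..v} s * (c / (T - s))) (c * (ln (T - u) - ln (T - v)))"
proof -
  have "has_bochner_integral lborel (\<lambda>s. c / (T - s) * indicator {u..v} s) (- c * ln (T - v) - (- c * ln (T - u)))"
    using assms by (intro has_bochner_integral_FTC_Icc_real[where F="\<lambda>s. - c * ln (T - s)"])
      (auto intro!: derivative_eq_intros continuous_intros)
  moreover have "AE s in lborel. c / (T - s) * indicator {u..v} s = indicator {u<..v} s * (c / (T - s))"
    using AE_lborel_singleton[of u] by eventually_elim (auto simp: indicator_def)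
  ultimately have "has_bochner_integral lborel (\<lambda>s. indicator {u<..v} s * (c / (T - s))) (- c * ln (T - v) - (- c * ln (T - u)))"
    by (subst (asm) has_bochner_integral_cong_AE[where g="\<lambda>s. indicator {u<..v} s * (c / (T - s))"]) auto
  thus ?thesis by (simp add: algebra_simps)
qed

context continuous_wiener
begin

lemma increment_product:
  assumes "0 \<le> a" "a \<le> b" "0 \<le> c" "c \<le> d"
  shows "has_bochner_integral M (\<lambda>\<omega>. (w b \<omega> - w a \<omega>) * (w d \<omega> - w c \<omega>)) (max 0 (min b d - max a c))"
proof -
  have "has_bochner_integral M (\<lambda>\<omega>. w b \<omega> * w d \<omega> - w b \<omega> * w c \<omega> - w a \<omega> * w d \<omega> + w a \<omega> * w c \<omega>)
      (min b d - min b c - min a d + min a c)"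
    using assms by (intro has_bochner_integral_add has_bochner_integral_diff w_covariance) auto
  thus ?thesis unfolding min_diff_overlap[OF assms(2,4)] by (simp add: algebra_simps)
qed

text \<open>
  The right-hand side is the integral of \<open>(T - t) / (T - s)\<close> over \<open>[u, v]\<close>: tested against increments,
  the by-parts expression behaves like the stochastic integral.
\<close>

lemma parts_product:
  assumes "0 \<le> u" "u \<le> v" "v \<le> t" "t < T"
  shows "has_bochner_integral M (\<lambda>\<omega>. (w v \<omega> - w u \<omega>) * (w t \<omega> - (T - t) * J T t \<omega>)) ((T - t) * (ln (T - u) - ln (T - v)))"
proof -
  have "has_bochner_integral M (\<lambda>\<omega>. (w v \<omega> * w t \<omega> - w u \<omega> * w t \<omega>) - (T - t) * (J T t \<omega> * w v \<omega> - J T t \<omega> * w u \<omega>))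
     ((min v t - min u t) - (T - t) * (wint T (\<lambda>s. min s v) t - wint T (\<lambda>s. min s u) t))"
    using assms by (intro has_bochner_integral_diff has_bochner_integral_mult_right w_covariance J_w_product) auto
  also have "(min v t - min u t) - (T - t) * (wint T (\<lambda>s. min s v) t - wint T (\<lambda>s. min s u) t)
     = (v - u) - (T - t) * ((ln (T - v) - ln (T - u)) + (v - u) / (T - t))"
  proof -
    have l: "ln ((T - x) / T) = ln (T - x) - ln T" if "x < T" "0 < T" for x
      by (rule ln_divide_pos) (use that in auto)
    have "wint T (\<lambda>s. min s v) t - wint T (\<lambda>s. min s u) t = (ln (T - v) - ln (T - u)) + (v - u) / (T - t)"
      using l[of v] l[of u] wint_min[of v t T] wint_min[of u t T] assms
      by (simp only: diff_divide_distrib)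
    thus ?thesis using assms by simp
  qed
  also have "\<dots> = (T - t) * (ln (T - u) - ln (T - v))"
  proof -
    have "x - y * (z + x / y) = - (y * z)" if "y \<noteq> 0" for x y z :: real
      using that by (simp add: distrib_left)
    from this[of "T - t"] show ?thesis using assms by (simp add: right_diff_distrib)
  qed
  finally show ?thesis by (simp add: algebra_simps)
qed

text \<open>
  The right-hand side is the integral of \<open>((T - t) / (T - s))\<^sup>2\<close> over \<open>[0, t]\<close>.
\<close>

lemma parts_square:
  assumes "0 \<le> t" "t < T"
  shows "has_bochner_integral M (\<lambda>\<omega>. (w t \<omega> - (T - t) * J T t \<omega>)\<^sup>2) (t * (T - t) / T)"
proof -
  let ?A = "wint T (\<lambda>s. s) t"
  have min: "wint T (\<lambda>s. min s t) t = ?A" by (rule wint_cong) auto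
  have "has_bochner_integral M (\<lambda>\<omega>. w t \<omega> * w t \<omega> - (2 * (T - t)) * (J T t \<omega> * w t \<omega>) + (T - t)\<^sup>2 * (J T t \<omega>)\<^sup>2)
     (min t t - (2 * (T - t)) * wint T (\<lambda>s. min s t) t + (T - t)\<^sup>2 * (2 * wint T (wint T (\<lambda>s. s)) t))"
    using assms by (intro has_bochner_integral_diff has_bochner_integral_add has_bochner_integral_mult_right w_covariance J_w_product J_square) auto
  also have "min t t - (2 * (T - t)) * wint T (\<lambda>s. min s t) t + (T - t)\<^sup>2 * (2 * wint T (wint T (\<lambda>s. s)) t)
     = t - 2 * (T - t) * ?A + (T - t)\<^sup>2 * (2 * (?A / (T - t) - t\<^sup>2 / (2 * T * (T - t)\<^sup>2)))"
    using wint_wint_identity[OF assms] min by simp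
  also have "\<dots> = t * (T - t) / T"
  proof -
    define y where "y = T - t"
    have y: "0 < y" "t = T - y" "0 < T" using assms by (auto simp: y_def)
    show ?thesis unfolding y_def[symmetric] using y(1,3)
      by (simp add: y(2) field_simps power2_eq_square)
  qed
  finally have "has_bochner_integral M (\<lambda>\<omega>. w t \<omega> * w t \<omega> - (2 * (T - t)) * (J T t \<omega> * w t \<omega>) + (T - t)\<^sup>2 * (J T t \<omega>)\<^sup>2) (t * (T - t) / T)" .
  moreover have "x * x - (2 * y) * (z * x) + y\<^sup>2 * z\<^sup>2 = (x - y * z)\<^sup>2" for x y z :: real
    by (simp add: power2_eq_square algebra_simps)
  ultimately show ?thesis by (simp only:)
qed

text \<open>
  Ito's isometry between step functions and the candidate for the integral: on both sides the
  square expands into the same products, by \<open>increment_product\<close>, \<open>parts_product\<close> and \<open>parts_square\<close>.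
\<close>

lemma step_integral_distance:
  fixes p c :: "nat \<Rightarrow> real"
  assumes t: "0 \<le> t" "t < T" and p: "p 0 = 0" "p n = t" "\<forall>i<n. p i \<le> p (Suc i)"
  shows "(\<integral>\<^sup>+\<omega>. ennreal ((step_integral W n p c \<omega> - (w t \<omega> - (T - t) * J T t \<omega>))\<^sup>2) \<partial>M)
    = (\<integral>\<^sup>+s\<in>{0..t}. ennreal ((step_fun n p c s - (T - t) / (T - s))\<^sup>2) \<partial>lborel)"
proof -
  have pr: "0 \<le> p i" "p i \<le> t" if "i \<le> n" for i
    using grid_monotone[OF p(3), of 0 i] grid_monotone[OF p(3), of i n] that p by auto
  have ps: "p i \<le> p (Suc i)" if "i < n" for i using p(3) that by auto
  let ?R = "\<lambda>\<omega>. w t \<omega> - (T - t) * J T t \<omega>"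
  define a where "a = (\<lambda>i j. max 0 (min (p (Suc i)) (p (Suc j)) - max (p i) (p j)))"
  define v where "v = (\<lambda>i. (T - t) * (ln (T - p i) - ln (T - p (Suc i))))"
  define V where "V = (\<Sum>i<n. \<Sum>j<n. c i * c j * a i j) - 2 * (\<Sum>i<n. c i * v i) + t * (T - t) / T"
  have "has_bochner_integral M (\<lambda>\<omega>. ((\<Sum>i<n. c i * (w (p (Suc i)) \<omega> - w (p i) \<omega>)) - ?R \<omega>)\<^sup>2) V"
    unfolding V_def
  proof (rule has_bochner_integral_square_linear_combination)
    show "has_bochner_integral M (\<lambda>\<omega>. (w (p (Suc i)) \<omega> - w (p i) \<omega>) * (w (p (Suc j)) \<omega> - w (p j) \<omega>)) (a i j)"
      if "i < n" "j < n" for i j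
      unfolding a_def using that pr ps by (intro increment_product) auto
    show "has_bochner_integral M (\<lambda>\<omega>. (w (p (Suc i)) \<omega> - w (p i) \<omega>) * ?R \<omega>) (v i)" if "i < n" for i
      unfolding v_def using that pr ps t by (intro parts_product) auto
    show "has_bochner_integral M (\<lambda>\<omega>. (?R \<omega>)\<^sup>2) (t * (T - t) / T)"
      by (rule parts_square[OF t])
  qed
  hence "(\<integral>\<^sup>+\<omega>. ennreal (((\<Sum>i<n. c i * (w (p (Suc i)) \<omega> - w (p i) \<omega>)) - ?R \<omega>)\<^sup>2) \<partial>M) = ennreal V"
    by (subst nn_integral_eq_integral) (auto simp: has_bochner_integral_iff)
  moreover have "AE \<omega> in M. (\<Sum>i<n. c i * (w (p (Suc i)) \<omega> - w (p i) \<omega>)) = step_integral W n p c \<omega>"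
    using w_AE
  proof eventually_elim
    case (elim \<omega>)
    thus ?case unfolding step_integral_def by (intro sum.cong refl) (use pr in \<open>auto simp: less_imp_le\<close>)
  qed
  ultimately have 1: "(\<integral>\<^sup>+\<omega>. ennreal ((step_integral W n p c \<omega> - ?R \<omega>)\<^sup>2) \<partial>M) = ennreal V"
    by (subst nn_integral_cong_AE[where v="\<lambda>\<omega>. ennreal (((\<Sum>i<n. c i * (w (p (Suc i)) \<omega> - w (p i) \<omega>)) - ?R \<omega>)\<^sup>2)"]) auto
  let ?D = "\<lambda>i s. indicator {p i<..p (Suc i)} s :: real"
  let ?f = "\<lambda>s. indicator {0..t} s * ((T - t) / (T - s)) :: real"
  have sub: "{p i<..p (Suc i)} \<subseteq> {0..t}" if "i < n" for i
    using pr[of i] pr[of "Suc i"] that by auto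
  have "has_bochner_integral lborel (\<lambda>s. ((\<Sum>i<n. c i * ?D i s) - ?f s)\<^sup>2) V"
    unfolding V_def
  proof (rule has_bochner_integral_square_linear_combination)
    fix i j assume "i < n" "j < n"
    have "?D i s * ?D j s = indicator {max (p i) (p j)<..min (p (Suc i)) (p (Suc j))} s" for s
      by (auto simp: indicator_def)
    moreover have "has_bochner_integral lborel (indicator {l<..m} :: real \<Rightarrow> real) (max 0 (m - l))" for l m :: real
    proof -
      have "has_bochner_integral lborel (indicator {l<..m} :: real \<Rightarrow> real) (measure lborel {l<..m})"
        by (rule has_bochner_integral_real_indicator) (cases "l \<le> m"; simp)+
      also have "measure lborel {l<..m} = max 0 (m - l)"
        by (cases "l \<le> m") auto
      finally show ?thesis .
    qed
    ultimately show "has_bochner_integral lborel (\<lambda>s. ?D i s * ?D j s) (a i j)"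
      unfolding a_def by presburger
  next
    fix i assume i: "i < n"
    have "?D i s * ?f s = ?D i s * ((T - t) / (T - s))" for s
      using sub[OF i] by (auto simp: indicator_def)
    moreover have "has_bochner_integral lborel (\<lambda>s. ?D i s * ((T - t) / (T - s))) (v i)"
      unfolding v_def using i ps[of i] pr[of "Suc i"] t
      by (intro has_bochner_integral_reciprocal_Ioc) auto
    ultimately show "has_bochner_integral lborel (\<lambda>s. ?D i s * ?f s) (v i)" by presburger
  next
    have "has_bochner_integral lborel (\<lambda>s. (T - t)\<^sup>2 / (T - s)\<^sup>2 * indicator {0..t} s) ((T - t)\<^sup>2 / (T - t) - (T - t)\<^sup>2 / (T - 0))"
      using t by (intro has_bochner_integral_FTC_Icc_real[where F="\<lambda>s. (T - t)\<^sup>2 / (T - s)"])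
        (auto intro!: derivative_eq_intros continuous_intros simp: power2_eq_square)
    also have "(T - t)\<^sup>2 / (T - t) - (T - t)\<^sup>2 / (T - 0) = t * (T - t) / T"
      using t by (simp add: field_simps power2_eq_square)
    also have "(\<lambda>s. (T - t)\<^sup>2 / (T - s)\<^sup>2 * indicator {0..t} s) = (\<lambda>s. (?f s)\<^sup>2)"
      by (auto simp: indicator_def power_divide fun_eq_iff)
    finally show "has_bochner_integral lborel (\<lambda>s. (?f s)\<^sup>2) (t * (T - t) / T)" .
  qed
  hence "(\<integral>\<^sup>+s. ennreal (((\<Sum>i<n. c i * ?D i s) - ?f s)\<^sup>2) \<partial>lborel) = ennreal V"
    by (subst nn_integral_eq_integral) (auto simp: has_bochner_integral_iff)
  moreover have "ennreal (((\<Sum>i<n. c i * ?D i s) - ?f s)\<^sup>2)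
      = ennreal ((step_fun n p c s - (T - t) / (T - s))\<^sup>2) * indicator {0..t} s" for s
  proof (cases "s \<in> {0..t}")
    case False
    have "(\<Sum>i<n. c i * ?D i s) = 0"
    proof (intro sum.neutral ballI)
      fix i assume "i \<in> {..<n}"
      hence "s \<notin> {p i<..p (Suc i)}" using sub[of i] False by blast
      thus "c i * ?D i s = 0" by simp
    qed
    thus ?thesis using False by simp
  qed (simp add: step_fun_def)
  ultimately show ?thesis using 1 by simp
qed

text \<open>
  Step integrals that converge to \<open>I\<close> also converge to the by-parts expression, by the isometry; limits in
  the mean square are almost surely unique.
\<close>

theorem wiener_integral_by_parts:
  assumes t: "0 \<le> t" "t < T" and I: "has_wiener_integral M W (\<lambda>s. (T - t) / (T - s)) 0 t I"
  shows "AE \<omega> in M. I \<omega> = w t \<omega> - (T - t) * J T t \<omega>"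
proof -
  let ?R = "\<lambda>\<omega>. w t \<omega> - (T - t) * J T t \<omega>"
  obtain n :: "nat \<Rightarrow> nat" and p c :: "nat \<Rightarrow> nat \<Rightarrow> real" where
    p: "\<And>k. p k 0 = 0 \<and> p k (n k) = t \<and> (\<forall>i<n k. p k i \<le> p k (Suc i))" and
    1: "(\<lambda>k. \<integral>\<^sup>+s\<in>{0..t}. ennreal ((step_fun (n k) (p k) (c k) s - (T - t) / (T - s))\<^sup>2) \<partial>lborel) \<longlonglongrightarrow> 0" and
    2: "(\<lambda>k. \<integral>\<^sup>+\<omega>. ennreal ((step_integral W (n k) (p k) (c k) \<omega> - I \<omega>)\<^sup>2) \<partial>M) \<longlonglongrightarrow> 0"
    and Im[measurable]: "I \<in> borel_measurable M"
    using I unfolding has_wiener_integral_def by blast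
  have [measurable]: "w t \<in> borel_measurable M" "J T t \<in> borel_measurable M"
    using w_measurable J_measurable t by auto
  have eq: "(\<integral>\<^sup>+\<omega>. ennreal ((step_integral W (n k) (p k) (c k) \<omega> - ?R \<omega>)\<^sup>2) \<partial>M)
      = (\<integral>\<^sup>+s\<in>{0..t}. ennreal ((step_fun (n k) (p k) (c k) s - (T - t) / (T - s))\<^sup>2) \<partial>lborel)" for k
    using p[of k] by (intro step_integral_distance t) auto
  have R1: "(\<lambda>k. \<integral>\<^sup>+\<omega>. ennreal ((step_integral W (n k) (p k) (c k) \<omega> - ?R \<omega>)\<^sup>2) \<partial>M) \<longlonglongrightarrow> 0"
    unfolding eq by (rule 1)
  have Sm[measurable]: "step_integral W (n k) (p k) (c k) \<in> borel_measurable M" for k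
  proof -
    have "0 \<le> p k i" if "i \<le> n k" for i
      using grid_monotone[of "n k" "p k" 0 i] p[of k] that by auto
    hence "(\<lambda>\<omega>. \<Sum>i<n k. c k i * (W (p k (Suc i)) \<omega> - W (p k i) \<omega>)) \<in> borel_measurable M"
      by (intro borel_measurable_sum borel_measurable_times borel_measurable_const borel_measurable_diff W_measurable) auto
    thus ?thesis by (simp add: step_integral_def[abs_def])
  qed
  have le: "(\<integral>\<^sup>+\<omega>. ennreal ((I \<omega> - ?R \<omega>)\<^sup>2) \<partial>M) \<le>
      2 * (\<integral>\<^sup>+\<omega>. ennreal ((step_integral W (n k) (p k) (c k) \<omega> - ?R \<omega>)\<^sup>2) \<partial>M)
    + 2 * (\<integral>\<^sup>+\<omega>. ennreal ((step_integral W (n k) (p k) (c k) \<omega> - I \<omega>)\<^sup>2) \<partial>M)" for k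
  proof -
    let ?S = "step_integral W (n k) (p k) (c k)"
    have "(\<integral>\<^sup>+\<omega>. ennreal ((I \<omega> - ?R \<omega>)\<^sup>2) \<partial>M) \<le>
        (\<integral>\<^sup>+\<omega>. 2 * ennreal ((?S \<omega> - ?R \<omega>)\<^sup>2) + 2 * ennreal ((?S \<omega> - I \<omega>)\<^sup>2) \<partial>M)"
    proof (rule nn_integral_mono)
      fix \<omega>
      have "(y - z)\<^sup>2 \<le> 2 * (x - z)\<^sup>2 + 2 * (x - y)\<^sup>2" for x y z :: real
      proof -
        have "2 * (x - z)\<^sup>2 + 2 * (x - y)\<^sup>2 - (y - z)\<^sup>2 = ((x - z) + (x - y))\<^sup>2"
          by (simp add: power2_eq_square algebra_simps)
        thus ?thesis by (smt (verit) zero_le_power2)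
      qed
      hence "ennreal ((I \<omega> - ?R \<omega>)\<^sup>2) \<le> ennreal (2 * (?S \<omega> - ?R \<omega>)\<^sup>2 + 2 * (?S \<omega> - I \<omega>)\<^sup>2)"
        by (rule ennreal_leI)
      thus "ennreal ((I \<omega> - ?R \<omega>)\<^sup>2) \<le> 2 * ennreal ((?S \<omega> - ?R \<omega>)\<^sup>2) + 2 * ennreal ((?S \<omega> - I \<omega>)\<^sup>2)"
        by (simp add: ennreal_plus ennreal_mult)
    qed
    also have "\<dots> = 2 * (\<integral>\<^sup>+\<omega>. ennreal ((?S \<omega> - ?R \<omega>)\<^sup>2) \<partial>M) + 2 * (\<integral>\<^sup>+\<omega>. ennreal ((?S \<omega> - I \<omega>)\<^sup>2) \<partial>M)"
      by (subst nn_integral_add) (auto simp: nn_integral_cmult)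
    finally show ?thesis .
  qed
  have "(\<lambda>k. 2 * (\<integral>\<^sup>+\<omega>. ennreal ((step_integral W (n k) (p k) (c k) \<omega> - ?R \<omega>)\<^sup>2) \<partial>M)
    + 2 * (\<integral>\<^sup>+\<omega>. ennreal ((step_integral W (n k) (p k) (c k) \<omega> - I \<omega>)\<^sup>2) \<partial>M)) \<longlonglongrightarrow> 2 * 0 + 2 * 0"
    by (intro tendsto_add ennreal_tendsto_cmult R1 2) auto
  hence "(\<integral>\<^sup>+\<omega>. ennreal ((I \<omega> - ?R \<omega>)\<^sup>2) \<partial>M) \<le> 2 * 0 + 2 * 0"
    by (rule LIMSEQ_le_const) (use le in blast)
  hence "(\<integral>\<^sup>+\<omega>. ennreal ((I \<omega> - ?R \<omega>)\<^sup>2) \<partial>M) = 0" by simp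
  hence "AE \<omega> in M. ennreal ((I \<omega> - ?R \<omega>)\<^sup>2) = 0"
    by (subst (asm) nn_integral_0_iff_AE) auto
  thus ?thesis by eventually_elim (simp add: ennreal_eq_0_iff)
qed

end

section \<open>Regression of the paths on the endpoint\<close>

lemma (in wiener_process) full_support_W:
  assumes T: "0 < T" shows "full_support M (W T)"
  unfolding full_support_def
proof (intro allI impI)
  fix a b :: real assume ab: "a < b"
  have [measurable]: "W T \<in> borel_measurable M" "W 0 \<in> borel_measurable M" using W_measurable T by auto
  have D: "distributed M lborel (\<lambda>\<omega>. W T \<omega> - W 0 \<omega>) (normal_density 0 (sqrt (T - 0)))"
    using W_increment[of 0 T] T by simp
  have eq: "prob (W T -` {a<..<b} \<inter> space M) = prob ((\<lambda>\<omega>. W T \<omega> - W 0 \<omega>) -` {a<..<b} \<inter> space M)"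
  proof (rule finite_measure_eq_AE)
    show "AE \<omega> in M. (\<omega> \<in> W T -` {a<..<b} \<inter> space M) = (\<omega> \<in> (\<lambda>\<omega>. W T \<omega> - W 0 \<omega>) -` {a<..<b} \<inter> space M)"
      using W_zero by eventually_elim auto
  qed measurable
  have "prob (W T -` {a<..<b} \<inter> space M) \<noteq> 0"
  proof
    assume "prob (W T -` {a<..<b} \<inter> space M) = 0"
    hence "emeasure M ((\<lambda>\<omega>. W T \<omega> - W 0 \<omega>) -` {a<..<b} \<inter> space M) = 0"
      by (simp add: eq emeasure_eq_measure)
    hence "(\<integral>\<^sup>+x. ennreal (normal_density 0 (sqrt (T - 0)) x) * indicator {a<..<b} x \<partial>lborel) = 0"
      by (subst (asm) distributed_emeasure[OF D]) auto
    hence "AE x in lborel. ennreal (normal_density 0 (sqrt (T - 0)) x) * indicator {a<..<b} x = 0"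
      by (subst (asm) nn_integral_0_iff_AE) auto
    hence "AE x in lborel. x \<notin> {a<..<b}"
    proof eventually_elim
      case (elim x)
      have "0 < normal_density 0 (sqrt (T - 0)) x" using T by (intro normal_density_pos) simp
      thus ?case using elim by (auto simp: indicator_def split: if_splits)
    qed
    hence "emeasure lborel {x \<in> space lborel. \<not> x \<notin> {a<..<b}} = 0"
      by (subst (asm) AE_iff_measurable[OF _ refl]) auto
    moreover have "{x \<in> space lborel. \<not> x \<notin> {a<..<b}} = {a<..<b}" by auto
    ultimately show False using ab by simp
  qed
  thus "0 < prob (W T -` {a<..<b} \<inter> space M)" by (simp add: less_le)
qed

context continuous_wiener
begin

text \<open>
  The process \<open>V\<close> of the introduction, built from \<open>w\<close> and therefore with continuous paths; negative times are
  replaced by 0.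
\<close>

definition V :: "real \<Rightarrow> real \<Rightarrow> 'a \<Rightarrow> real" where
  "V T r \<omega> = w (max 0 r) \<omega> - min (max 0 r) T / T * w T \<omega>"

text \<open>
  The sigma-algebra generated by \<open>V\<close>, with the finite-dimensional events as generators because these are
  closed under intersection.
\<close>

definition bridge_algebra :: "real \<Rightarrow> 'a measure" where
  "bridge_algebra T = sigma (space M)
    {{\<omega> \<in> space M. \<forall>j\<in>I. V T j \<omega> \<in> B j} |I B. finite I \<and> I \<subseteq> {0..} \<and> (\<forall>j. B j \<in> sets borel)}"

lemma V_measurable [measurable]: "V T r \<in> borel_measurable M"
  unfolding V_def by (intro borel_measurable_diff borel_measurable_times borel_measurable_const w_measurable)

lemma V_continuous:
  assumes "\<omega> \<in> space M" "0 < T" shows "continuous_on S (\<lambda>r. V T r \<omega>)"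
  unfolding V_def
  by (intro continuous_intros continuous_on_compose2[OF w_continuous[OF assms(1)]]) (use assms in auto)

lemma bridge_generator_measurable:
  assumes "finite I" "\<And>j. B j \<in> sets borel"
  shows "{\<omega> \<in> space M. \<forall>j\<in>I. V T j \<omega> \<in> B j} \<in> events"
proof (rule sets.sets_Collect_finite_All[OF _ assms(1)])
  fix j
  have "V T j -` B j \<inter> space M \<in> events" by (rule measurable_sets[OF V_measurable assms(2)])
  thus "{\<omega> \<in> space M. V T j \<omega> \<in> B j} \<in> events" by (simp add: vimage_def Int_def conj_commute)
qed

lemma sets_bridge_algebra:
  "sets (bridge_algebra T) = sigma_sets (space M)
    {{\<omega> \<in> space M. \<forall>j\<in>I. V T j \<omega> \<in> B j} |I B. finite I \<and> I \<subseteq> {0..} \<and> (\<forall>j. B j \<in> sets borel)}"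
  unfolding bridge_algebra_def by (rule sets_measure_of) auto

lemma space_bridge_algebra [simp]: "space (bridge_algebra T) = space M"
  unfolding bridge_algebra_def by (rule space_measure_of) auto

lemma subalgebra_bridge_algebra: "subalgebra M (bridge_algebra T)"
  unfolding subalgebra_def sets_bridge_algebra
proof (intro conjI sets.sigma_sets_subset subsetI)
  fix A assume "A \<in> {{\<omega> \<in> space M. \<forall>j\<in>I. V T j \<omega> \<in> B j} |I B. finite I \<and> I \<subseteq> {0..} \<and> (\<forall>j. B j \<in> sets borel)}"
  then obtain I B where "A = {\<omega> \<in> space M. \<forall>j\<in>I. V T j \<omega> \<in> B j}" "finite I" "\<forall>j. B j \<in> sets borel"
    by blast
  thus "A \<in> events" using bridge_generator_measurable[of I B T] by simp
qed simp

lemma V_measurable_bridge_algebra: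
  "V T r \<in> borel_measurable (bridge_algebra T)"
proof -
  have V0: "V T r = V T (max 0 r)" by (simp add: V_def fun_eq_iff)
  show ?thesis
  proof (rule measurableI)
    fix A :: "real set" assume A: "A \<in> sets borel"
    have "V T r -` A \<inter> space (bridge_algebra T) = {\<omega> \<in> space M. \<forall>j\<in>{max 0 r}. V T j \<omega> \<in> A}"
      unfolding V0 by auto
    also have "\<dots> \<in> sets (bridge_algebra T)"
      unfolding sets_bridge_algebra
      by (rule sigma_sets.Basic, rule CollectI, rule exI[of _ "{max 0 r}"], rule exI[of _ "\<lambda>_. A"]) (use A in auto)
    finally show "V T r -` A \<inter> space (bridge_algebra T) \<in> sets (bridge_algebra T)" .
  qed simp
qed

lemma V_AE:
  assumes "0 < T" shows "AE \<omega> in M. \<forall>r\<ge>0. V T r \<omega> = bridge_part T W r \<omega>"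
  using w_AE W_zero
proof eventually_elim
  case (elim \<omega>)
  thus ?case using assms by (auto simp: V_def bridge_part_def)
qed

proposition indep_bridge_algebra:
  assumes T: "0 < T"
  shows "indep_set (sets (bridge_algebra T)) {W T -` C \<inter> space M |C. C \<in> sets borel}"
proof -
  let ?G = "{{\<omega> \<in> space M. \<forall>j\<in>I. V T j \<omega> \<in> B j} |I B. finite I \<and> I \<subseteq> {0..} \<and> (\<forall>j. B j \<in> sets borel)}"
  let ?Z = "{W T -` C \<inter> space M |C. C \<in> sets borel}"
  have [measurable]: "W T \<in> borel_measurable M" "W 0 \<in> borel_measurable M" using W_measurable T by auto
  have bm[measurable]: "bridge_part T W r \<in> borel_measurable M" if "0 \<le> r" for r
    unfolding bridge_part_def
    by (intro borel_measurable_diff borel_measurable_times borel_measurable_const W_measurable) (use that T in auto)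
  have "indep_set ?G ?Z"
    unfolding indep_sets2_eq
  proof (intro conjI ballI)
    show "?G \<subseteq> events" using bridge_generator_measurable by auto
    show "?Z \<subseteq> events" by (auto intro: measurable_sets)
    fix x y assume "x \<in> ?G" "y \<in> ?Z"
    then obtain I B C where I: "finite I" "I \<subseteq> {0..}" "\<And>j. B j \<in> sets borel"
      and x: "x = {\<omega> \<in> space M. \<forall>j\<in>I. V T j \<omega> \<in> B j}" and C[measurable]: "C \<in> sets borel" and y: "y = W T -` C \<inter> space M"
      by auto
    have ym: "y \<in> events" unfolding y by measurable
    have xm: "x \<in> events" unfolding x by (rule bridge_generator_measurable) (use I in auto)
    have m1: "{\<omega> \<in> space M. \<forall>j\<in>I. bridge_part T W j \<omega> \<in> B j} \<in> events"
    proof (rule sets.sets_Collect_finite_All[OF _ I(1)])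
      fix j assume "j \<in> I"
      hence "bridge_part T W j -` B j \<inter> space M \<in> events" using I by (intro measurable_sets[OF bm]) auto
      thus "{\<omega> \<in> space M. bridge_part T W j \<omega> \<in> B j} \<in> events" by (simp add: vimage_def Int_def conj_commute)
    qed
    have m2: "{\<omega> \<in> space M. W T \<omega> - W 0 \<omega> \<in> C} \<in> events" by measurable
    have e1: "prob x = prob {\<omega> \<in> space M. \<forall>j\<in>I. bridge_part T W j \<omega> \<in> B j}"
    proof (rule finite_measure_eq_AE[OF _ xm m1])
      show "AE \<omega> in M. (\<omega> \<in> x) = (\<omega> \<in> {\<omega> \<in> space M. \<forall>j\<in>I. bridge_part T W j \<omega> \<in> B j})"
        using V_AE[OF T]
      proof eventually_elim
        case (elim \<omega>)
        hence "\<forall>j\<in>I. V T j \<omega> = bridge_part T W j \<omega>" using I(2) by auto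
        thus ?case by (auto simp: x)
      qed
    qed
    have e2: "prob y = prob {\<omega> \<in> space M. W T \<omega> - W 0 \<omega> \<in> C}"
    proof (rule finite_measure_eq_AE[OF _ ym m2])
      show "AE \<omega> in M. (\<omega> \<in> y) = (\<omega> \<in> {\<omega> \<in> space M. W T \<omega> - W 0 \<omega> \<in> C})"
        using W_zero by eventually_elim (auto simp: y)
    qed
    have e3: "prob (x \<inter> y) = prob {\<omega> \<in> space M. (\<forall>j\<in>I. bridge_part T W j \<omega> \<in> B j) \<and> W T \<omega> - W 0 \<omega> \<in> C}"
    proof (rule finite_measure_eq_AE)
      show "AE \<omega> in M. (\<omega> \<in> x \<inter> y) = (\<omega> \<in> {\<omega> \<in> space M. (\<forall>j\<in>I. bridge_part T W j \<omega> \<in> B j) \<and> W T \<omega> - W 0 \<omega> \<in> C})"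
        using V_AE[OF T] W_zero
      proof eventually_elim
        case (elim \<omega>)
        hence "\<forall>j\<in>I. V T j \<omega> = bridge_part T W j \<omega>" using I(2) by auto
        thus ?case using elim by (auto simp: x y)
      qed
      have "{\<omega> \<in> space M. (\<forall>j\<in>I. bridge_part T W j \<omega> \<in> B j) \<and> W T \<omega> - W 0 \<omega> \<in> C}
        = {\<omega> \<in> space M. \<forall>j\<in>I. bridge_part T W j \<omega> \<in> B j} \<inter> {\<omega> \<in> space M. W T \<omega> - W 0 \<omega> \<in> C}" by auto
      thus "{\<omega> \<in> space M. (\<forall>j\<in>I. bridge_part T W j \<omega> \<in> B j) \<and> W T \<omega> - W 0 \<omega> \<in> C} \<in> events"
        using m1 m2 by auto
    qed (use xm ym in auto)
    show "prob (x \<inter> y) = prob x * prob y"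
      unfolding e1 e2 e3 by (rule bridge_part_indep_finite[OF T I C])
  qed
  moreover have "Int_stable ?G"
  proof (rule Int_stableI)
    fix x y assume "x \<in> ?G" "y \<in> ?G"
    then obtain I B I' B' where I: "finite I" "I \<subseteq> {0..}" "\<And>j. B j \<in> sets borel" "x = {\<omega> \<in> space M. \<forall>j\<in>I. V T j \<omega> \<in> B j}"
      and I': "finite I'" "I' \<subseteq> {0..}" "\<And>j. B' j \<in> sets borel" "y = {\<omega> \<in> space M. \<forall>j\<in>I'. V T j \<omega> \<in> B' j}"
      by auto
    let ?B = "\<lambda>j. (if j \<in> I then B j else UNIV) \<inter> (if j \<in> I' then B' j else UNIV)"
    have "x \<inter> y = {\<omega> \<in> space M. \<forall>j\<in>I \<union> I'. V T j \<omega> \<in> ?B j}"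
      unfolding I(4) I'(4) by auto
    moreover have "finite (I \<union> I')" "I \<union> I' \<subseteq> {0..}" "\<forall>j. ?B j \<in> sets borel" using I I' by auto
    ultimately show "x \<inter> y \<in> ?G"
      by (intro CollectI exI[of _ "I \<union> I'"] exI[of _ ?B] conjI)
  qed
  moreover have "Int_stable ?Z"
  proof (rule Int_stableI)
    fix x y assume "x \<in> ?Z" "y \<in> ?Z"
    then obtain C C' where "C \<in> sets borel" "C' \<in> sets borel" "x = W T -` C \<inter> space M" "y = W T -` C' \<inter> space M" by auto
    thus "x \<inter> y \<in> ?Z" by (intro CollectI exI[of _ "C \<inter> C'"]) auto
  qed
  ultimately have "indep_set (sigma_sets (space M) ?G) (sigma_sets (space M) ?Z)"
    by (rule indep_set_sigma_sets)
  thus ?thesis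
    unfolding indep_sets2_eq sets_bridge_algebra by (auto intro: sigma_sets.Basic)
qed

text \<open>
  The paths \<open>(W, B)\<close> agree almost surely with \<open>(V, y) + W\<^sub>T (t / T, h)\<close>, where \<open>(V, y)\<close> is measurable for
  the sigma-algebra of \<open>V\<close>; so \<open>cond_distr_independent_shift\<close> applies.
\<close>

proposition has_cond_expectation_regression:
  assumes T: "0 < T"
    and y: "\<And>t. t \<in> {0..T} \<Longrightarrow> y t \<in> borel_measurable (bridge_algebra T)"
    and yc: "\<And>\<omega>. \<omega> \<in> space M \<Longrightarrow> continuous_on {0..T} (\<lambda>t. y t \<omega>)"
    and h: "continuous_on {0..T} h"
    and B: "AE \<omega> in M. \<forall>t\<in>{0..T}. B t \<omega> = y t \<omega> + W T \<omega> * h t"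
    and Fm: "(\<lambda>x. F (\<lambda>t. fst (apply_bcontfun x t)) (\<lambda>t. snd (apply_bcontfun x t))) \<in> borel_measurable borel"
    and Fcong: "\<And>f f' g g'. (\<And>t. t \<in> {0..T} \<Longrightarrow> f t = f' t \<and> g t = g' t) \<Longrightarrow> F f g = F f' g'"
    and v: "has_bochner_integral M (\<lambda>\<omega>. F (\<lambda>t. V T t \<omega> + d * (t / T)) (\<lambda>t. y t \<omega> + d * h t)) v"
  shows "has_cond_expectation M T W B F d v"
proof -
  define Y where "Y = (\<lambda>\<omega>. path_of T (\<lambda>t. (V T t \<omega>, y t \<omega>)))"
  define H where "H = path_of T (\<lambda>t. (t / T, h t))"
  have Yc: "continuous_on {0..T} (\<lambda>t. (V T t \<omega>, y t \<omega>))" if "\<omega> \<in> space M" for \<omega>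
    by (intro continuous_on_Pair V_continuous yc that T)
  have Hc: "continuous_on {0..T} (\<lambda>t. (t / T, h t))"
    using T by (intro continuous_intros h) auto
  have YH: "Y \<omega> + e *\<^sub>R H = path_of T (\<lambda>t. (V T t \<omega> + e * (t / T), y t \<omega> + e * h t))" if "\<omega> \<in> space M" for \<omega> e
    unfolding Y_def H_def by (subst path_of_add_scaleR[OF Yc[OF that] Hc, symmetric]) simp
  have YHc: "continuous_on {0..T} (\<lambda>t. (V T t \<omega> + e * (t / T), y t \<omega> + e * h t))" if "\<omega> \<in> space M" for \<omega> e
    using T by (intro continuous_intros V_continuous yc that h) auto
  have pm: "(\<lambda>(\<omega>, e). Y \<omega> + e *\<^sub>R H) \<in> borel_measurable (bridge_algebra T \<Otimes>\<^sub>M borel)"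
  proof -
    have "(\<lambda>z. path_of T (\<lambda>t. (V T t (fst z) + snd z * (t / T), y t (fst z) + snd z * h t))) \<in> borel_measurable (bridge_algebra T \<Otimes>\<^sub>M borel)"
    proof (rule measurable_path_of[OF T])
      fix t assume t: "t \<in> {0..T}"
      note [measurable] = y[OF t] V_measurable_bridge_algebra
      show "(\<lambda>z. (V T t (fst z) + snd z * (t / T), y t (fst z) + snd z * h t)) \<in> borel_measurable (bridge_algebra T \<Otimes>\<^sub>M borel)"
        by measurable
    next
      fix z assume "z \<in> space (bridge_algebra T \<Otimes>\<^sub>M (borel :: real measure))"
      thus "continuous_on {0..T} (\<lambda>t. (V T t (fst z) + snd z * (t / T), y t (fst z) + snd z * h t))"
        by (intro YHc) (auto simp: space_pair_measure)
    qed
    also have "?this \<longleftrightarrow> ?thesis"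
      by (rule measurable_cong) (auto simp: space_pair_measure YH)
    finally show ?thesis .
  qed
  have X: "AE \<omega> in M. joint_path T W B \<omega> = Y \<omega> + W T \<omega> *\<^sub>R H"
    using B w_AE AE_space
  proof eventually_elim
    case (elim \<omega>)
    have "joint_path T W B \<omega> = path_of T (\<lambda>t. (V T t \<omega> + W T \<omega> * (t / T), y t \<omega> + W T \<omega> * h t))"
      unfolding joint_path_def
    proof (rule path_of_cong[OF T])
      fix t assume "t \<in> {0..T}"
      thus "(W t \<omega>, B t \<omega>) = (V T t \<omega> + W T \<omega> * (t / T), y t \<omega> + W T \<omega> * h t)"
        using elim T by (auto simp: V_def)
    qed
    thus ?case using YH[OF elim(3)] by simp
  qed
  have WT: "W T \<in> borel_measurable M" using W_measurable T by simp
  have cd: "cond_distr (completion M) (joint_path T W B) (W T) d = distr M borel (\<lambda>\<omega>. Y \<omega> + d *\<^sub>R H)"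
    by (rule cond_distr_independent_shift[OF subalgebra_bridge_algebra WT indep_bridge_algebra[OF T] pm X full_support_W[OF T]])
  have idN: "(\<lambda>\<omega>. \<omega>) \<in> M \<rightarrow>\<^sub>M bridge_algebra T"
    by (rule measurable_from_subalg[OF subalgebra_bridge_algebra[of T]]) simp
  have Ym: "(\<lambda>\<omega>. Y \<omega> + d *\<^sub>R H) \<in> borel_measurable M"
    using measurable_compose[OF measurable_Pair[OF idN measurable_const[of d borel]] pm] by simp
  have Feq: "F (\<lambda>t. fst (apply_bcontfun (Y \<omega> + d *\<^sub>R H) t)) (\<lambda>t. snd (apply_bcontfun (Y \<omega> + d *\<^sub>R H) t))
      = F (\<lambda>t. V T t \<omega> + d * (t / T)) (\<lambda>t. y t \<omega> + d * h t)" if "\<omega> \<in> space M" for \<omega>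
  proof (rule Fcong)
    fix t assume "t \<in> {0..T}"
    from apply_path_of[OF YHc[OF that] this, of d]
    show "fst (apply_bcontfun (Y \<omega> + d *\<^sub>R H) t) = V T t \<omega> + d * (t / T)
        \<and> snd (apply_bcontfun (Y \<omega> + d *\<^sub>R H) t) = y t \<omega> + d * h t"
      unfolding YH[OF that] by (simp only: fst_conv snd_conv)
  qed
  have "has_bochner_integral M (\<lambda>\<omega>. F (\<lambda>t. fst (apply_bcontfun (Y \<omega> + d *\<^sub>R H) t)) (\<lambda>t. snd (apply_bcontfun (Y \<omega> + d *\<^sub>R H) t))) v"
    by (rule has_bochner_integral_cong[THEN iffD2, OF refl Feq refl v])
  thus ?thesis
    unfolding has_cond_expectation_def cd by (subst has_bochner_integral_distr[OF Fm Ym]) simp_all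
qed

text \<open>
  The error formula \<open>v\<close> holds at times before \<open>T\<close>; its continuity up to \<open>T\<close> provides the bound for
  Fubini's theorem.
\<close>

lemma has_cond_expectation_square:
  assumes T: "0 < T"
    and y: "\<And>t. t \<in> {0..T} \<Longrightarrow> y t \<in> borel_measurable (bridge_algebra T)"
    and yc: "\<And>\<omega>. \<omega> \<in> space M \<Longrightarrow> continuous_on {0..T} (\<lambda>t. y t \<omega>)"
    and h: "continuous_on {0..T} h"
    and B: "AE \<omega> in M. \<forall>t\<in>{0..T}. B t \<omega> = y t \<omega> + W T \<omega> * h t"
    and v: "\<And>t. 0 \<le> t \<Longrightarrow> t < T \<Longrightarrow>
      has_bochner_integral M (\<lambda>\<omega>. ((V T t \<omega> + d * (t / T)) - (y t \<omega> + d * h t))\<^sup>2) (v t)"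
  shows "\<And>t. 0 \<le> t \<Longrightarrow> t < T \<Longrightarrow> has_cond_expectation M T W B (\<lambda>w y. (w t - y t)\<^sup>2) d (v t)"
    and "continuous_on {0..T} v \<Longrightarrow> (v has_integral i) {0..T} \<Longrightarrow>
      has_cond_expectation M T W B (\<lambda>w y. LBINT t:{0..T}. (w t - y t)\<^sup>2) d i"
proof -
  fix t assume t: "0 \<le> t" "t < T"
  show "has_cond_expectation M T W B (\<lambda>w y. (w t - y t)\<^sup>2) d (v t)"
  proof (rule has_cond_expectation_regression[OF T y yc h B])
    show "(\<lambda>x :: real \<Rightarrow>\<^sub>C (real \<times> real). (fst (apply_bcontfun x t) - snd (apply_bcontfun x t))\<^sup>2) \<in> borel_measurable borel"
      by (intro borel_measurable_power borel_measurable_diff measurable_compose[OF measurable_apply_bcontfun] borel_measurable_continuous_onI continuous_intros)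
  qed (use v t in auto)
next
  assume vc: "continuous_on {0..T} v" and i: "(v has_integral i) {0..T}"
  show "has_cond_expectation M T W B (\<lambda>w y. LBINT t:{0..T}. (w t - y t)\<^sup>2) d i"
  proof (rule has_cond_expectation_regression[OF T y yc h B])
    have "(\<lambda>(x :: real \<Rightarrow>\<^sub>C (real \<times> real), t). apply_bcontfun x t) \<in> borel_measurable (borel \<Otimes>\<^sub>M borel)"
      by (intro borel_measurable_pair_continuous_paths measurable_apply_bcontfun) simp
    hence app: "(\<lambda>z :: (real \<Rightarrow>\<^sub>C (real \<times> real)) \<times> real. apply_bcontfun (fst z) (snd z)) \<in> borel_measurable (borel \<Otimes>\<^sub>M lborel)"
      by (simp add: case_prod_beta' cong: measurable_cong_sets sets_pair_measure_cong)
    have [measurable]: "(\<lambda>z :: (real \<Rightarrow>\<^sub>C (real \<times> real)) \<times> real. fst (apply_bcontfun (fst z) (snd z))) \<in> borel_measurable (borel \<Otimes>\<^sub>M lborel)"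
      "(\<lambda>z :: (real \<Rightarrow>\<^sub>C (real \<times> real)) \<times> real. snd (apply_bcontfun (fst z) (snd z))) \<in> borel_measurable (borel \<Otimes>\<^sub>M lborel)"
      by (rule measurable_compose[OF app], rule borel_measurable_continuous_onI, intro continuous_intros)+
    show "(\<lambda>x :: real \<Rightarrow>\<^sub>C (real \<times> real). LBINT t:{0..T}. (fst (apply_bcontfun x t) - snd (apply_bcontfun x t))\<^sup>2) \<in> borel_measurable borel"
      unfolding set_lebesgue_integral_def
      by (rule lborel.borel_measurable_lebesgue_integral) (unfold case_prod_beta', measurable)
    show "(LBINT t:{0..T}. (f t - g t)\<^sup>2) = (LBINT t:{0..T}. (f' t - g' t)\<^sup>2)"
      if "\<And>t. t \<in> {0..T} \<Longrightarrow> f t = f' t \<and> g t = g' t" for f f' g g' :: "real \<Rightarrow> real"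
      using that by (intro set_lebesgue_integral_cong) auto
    \<comment> \<open>clamping the time gives continuous paths on the whole line, as joint measurability needs\<close>
    define c where "c = (\<lambda>t. max 0 (min t T))"
    have c: "c t \<in> {0..T}" "t \<in> {0..T} \<Longrightarrow> c t = t" for t using T by (auto simp: c_def)
    define Z where "Z = (\<lambda>t \<omega>. ((V T (c t) \<omega> + d * (c t / T)) - (y (c t) \<omega> + d * h (c t)))\<^sup>2)"
    have "compact (v ` {0..T})" by (intro compact_continuous_image vc) simp
    then obtain K where K: "\<forall>t\<in>{0..T}. \<bar>v t\<bar> \<le> K"
      using compact_imp_bounded[of "v ` {0..T}"] by (auto simp: bounded_iff)
    have Zv: "has_bochner_integral M (Z t) (v t)" if "0 \<le> t" "t < T" for t
      using v[OF that] c(2)[of t] that by (simp add: Z_def)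
    have "has_bochner_integral M (\<lambda>\<omega>. LBINT t:{0..T}. Z t \<omega>) (LBINT t:{0..T}. v t)"
    proof (rule has_bochner_integral_process_integral[OF _ Zv])
      show "(\<lambda>(\<omega>, t). Z t \<omega>) \<in> borel_measurable (M \<Otimes>\<^sub>M borel)"
      proof (rule borel_measurable_pair_continuous_paths)
        fix t
        have [measurable]: "y (c t) \<in> borel_measurable M"
          by (rule measurable_from_subalg[OF subalgebra_bridge_algebra y[OF c(1)]])
        show "Z t \<in> borel_measurable M" unfolding Z_def by measurable
      next
        fix \<omega> assume \<omega>: "\<omega> \<in> space M"
        have "continuous_on {0..T} (\<lambda>t. ((V T t \<omega> + d * (t / T)) - (y t \<omega> + d * h t))\<^sup>2)"
          using T by (intro continuous_intros V_continuous yc h \<omega>) auto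
        thus "continuous_on UNIV (\<lambda>t. Z t \<omega>)"
          unfolding Z_def
          by (rule continuous_on_compose2[of _ _ UNIV c]) (use c in \<open>auto simp: c_def intro!: continuous_intros\<close>)
      qed
      fix t assume t: "0 \<le> t" "t < T"
      have "(\<integral>\<omega>. \<bar>Z t \<omega>\<bar> \<partial>M) = v t" using Zv[OF t] by (simp add: Z_def has_bochner_integral_iff)
      moreover have "\<bar>v t\<bar> \<le> K" using K t by simp
      ultimately show "(\<integral>\<omega>. \<bar>Z t \<omega>\<bar> \<partial>M) \<le> K" by linarith
    qed
    moreover have "(LBINT t:{0..T}. v t) = i"
      using set_borel_integral_eq_integral(2)[OF borel_integrable_atLeastAtMost'[OF vc]] i by (simp add: integral_unique)
    moreover have "(LBINT t:{0..T}. Z t \<omega>) = (LBINT t:{0..T}. ((V T t \<omega> + d * (t / T)) - (y t \<omega> + d * h t))\<^sup>2)" for \<omega>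
      using c by (intro set_lebesgue_integral_cong) (auto simp: Z_def)
    ultimately show "has_bochner_integral M (\<lambda>\<omega>. LBINT t:{0..T}. ((V T t \<omega> + d * (t / T)) - (y t \<omega> + d * h t))\<^sup>2) i"
      by simp
  qed
qed

lemma has_bochner_integral_square_shift:
  fixes G :: "'a \<Rightarrow> real" and m s :: real
  assumes "has_bochner_integral M G 0" "has_bochner_integral M (\<lambda>\<omega>. (G \<omega>)\<^sup>2) s"
  shows "has_bochner_integral M (\<lambda>\<omega>. (G \<omega> + m)\<^sup>2) (s + m\<^sup>2)"
proof -
  have "has_bochner_integral M (\<lambda>\<omega>. (G \<omega>)\<^sup>2 + (2 * m) * G \<omega> + m\<^sup>2) (s + (2 * m) * 0 + m\<^sup>2)"
    using assms by (intro has_bochner_integral_add has_bochner_integral_mult_right)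
      (auto simp: has_bochner_integral_iff prob_space)
  thus ?thesis by (simp add: power2_sum algebra_simps)
qed

lemma V_mean: "has_bochner_integral M (V T r) 0" if "0 < T"
proof -
  have "has_bochner_integral M (V T r) (0 - min (max 0 r) T / T * 0)"
    unfolding V_def[abs_def] using that by (intro has_bochner_integral_diff has_bochner_integral_mult_right w_mean) auto
  thus ?thesis by simp
qed

lemma V_covariance:
  assumes T: "0 < T" and s: "0 \<le> s" and r: "0 \<le> r"
  shows "has_bochner_integral M (\<lambda>\<omega>. V T s \<omega> * V T r \<omega>) (min s r - min s T * min r T / T)"
proof -
  have "has_bochner_integral M (\<lambda>\<omega>. w s \<omega> * w r \<omega> - min r T / T * (w s \<omega> * w T \<omega>) - min s T / T * (w r \<omega> * w T \<omega>)
      + (min s T / T * (min r T / T)) * (w T \<omega> * w T \<omega>))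
     (min s r - min r T / T * min s T - min s T / T * min r T + (min s T / T * (min r T / T)) * min T T)"
    using assms by (intro has_bochner_integral_add has_bochner_integral_diff has_bochner_integral_mult_right w_covariance) auto
  also have "min s r - min r T / T * min s T - min s T / T * min r T + (min s T / T * (min r T / T)) * min T T
      = min s r - min s T * min r T / T"
    using T by (simp add: mult.commute)
  finally show ?thesis using s r by (simp add: V_def algebra_simps)
qed

end

section \<open>Time integrals of the error formulas\<close>

lemma has_integral_FTC:
  fixes F f :: "real \<Rightarrow> real"
  assumes "a \<le> b" "\<And>x. x \<in> {a..b} \<Longrightarrow> (F has_real_derivative f x) (at x)"
  shows "(f has_integral F b - F a) {a..b}"
  using assms
  by (intro fundamental_theorem_of_calculus)
    (auto simp: has_real_derivative_iff_has_vector_derivative[symmetric] intro: has_field_derivative_at_within)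

lemma integral_av_error:
  fixes T :: real
  assumes T: "0 < T"
  shows "((\<lambda>t. (d - b)\<^sup>2 * (t\<^sup>2 / T\<^sup>2)) has_integral 1 / 3 * (d - b)\<^sup>2 * T) {0..T}"
proof -
  have "((\<lambda>t. (d - b)\<^sup>2 * (t\<^sup>2 / T\<^sup>2)) has_integral (d - b)\<^sup>2 * (T ^ 3 / (3 * T\<^sup>2)) - (d - b)\<^sup>2 * (0 ^ 3 / (3 * T\<^sup>2))) {0..T}"
    by (rule has_integral_FTC[where F="\<lambda>t. (d - b)\<^sup>2 * (t ^ 3 / (3 * T\<^sup>2))"])
      (use T in \<open>auto intro!: derivative_eq_intros simp: field_simps power2_eq_square\<close>)
  also have "(d - b)\<^sup>2 * (T ^ 3 / (3 * T\<^sup>2)) - (d - b)\<^sup>2 * (0 ^ 3 / (3 * T\<^sup>2)) = 1 / 3 * (d - b)\<^sup>2 * T"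
    using T by (simp add: power2_eq_square power3_eq_cube)
  finally show ?thesis .
qed

text \<open>
  The indicator of \<open>[T/2, T)\<close> is written as a maximum, which shows that the formula is continuous.
\<close>

lemma integral_st_error:
  fixes T b d :: real
  assumes T: "0 < T"
  defines "v \<equiv> \<lambda>t. t\<^sup>2 / T - (max 0 (2 * t - T))\<^sup>2 / T + (b * (t / T) - d * (max 0 (2 * t - T) / T))\<^sup>2"
  shows "(v has_integral 1 / 6 * (d - b)\<^sup>2 * T + 1 / 6 * b\<^sup>2 * T - 1 / 12 * d * b * T + 1 / 6 * T\<^sup>2) {0..T}"
proof -
  let ?F = "\<lambda>t. t ^ 3 / (3 * T) + b\<^sup>2 * t ^ 3 / (3 * T\<^sup>2)"
  let ?G = "\<lambda>t. t ^ 3 / (3 * T) - (2 * t - T) ^ 3 / (6 * T)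
    + (b\<^sup>2 * t ^ 3 / 3 - 2 * b * d * (2 * t ^ 3 / 3 - T * t\<^sup>2 / 2) + d\<^sup>2 * (2 * t - T) ^ 3 / 6) / T\<^sup>2"
  have "((\<lambda>t. t\<^sup>2 / T + b\<^sup>2 * t\<^sup>2 / T\<^sup>2) has_integral ?F (T / 2) - ?F 0) {0..T / 2}"
    by (rule has_integral_FTC) (use T in \<open>auto intro!: derivative_eq_intros simp: power2_eq_square power4_eq_xxxx\<close>)
  hence 1: "(v has_integral ?F (T / 2) - ?F 0) {0..T / 2}"
  proof (rule has_integral_eq[rotated])
    fix t assume "t \<in> {0..T / 2}"
    hence m: "max 0 (2 * t - T) = 0" by auto
    have "(b * (t / T))\<^sup>2 = b\<^sup>2 * t\<^sup>2 / T\<^sup>2" by (simp add: power_mult_distrib power_divide)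
    thus "t\<^sup>2 / T + b\<^sup>2 * t\<^sup>2 / T\<^sup>2 = v t" unfolding v_def m by simp
  qed
  have "((\<lambda>t. t\<^sup>2 / T - (2 * t - T)\<^sup>2 / T + (b\<^sup>2 * t\<^sup>2 - 2 * b * d * (2 * t\<^sup>2 - T * t) + d\<^sup>2 * (2 * t - T)\<^sup>2) / T\<^sup>2)
      has_integral ?G T - ?G (T / 2)) {T / 2..T}"
  proof (rule has_integral_FTC)
    fix t
    show "(?G has_real_derivative t\<^sup>2 / T - (2 * t - T)\<^sup>2 / T + (b\<^sup>2 * t\<^sup>2 - 2 * b * d * (2 * t\<^sup>2 - T * t) + d\<^sup>2 * (2 * t - T)\<^sup>2) / T\<^sup>2) (at t)"
      using T by (auto intro!: derivative_eq_intros simp: divide_simps) (simp add: algebra_simps)?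
  qed (use T in simp)
  hence 2: "(v has_integral ?G T - ?G (T / 2)) {T / 2..T}"
  proof (rule has_integral_eq[rotated])
    fix t assume "t \<in> {T / 2..T}"
    hence m: "max 0 (2 * t - T) = 2 * t - T" by auto
    show "t\<^sup>2 / T - (2 * t - T)\<^sup>2 / T + (b\<^sup>2 * t\<^sup>2 - 2 * b * d * (2 * t\<^sup>2 - T * t) + d\<^sup>2 * (2 * t - T)\<^sup>2) / T\<^sup>2 = v t"
    proof -
      have "(b * (t / T) - d * ((2 * t - T) / T))\<^sup>2 = ((b * t - d * (2 * t - T)) / T)\<^sup>2"
      proof -
        have "b * (t / T) - d * ((2 * t - T) / T) = (b * t - d * (2 * t - T)) / T"
          using T by (simp add: field_simps)
        thus ?thesis by (simp only:)
      qed
      also have "\<dots> = (b\<^sup>2 * t\<^sup>2 - 2 * b * d * (2 * t\<^sup>2 - T * t) + d\<^sup>2 * (2 * t - T)\<^sup>2) / T\<^sup>2"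
        unfolding power_divide by (rule arg_cong[where f="\<lambda>x. x / T\<^sup>2"]) (simp add: power2_eq_square algebra_simps)
      finally show ?thesis by (simp only: v_def m)
    qed
  qed
  have "(v has_integral (?F (T / 2) - ?F 0) + (?G T - ?G (T / 2))) {0..T}"
    by (rule has_integral_combine[OF _ _ 1 2]) (use T in auto)
  also have "(?F (T / 2) - ?F 0) + (?G T - ?G (T / 2))
      = 1 / 6 * (d - b)\<^sup>2 * T + 1 / 6 * b\<^sup>2 * T - 1 / 12 * d * b * T + 1 / 6 * T\<^sup>2"
    using T by (simp add: field_simps power2_eq_square power3_eq_cube)
  finally show ?thesis .
qed

text \<open>
  The regression coefficient of the integral representation on the end point.
\<close>

lemma bridge_op_linear_path:
  assumes "0 < T" "0 \<le> t"
  shows "bridge_op T (\<lambda>s. s / T) t = (if t < T then - ((T - t) / T * ln ((T - t) / T)) else 0)"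
proof (cases "t < T")
  case True
  have "wint T (\<lambda>s. s / T) t = wint T (\<lambda>s. s) t / T"
    using wint_mult_right[of T "\<lambda>s. s" "1 / T" t] by simp
  moreover have "t / T - y * ((t / y + l) / T) = - (y / T * l)" if "y \<noteq> 0" for y l :: real
    using that by (simp add: distrib_left add_divide_distrib)
  from this[of "T - t"] have "t / T - (T - t) * ((t / (T - t) + ln ((T - t) / T)) / T) = - ((T - t) / T * ln ((T - t) / T))"
    using True by simp
  ultimately show ?thesis using True assms wint_identity[of t T] by (simp add: bridge_op_def)
qed (simp add: bridge_op_def)

text \<open>
  Continuity of \<open>u ln u\<close> at \<open>u = 0\<close> is the continuity of \<open>bridge_op\<close> at \<open>T\<close>.
\<close>

lemma continuous_on_entropy:
  assumes T: "0 < (T :: real)"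
  shows "continuous_on {0..T} (\<lambda>t. (T - t) / T * ln ((T - t) / T))"
proof -
  have "continuous_on {0..T} (\<lambda>t. - bridge_op T (\<lambda>s. s / T) t)"
    using T by (intro continuous_intros bridge_op_continuous_on) auto
  also have "?this \<longleftrightarrow> ?thesis"
    by (rule continuous_on_cong) (auto simp: bridge_op_linear_path[OF T])
  finally show ?thesis .
qed

lemma integral_ir_error:
  fixes T b d :: real
  assumes T: "0 < T"
  defines "\<eta> \<equiv> \<lambda>t. (T - t) / T * ln ((T - t) / T)"
  defines "v \<equiv> \<lambda>t. 2 * t * ((T - t) / T) + 2 * (T - t) * \<eta> t - T * (\<eta> t)\<^sup>2 + ((d - b) * (t / T) + d * \<eta> t)\<^sup>2"
  shows "continuous_on {0..T} v"
    and "(v has_integral 7 / 54 * (b - d)\<^sup>2 * T + 11 / 54 * b\<^sup>2 * T - 7 / 54 * d * b * T + 1 / 27 * T\<^sup>2) {0..T}"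
proof -
  have \<eta>: "continuous_on {0..T} \<eta>" unfolding \<eta>_def by (rule continuous_on_entropy[OF T])
  show "continuous_on {0..T} v" unfolding v_def using T by (intro continuous_intros \<eta>) auto
  define u where "u = (\<lambda>t. (T - t) / T)"
  have u: "continuous_on {0..T} u" unfolding u_def using T by (intro continuous_intros) auto
  \<comment> \<open>in terms of \<open>u = (T - t) / T\<close> and \<open>\<eta> = u ln u\<close>, the function \<open>- T \<Phi>\<close> is an antiderivative of \<open>v\<close>\<close>
  define a where "a = d - b"
  define \<Phi> where "\<Phi> = (\<lambda>t. T * ((u t)\<^sup>2 - 2 / 3 * (u t) ^ 3) + 2 * T * (1 / 3 * ((u t)\<^sup>2 * \<eta> t) - 1 / 9 * (u t) ^ 3)
     + (d\<^sup>2 - T) * (1 / 3 * (u t * (\<eta> t)\<^sup>2) - 2 / 9 * ((u t)\<^sup>2 * \<eta> t) + 2 / 27 * (u t) ^ 3)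
     - a\<^sup>2 * (1 / 3 * (1 - u t) ^ 3)
     + 2 * a * d * ((1 / 2 * (u t * \<eta> t) - 1 / 4 * (u t)\<^sup>2) - (1 / 3 * ((u t)\<^sup>2 * \<eta> t) - 1 / 9 * (u t) ^ 3)))"
  have "(v has_integral - T * \<Phi> T - (- T * \<Phi> 0)) {0..T}"
  proof (rule fundamental_theorem_of_calculus_interior)
    show "0 \<le> T" using T by simp
    show "continuous_on {0..T} (\<lambda>t. - T * \<Phi> t)"
      unfolding \<Phi>_def by (intro continuous_intros \<eta> u) auto
    fix t assume t: "t \<in> {0<..<T}"
    define x where "x = u t"
    define L where "L = ln x"
    have x: "0 < x" "x < 1" "t = T * (1 - x)" using t T by (auto simp: x_def u_def field_simps)
    have e: "\<eta> t = x * L" by (simp add: \<eta>_def x_def u_def L_def)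
    have du: "(u has_real_derivative - 1 / T) (at t)"
      unfolding u_def using T by (auto intro!: derivative_eq_intros)
    have "((\<lambda>t. u t * ln (u t)) has_real_derivative - 1 / T * ln (u t) + (- 1 / T) / u t * u t) (at t)"
      using x(1) unfolding x_def by (auto intro!: derivative_eq_intros du)
    moreover have "- 1 / T * ln (u t) + (- 1 / T) / u t * u t = - (L + 1) / T"
      unfolding x_def[symmetric] L_def using x(1) by (simp add: add_divide_distrib diff_divide_distrib)
    moreover have "(\<lambda>t. u t * ln (u t)) = \<eta>" by (simp add: \<eta>_def u_def)
    ultimately have d\<eta>: "(\<eta> has_real_derivative - (L + 1) / T) (at t)" by simp
    define r where "r = - 1 / T"
    have du': "(u has_real_derivative r) (at t)" and d\<eta>': "(\<eta> has_real_derivative r * (L + 1)) (at t)"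
    proof -
      have "- (L + 1) / T = r * (L + 1)" unfolding r_def using T by (simp add: divide_simps)
      thus "(u has_real_derivative r) (at t)" "(\<eta> has_real_derivative r * (L + 1)) (at t)"
        using du d\<eta> by (simp_all only: r_def)
    qed
    define Q where "Q = 2 * (T * (1 - x)) * x + 2 * (T * x) * (x * L) - T * (x * L)\<^sup>2 + (a * (1 - x) + d * (x * L))\<^sup>2"
    have vQ: "v t = Q"
    proof -
      have "(T - t) / T = x" "T - t = T * x" "t / T = 1 - x" using x(3) T by (simp_all add: field_simps)
      thus ?thesis unfolding v_def e Q_def a_def using x(3) by simp
    qed
    have D1: "((\<lambda>t. (u t)\<^sup>2) has_real_derivative 2 * x * r) (at t)"
      using DERIV_power[OF du', of 2] by (simp add: x_def mult_ac)
    have D2: "((\<lambda>t. (u t) ^ 3) has_real_derivative 3 * x\<^sup>2 * r) (at t)"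
      using DERIV_power[OF du', of 3] by (simp add: x_def mult_ac)
    have D3: "((\<lambda>t. u t * \<eta> t) has_real_derivative r * (x * L) + r * (L + 1) * x) (at t)"
      using DERIV_mult[OF du' d\<eta>'] by (simp add: x_def[symmetric] e)
    have D4: "((\<lambda>t. (u t)\<^sup>2 * \<eta> t) has_real_derivative 2 * x * r * (x * L) + r * (L + 1) * x\<^sup>2) (at t)"
      using DERIV_mult[OF D1 d\<eta>'] by (simp add: x_def[symmetric] e)
    have D5: "((\<lambda>t. u t * (\<eta> t)\<^sup>2) has_real_derivative r * (x * L)\<^sup>2 + 2 * (x * L) * (r * (L + 1)) * x) (at t)"
    proof -
      have "((\<lambda>t. (\<eta> t)\<^sup>2) has_real_derivative 2 * (x * L) * (r * (L + 1))) (at t)"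
        using DERIV_power[OF d\<eta>', of 2] by (simp add: e mult_ac)
      from DERIV_mult[OF du' this] show ?thesis by (simp add: x_def[symmetric] e)
    qed
    have D6: "((\<lambda>t. (1 - u t) ^ 3) has_real_derivative 3 * (1 - x)\<^sup>2 * (- r)) (at t)"
      using DERIV_power[OF DERIV_diff[OF DERIV_const[of 1] du'], of 3] by (simp add: x_def mult_ac)
    let ?D = "T * (2 * x * r - 2 / 3 * (3 * x\<^sup>2 * r))
        + 2 * T * (1 / 3 * (2 * x * r * (x * L) + r * (L + 1) * x\<^sup>2) - 1 / 9 * (3 * x\<^sup>2 * r))
        + (d\<^sup>2 - T) * (1 / 3 * (r * (x * L)\<^sup>2 + 2 * (x * L) * (r * (L + 1)) * x)
            - 2 / 9 * (2 * x * r * (x * L) + r * (L + 1) * x\<^sup>2) + 2 / 27 * (3 * x\<^sup>2 * r))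
        - a\<^sup>2 * (1 / 3 * (3 * (1 - x)\<^sup>2 * (- r)))
        + 2 * a * d * ((1 / 2 * (r * (x * L) + r * (L + 1) * x) - 1 / 4 * (2 * x * r))
            - (1 / 3 * (2 * x * r * (x * L) + r * (L + 1) * x\<^sup>2) - 1 / 9 * (3 * x\<^sup>2 * r)))"
    have "(\<Phi> has_real_derivative ?D) (at t)"
      unfolding \<Phi>_def by (intro DERIV_add DERIV_diff DERIV_cmult D1 D2 D3 D4 D5 D6)
    also have "?D = r * Q"
      unfolding Q_def by (simp add: power2_eq_square algebra_simps)
    finally have "(\<Phi> has_real_derivative r * Q) (at t)" .
    from DERIV_cmult[OF this, of "- T"] have "((\<lambda>t. - T * \<Phi> t) has_real_derivative v t) (at t)"
      using T by (simp add: vQ r_def)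
    thus "((\<lambda>t. - T * \<Phi> t) has_vector_derivative v t) (at t)"
      by (simp add: has_real_derivative_iff_has_vector_derivative)
  qed
  also have "- T * \<Phi> T - (- T * \<Phi> 0) = 7 / 54 * (b - d)\<^sup>2 * T + 11 / 54 * b\<^sup>2 * T - 7 / 54 * d * b * T + 1 / 27 * T\<^sup>2"
    using T by (simp add: \<Phi>_def u_def \<eta>_def a_def power2_eq_square field_simps)
  finally show "(v has_integral 7 / 54 * (b - d)\<^sup>2 * T + 11 / 54 * b\<^sup>2 * T - 7 / 54 * d * b * T + 1 / 27 * T\<^sup>2) {0..T}" .
qed

section \<open>The three versions of the bridge\<close>

context wiener_process
begin

text \<open>
  On the exceptional null set the zero path is used.
\<close>

lemma continuous_version:
  obtains w where "continuous_wiener M W w"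
proof -
  have "AE \<omega> in M. continuous_on {0..} (\<lambda>t. W t \<omega>) \<and> ((\<lambda>u. W u \<omega> / u) \<longlongrightarrow> 0) at_top"
    using W_continuous strong_law by eventually_elim auto
  then obtain N where N: "N \<in> null_sets M"
    "\<And>\<omega>. \<omega> \<in> space M - N \<Longrightarrow> continuous_on {0..} (\<lambda>t. W t \<omega>) \<and> ((\<lambda>u. W u \<omega> / u) \<longlongrightarrow> 0) at_top"
    by (rule AE_E3) blast
  define w where "w = (\<lambda>t \<omega>. if \<omega> \<in> N then 0 else W (max 0 t) \<omega>)"
  have "continuous_wiener M W w"
  proof (unfold_locales)
    fix t
    have "N \<in> events" using N by auto
    thus "w t \<in> borel_measurable M"
      unfolding w_def by (intro measurable_If_set measurable_const W_measurable) auto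
  next
    fix \<omega> assume \<omega>: "\<omega> \<in> space M"
    show "continuous_on UNIV (\<lambda>t. w t \<omega>)"
    proof (cases "\<omega> \<in> N")
      case False
      hence "continuous_on {0..} (\<lambda>t. W t \<omega>)" using N(2) \<omega> by auto
      hence "continuous_on UNIV (\<lambda>t. W (max 0 t) \<omega>)"
        by (rule continuous_on_compose2) (auto intro!: continuous_intros)
      thus ?thesis using False by (simp add: w_def)
    qed (simp add: w_def)
    show "((\<lambda>u. w u \<omega> / u) \<longlongrightarrow> 0) at_top"
    proof (cases "\<omega> \<in> N")
      case False
      hence "((\<lambda>u. W u \<omega> / u) \<longlongrightarrow> 0) at_top" using N(2) \<omega> by auto
      moreover have "\<forall>\<^sub>F u in at_top. W u \<omega> / u = w u \<omega> / u"
        using eventually_ge_at_top[of 0] by eventually_elim (use False in \<open>simp add: w_def\<close>)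
      ultimately show ?thesis by (rule tendsto_cong[THEN iffD1, rotated])
    qed (simp add: w_def)
  next
    have "AE \<omega> in M. \<omega> \<notin> N" using N(1) by (rule AE_not_in)
    thus "AE \<omega> in M. \<forall>t\<ge>0. w t \<omega> = W t \<omega>"
      by eventually_elim (simp add: w_def)
  qed
  thus thesis by (rule that)
qed

end

context continuous_wiener
begin

lemma conditional_error_av:
  assumes T: "0 < T"
  shows "\<And>t. 0 \<le> t \<Longrightarrow> t < T \<Longrightarrow> has_cond_expectation M T W (bridge_av W T b) (\<lambda>w y. (w t - y t)\<^sup>2) d ((d - b)\<^sup>2 * (t\<^sup>2 / T\<^sup>2))"
    and "has_cond_expectation M T W (bridge_av W T b) (\<lambda>w y. LBINT t:{0..T}. (w t - y t)\<^sup>2) d (1 / 3 * (d - b)\<^sup>2 * T)"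
proof -
  define y where "y = (\<lambda>t \<omega>. V T t \<omega> + b * (t / T))"
  define h where "h = (\<lambda>t :: real. 0 :: real)"
  have ym: "y t \<in> borel_measurable (bridge_algebra T)" for t
    unfolding y_def by (intro borel_measurable_add borel_measurable_const V_measurable_bridge_algebra)
  have yc: "continuous_on {0..T} (\<lambda>t. y t \<omega>)" if "\<omega> \<in> space M" for \<omega>
    unfolding y_def using T by (intro continuous_intros V_continuous that) auto
  have h: "continuous_on {0..T} h" by (simp add: h_def)
  have B: "AE \<omega> in M. \<forall>t\<in>{0..T}. bridge_av W T b t \<omega> = y t \<omega> + W T \<omega> * h t"
    using w_AE
  proof eventually_elim
    case (elim \<omega>)
    thus ?case using T by (auto simp: bridge_av_def y_def h_def V_def)
  qed
  have v: "has_bochner_integral M (\<lambda>\<omega>. ((V T t \<omega> + d * (t / T)) - (y t \<omega> + d * h t))\<^sup>2) ((d - b)\<^sup>2 * (t\<^sup>2 / T\<^sup>2))" for t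
  proof -
    have "((V T t \<omega> + d * (t / T)) - (y t \<omega> + d * h t))\<^sup>2 = (d - b)\<^sup>2 * (t\<^sup>2 / T\<^sup>2)" for \<omega>
    proof -
      have "(V T t \<omega> + d * (t / T)) - (y t \<omega> + d * h t) = (d - b) * (t / T)"
        by (simp add: y_def h_def left_diff_distrib diff_divide_distrib)
      thus ?thesis by (simp only: power_mult_distrib power_divide)
    qed
    thus ?thesis by (simp add: has_bochner_integral_iff prob_space)
  qed
  note sq = has_cond_expectation_square[where y=y and h=h and B="bridge_av W T b" and d=d, OF T ym yc h B v]
  show "has_cond_expectation M T W (bridge_av W T b) (\<lambda>w y. (w t - y t)\<^sup>2) d ((d - b)\<^sup>2 * (t\<^sup>2 / T\<^sup>2))" if "0 \<le> t" "t < T" for t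
    by (rule sq(1)[OF _ that])
  show "has_cond_expectation M T W (bridge_av W T b) (\<lambda>w y. LBINT t:{0..T}. (w t - y t)\<^sup>2) d (1 / 3 * (d - b)\<^sup>2 * T)"
  proof (rule sq(2))
    show "continuous_on {0..T} (\<lambda>t. (d - b)\<^sup>2 * (t\<^sup>2 / T\<^sup>2))"
      using T by (intro continuous_intros) auto
    show "((\<lambda>t. (d - b)\<^sup>2 * (t\<^sup>2 / T\<^sup>2)) has_integral 1 / 3 * (d - b)\<^sup>2 * T) {0..T}"
      by (rule integral_av_error[OF T])
  qed
qed

text \<open>
  Near \<open>T\<close> one has \<open>((T - t) / T) W\<^sub>r = t W\<^sub>r / r\<close> with \<open>r = t T / (T - t) \<rightarrow> \<infinity>\<close>, which tends to 0 by the
  strong law.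
\<close>

lemma space_time_bridge_continuous:
  assumes T: "0 < T" and \<omega>: "\<omega> \<in> space M"
  shows "continuous_on {0..T} (\<lambda>t. if t < T then (T - t) / T * V T (t * T / (T - t)) \<omega> else 0)"
proof (unfold continuous_on_def, intro ballI)
  let ?f = "\<lambda>t. (T - t) / T * V T (t * T / (T - t)) \<omega>"
  let ?g = "\<lambda>t. if t < T then ?f t else 0"
  fix t assume t: "t \<in> {0..T}"
  show "(?g \<longlongrightarrow> ?g t) (at t within {0..T})"
  proof (cases "t < T")
    case True
    have "continuous_on {0..<T} ?f"
      using T by (intro continuous_intros continuous_on_compose2[OF V_continuous[OF \<omega> T, of UNIV]]) auto
    hence "(?f \<longlongrightarrow> ?f t) (at t within {0..<T})"
      using t True by (simp add: continuous_on_def)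
    moreover have "at t within {0..<T} = at t within {0..T}"
      by (rule at_within_nhd[where S="{..<T}"]) (use t True in auto)
    ultimately have "(?f \<longlongrightarrow> ?f t) (at t within {0..T})" by simp
    moreover have "\<forall>\<^sub>F s in at t within {0..T}. ?f s = ?g s"
      unfolding eventually_at_topological
      by (rule exI[of _ "{..<T}"]) (use True in auto)
    ultimately have "(?g \<longlongrightarrow> ?f t) (at t within {0..T})"
      by (rule tendsto_cong[THEN iffD1, rotated])
    thus ?thesis using True by simp
  next
    case False
    hence tT: "t = T" using t by simp
    have ev: "\<forall>\<^sub>F s in at_left T. T / 2 < s \<and> s < T"
      using T by (intro eventually_conj) (auto simp: eventually_at_left_field intro!: exI[of _ "T / 2"])
    have "((\<lambda>s. T - s) \<longlongrightarrow> T - T) (at_left T)" by (intro tendsto_intros)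
    hence "filterlim (\<lambda>s. T - s) (at_right 0) (at_left T)"
      unfolding filterlim_at by (auto intro: eventually_mono[OF ev])
    from filterlim_compose[OF filterlim_inverse_at_top_right this]
    have "LIM s at_left T. inverse (T - s) :> at_top" .
    moreover have "((\<lambda>s. s * T) \<longlongrightarrow> T * T) (at_left T)" by (intro tendsto_intros)
    ultimately have "LIM s at_left T. (s * T) * inverse (T - s) :> at_top"
      using T by (intro filterlim_tendsto_pos_mult_at_top[where c="T * T"]) auto
    from filterlim_compose[OF w_sublinear[OF \<omega>] this]
    have "((\<lambda>s. w (s * T / (T - s)) \<omega> / (s * T / (T - s))) \<longlongrightarrow> 0) (at_left T)"
      by (simp add: divide_inverse)
    hence "((\<lambda>s. s * (w (s * T / (T - s)) \<omega> / (s * T / (T - s))) - (T - s) / T * w T \<omega>) \<longlongrightarrow> T * 0 - (T - T) / T * w T \<omega>) (at_left T)"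
      using T by (intro tendsto_intros) auto
    moreover have "\<forall>\<^sub>F s in at_left T. s * (w (s * T / (T - s)) \<omega> / (s * T / (T - s))) - (T - s) / T * w T \<omega> = ?g s"
      using ev
    proof eventually_elim
      case (elim s)
      have "T \<le> s * T / (T - s)" using elim T by (simp add: field_simps)
      hence V: "V T (s * T / (T - s)) \<omega> = w (s * T / (T - s)) \<omega> - w T \<omega>"
        using T by (simp add: V_def max_def min_def)
      have "s * (z / (s * T / (T - s))) = (T - s) / T * z" for z
        using elim T by (simp add: field_simps)
      thus ?case using elim V by (simp add: right_diff_distrib)
    qed
    ultimately have "(?g \<longlongrightarrow> T * 0 - (T - T) / T * w T \<omega>) (at_left T)"
      by (rule tendsto_cong[THEN iffD1, rotated])
    thus ?thesis using T unfolding tT by (simp add: at_within_Icc_at_left)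
  qed
qed

lemma space_time_error_variance:
  assumes T: "0 < T" and t: "0 \<le> t" "t < T"
  shows "has_bochner_integral M (\<lambda>\<omega>. (V T t \<omega> - (T - t) / T * V T (t * T / (T - t)) \<omega>)\<^sup>2) (t\<^sup>2 / T - (max 0 (2 * t - T))\<^sup>2 / T)"
proof -
  define r where "r = t * T / (T - t)"
  define a where "a = (T - t) / T"
  have r: "0 \<le> r" "t \<le> r" using t T by (auto simp: r_def field_simps)
  have ar: "a * r = t" using t T by (simp add: a_def r_def)
  have am: "a * min r T = min t (T - t)"
  proof -
    have "a * min r T = min (a * r) (a * T)" using t T by (simp add: a_def min_mult_distrib_left)
    thus ?thesis using ar T by (simp add: a_def)
  qed
  have "has_bochner_integral M (\<lambda>\<omega>. V T t \<omega> * V T t \<omega> - (2 * a) * (V T t \<omega> * V T r \<omega>) + a\<^sup>2 * (V T r \<omega> * V T r \<omega>))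
     ((min t t - min t T * min t T / T) - (2 * a) * (min t r - min t T * min r T / T) + a\<^sup>2 * (min r r - min r T * min r T / T))"
    by (intro has_bochner_integral_add has_bochner_integral_diff has_bochner_integral_mult_right V_covariance T t r)
  also have "(min t t - min t T * min t T / T) - (2 * a) * (min t r - min t T * min r T / T) + a\<^sup>2 * (min r r - min r T * min r T / T)
     = (t - t * t / T) - (2 * a * t - 2 * t * (a * min r T) / T) + (a * (a * r) - (a * min r T) * (a * min r T) / T)"
    using t r by (simp add: min_def power2_eq_square algebra_simps)
  also have "\<dots> = t\<^sup>2 / T - (max 0 (2 * t - T))\<^sup>2 / T"
  proof (cases "t \<le> T - t")
    case True
    hence "min t (T - t) = t" "max 0 (2 * t - T) = 0" by auto
    thus ?thesis unfolding am ar using T by (simp add: a_def field_simps power2_eq_square)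
  next
    case False
    hence "min t (T - t) = T - t" "max 0 (2 * t - T) = 2 * t - T" by auto
    thus ?thesis unfolding am ar using T by (simp add: a_def field_simps power2_eq_square)
  qed
  finally have "has_bochner_integral M (\<lambda>\<omega>. V T t \<omega> * V T t \<omega> - (2 * a) * (V T t \<omega> * V T r \<omega>) + a\<^sup>2 * (V T r \<omega> * V T r \<omega>)) (t\<^sup>2 / T - (max 0 (2 * t - T))\<^sup>2 / T)" .
  moreover have "x * x - (2 * a) * (x * z) + a\<^sup>2 * (z * z) = (x - a * z)\<^sup>2" for x z :: real
    by (simp add: power2_eq_square algebra_simps)
  ultimately show ?thesis by (simp only: a_def[symmetric] r_def[symmetric])
qed

lemma conditional_error_st:
  fixes T b d :: real
  assumes T: "0 < T"
  defines "v \<equiv> \<lambda>t. t\<^sup>2 / T - (max 0 (2 * t - T))\<^sup>2 / T + (b * (t / T) - d * (max 0 (2 * t - T) / T))\<^sup>2"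
  shows "\<And>t. 0 \<le> t \<Longrightarrow> t < T \<Longrightarrow> has_cond_expectation M T W (bridge_st W T b) (\<lambda>w y. (w t - y t)\<^sup>2) d (v t)"
    and "has_cond_expectation M T W (bridge_st W T b) (\<lambda>w y. LBINT t:{0..T}. (w t - y t)\<^sup>2) d
      (1 / 6 * (d - b)\<^sup>2 * T + 1 / 6 * b\<^sup>2 * T - 1 / 12 * d * b * T + 1 / 6 * T\<^sup>2)"
proof -
  define y where "y = (\<lambda>t \<omega>. (if t < T then (T - t) / T * V T (t * T / (T - t)) \<omega> else 0) + b * (t / T))"
  define h where "h = (\<lambda>t. min t (T - t) / T)"
  have ym: "y t \<in> borel_measurable (bridge_algebra T)" for t
  proof -
    note [measurable] = V_measurable_bridge_algebra
    show ?thesis unfolding y_def by measurable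
  qed
  have yc: "continuous_on {0..T} (\<lambda>t. y t \<omega>)" if "\<omega> \<in> space M" for \<omega>
    unfolding y_def using T by (intro continuous_on_add space_time_bridge_continuous that continuous_intros) auto
  have h: "continuous_on {0..T} h" unfolding h_def using T by (intro continuous_intros) auto
  have B: "AE \<omega> in M. \<forall>t\<in>{0..T}. bridge_st W T b t \<omega> = y t \<omega> + W T \<omega> * h t"
    using w_AE
  proof eventually_elim
    case (elim \<omega>)
    show ?case
    proof
      fix t assume t: "t \<in> {0..T}"
      show "bridge_st W T b t \<omega> = y t \<omega> + W T \<omega> * h t"
      proof (cases "t < T")
        case True
        define r where "r = t * T / (T - t)"
        define a where "a = (T - t) / T"
        have r: "0 \<le> r" using t T True by (auto simp: r_def)
        have "a * min r T = min (a * r) (a * T)" using True T by (simp add: a_def min_mult_distrib_left)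
        hence am: "a * min r T = min t (T - t)" using True T by (simp add: a_def r_def)
        have "V T r \<omega> = W r \<omega> - min r T / T * W T \<omega>"
          using elim r T by (simp add: V_def)
        hence "a * V T r \<omega> = a * W r \<omega> - (a * min r T) / T * W T \<omega>"
          by (simp add: right_diff_distrib)
        thus ?thesis using True unfolding am
          by (simp add: bridge_st_def y_def h_def a_def r_def)
      next
        case False
        hence "t = T" using t by simp
        thus ?thesis using T by (simp add: bridge_st_def y_def h_def)
      qed
    qed
  qed
  have v: "has_bochner_integral M (\<lambda>\<omega>. ((V T t \<omega> + d * (t / T)) - (y t \<omega> + d * h t))\<^sup>2) (v t)" if t: "0 \<le> t" "t < T" for t
  proof -
    let ?G = "\<lambda>\<omega>. V T t \<omega> - (T - t) / T * V T (t * T / (T - t)) \<omega>"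
    define m where "m = d * (max 0 (2 * t - T) / T) - b * (t / T)"
    have "has_bochner_integral M ?G (0 - (T - t) / T * 0)"
      by (intro has_bochner_integral_diff has_bochner_integral_mult_right V_mean T)
    hence "has_bochner_integral M (\<lambda>\<omega>. (?G \<omega> + m)\<^sup>2) (t\<^sup>2 / T - (max 0 (2 * t - T))\<^sup>2 / T + m\<^sup>2)"
      by (intro has_bochner_integral_square_shift space_time_error_variance T t) simp
    moreover have "m\<^sup>2 = (b * (t / T) - d * (max 0 (2 * t - T) / T))\<^sup>2"
      unfolding m_def by (rule power2_commute)
    moreover have "(V T t \<omega> + d * (t / T)) - (y t \<omega> + d * h t) = ?G \<omega> + m" for \<omega>
    proof -
      have "t / T - h t = max 0 (2 * t - T) / T"
        unfolding h_def diff_divide_distrib[symmetric] by (rule arg_cong[where f="\<lambda>x. x / T"]) auto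
      hence "d * (t / T) - d * h t = d * (max 0 (2 * t - T) / T)" by (simp only: right_diff_distrib[symmetric])
      thus ?thesis using t by (simp add: y_def m_def)
    qed
    ultimately show ?thesis by (simp only: v_def)
  qed
  note sq = has_cond_expectation_square[where y=y and h=h and B="bridge_st W T b" and d=d and v=v, OF T ym yc h B v]
  show "has_cond_expectation M T W (bridge_st W T b) (\<lambda>w y. (w t - y t)\<^sup>2) d (v t)" if "0 \<le> t" "t < T" for t
    by (rule sq(1)[OF _ _ _ that])
  show "has_cond_expectation M T W (bridge_st W T b) (\<lambda>w y. LBINT t:{0..T}. (w t - y t)\<^sup>2) d
      (1 / 6 * (d - b)\<^sup>2 * T + 1 / 6 * b\<^sup>2 * T - 1 / 12 * d * b * T + 1 / 6 * T\<^sup>2)"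
  proof (rule sq(2))
    show "continuous_on {0..T} v" unfolding v_def using T by (intro continuous_intros) auto
    show "(v has_integral 1 / 6 * (d - b)\<^sup>2 * T + 1 / 6 * b\<^sup>2 * T - 1 / 12 * d * b * T + 1 / 6 * T\<^sup>2) {0..T}"
      unfolding v_def by (rule integral_st_error[OF T])
  qed auto
qed

lemma J_mean:
  assumes "r < T" shows "has_bochner_integral M (J T r) 0"
proof -
  have bd: "(\<integral>\<omega>. \<bar>w s \<omega>\<bar> \<partial>M) \<le> r + 1" if s: "0 \<le> s" "s \<le> r" for s
  proof -
    have "(\<integral>\<omega>. \<bar>w s \<omega>\<bar> \<partial>M) \<le> (\<integral>\<omega>. w s \<omega> * w s \<omega> + 1 \<partial>M)"
    proof (rule integral_mono)
      show "integrable M (\<lambda>\<omega>. \<bar>w s \<omega>\<bar>)" using w_mean[of s] s by (auto simp: has_bochner_integral_iff)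
      show "integrable M (\<lambda>\<omega>. w s \<omega> * w s \<omega> + 1)" using w_covariance[of s s] s by (auto simp: has_bochner_integral_iff)
      fix \<omega>
      have "0 \<le> (\<bar>w s \<omega>\<bar> - 1)\<^sup>2" by simp
      hence "2 * \<bar>w s \<omega>\<bar> \<le> w s \<omega> * w s \<omega> + 1" by (simp add: power2_eq_square algebra_simps)
      thus "\<bar>w s \<omega>\<bar> \<le> w s \<omega> * w s \<omega> + 1" by linarith
    qed
    also have "\<dots> = s + 1" using w_covariance[of s s] s by (simp add: has_bochner_integral_iff prob_space)
    finally show ?thesis using s by simp
  qed
  have "has_bochner_integral M (\<lambda>\<omega>. wint T (\<lambda>s. w s \<omega>) r) (wint T (\<lambda>s. 0) r)"
    by (rule has_bochner_integral_wint[OF w_joint_measurable])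
      (use assms bd w_mean in \<open>auto intro!: w_continuous_on\<close>)
  thus ?thesis by (simp add: wint_def)
qed

lemma V_eq: "0 < T \<Longrightarrow> s \<in> {0..T} \<Longrightarrow> V T s \<omega> = w s \<omega> - s / T * w T \<omega>"
  by (auto simp: V_def)

lemma wint_V:
  assumes T: "0 < T" and t: "0 \<le> t" "t < T" and \<omega>: "\<omega> \<in> space M"
  shows "wint T (\<lambda>s. V T s \<omega>) t = J T t \<omega> - wint T (\<lambda>s. s) t / T * w T \<omega>"
proof -
  have "wint T (\<lambda>s. V T s \<omega>) t = wint T (\<lambda>s. w s \<omega> + (- w T \<omega> / T) * s) t"
    by (rule wint_cong) (use T t V_eq in auto)
  also have "\<dots> = J T t \<omega> + (- w T \<omega> / T) * wint T (\<lambda>s. s) t"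
    by (rule wint_linear) (use t \<omega> in \<open>auto intro!: w_continuous_on continuous_intros\<close>)
  finally show ?thesis by simp
qed

text \<open>
  By \<open>wint_V\<close> the error is the weighted integral of \<open>w\<close> minus its regression on \<open>w\<^sub>T\<close>, so its second
  moment is that of the weighted integral minus the squared covariance with \<open>w\<^sub>T\<close> divided by \<open>T\<close>.
\<close>

lemma integral_representation_error_moments:
  assumes T: "0 < T" and t: "0 \<le> t" "t < T"
  defines "\<eta> \<equiv> (T - t) / T * ln ((T - t) / T)"
  shows "has_bochner_integral M (\<lambda>\<omega>. (T - t) * wint T (\<lambda>s. V T s \<omega>) t) 0"
    and "has_bochner_integral M (\<lambda>\<omega>. ((T - t) * wint T (\<lambda>s. V T s \<omega>) t)\<^sup>2) (2 * t * ((T - t) / T) + 2 * (T - t) * \<eta> - T * \<eta>\<^sup>2)"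
proof -
  let ?A = "wint T (\<lambda>s. s) t"
  have "has_bochner_integral M (\<lambda>\<omega>. (T - t) * (J T t \<omega> - ?A / T * w T \<omega>)) ((T - t) * (0 - ?A / T * 0))"
    using t T by (intro has_bochner_integral_diff has_bochner_integral_mult_right J_mean w_mean) auto
  thus "has_bochner_integral M (\<lambda>\<omega>. (T - t) * wint T (\<lambda>s. V T s \<omega>) t) 0"
    using wint_V[OF T t] by (simp cong: has_bochner_integral_cong)
  have min: "wint T (\<lambda>s. min s T) t = ?A" by (rule wint_cong) (use t in auto)
  have "has_bochner_integral M (\<lambda>\<omega>. (T - t)\<^sup>2 * ((J T t \<omega>)\<^sup>2 - (2 * (?A / T)) * (J T t \<omega> * w T \<omega>) + (?A / T)\<^sup>2 * (w T \<omega> * w T \<omega>)))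
     ((T - t)\<^sup>2 * (2 * wint T (wint T (\<lambda>s. s)) t - (2 * (?A / T)) * wint T (\<lambda>s. min s T) t + (?A / T)\<^sup>2 * min T T))"
    using t T by (intro has_bochner_integral_add has_bochner_integral_diff has_bochner_integral_mult_right J_square J_w_product w_covariance) auto
  also have "(T - t)\<^sup>2 * (2 * wint T (wint T (\<lambda>s. s)) t - (2 * (?A / T)) * wint T (\<lambda>s. min s T) t + (?A / T)\<^sup>2 * min T T)
      = 2 * t * ((T - t) / T) + 2 * (T - t) * \<eta> - T * \<eta>\<^sup>2"
  proof -
    define p where "p = T - t"
    have p: "0 < p" "t = T - p" using t by (auto simp: p_def)
    have A: "p * ?A = t + T * \<eta>"
      using wint_identity[of t T] t T p(1) unfolding \<eta>_def p_def[symmetric] by (simp add: distrib_left)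
    have "p\<^sup>2 * (2 * (?A / p - t\<^sup>2 / (2 * T * p\<^sup>2)) - 2 * (?A / T) * ?A + (?A / T)\<^sup>2 * T)
        = 2 * (p * ?A) - t\<^sup>2 / T - (p * ?A)\<^sup>2 / T"
      using p(1) T by (simp add: field_simps power2_eq_square)
    also have "\<dots> = 2 * t * (p / T) + 2 * p * \<eta> - T * \<eta>\<^sup>2"
      unfolding A using T by (simp add: p_def field_simps power2_eq_square)
    finally show ?thesis
      unfolding wint_wint_identity[OF t] min p_def[symmetric] by simp
  qed
  finally have "has_bochner_integral M (\<lambda>\<omega>. (T - t)\<^sup>2 * ((J T t \<omega>)\<^sup>2 - (2 * (?A / T)) * (J T t \<omega> * w T \<omega>) + (?A / T)\<^sup>2 * (w T \<omega> * w T \<omega>)))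
      (2 * t * ((T - t) / T) + 2 * (T - t) * \<eta> - T * \<eta>\<^sup>2)" .
  moreover have "(T - t)\<^sup>2 * ((J T t \<omega>)\<^sup>2 - (2 * (?A / T)) * (J T t \<omega> * w T \<omega>) + (?A / T)\<^sup>2 * (w T \<omega> * w T \<omega>))
      = ((T - t) * wint T (\<lambda>s. V T s \<omega>) t)\<^sup>2" if "\<omega> \<in> space M" for \<omega>
  proof -
    have "q\<^sup>2 * (x\<^sup>2 - (2 * c) * (x * z) + c\<^sup>2 * (z * z)) = (q * (x - c * z))\<^sup>2" for q x c z :: real
      by (simp add: power2_eq_square algebra_simps)
    thus ?thesis by (simp only: wint_V[OF T t that])
  qed
  ultimately show "has_bochner_integral M (\<lambda>\<omega>. ((T - t) * wint T (\<lambda>s. V T s \<omega>) t)\<^sup>2) (2 * t * ((T - t) / T) + 2 * (T - t) * \<eta> - T * \<eta>\<^sup>2)"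
    by (subst (asm) has_bochner_integral_cong[OF refl _ refl]) auto
qed

text \<open>
  The representation holds almost surely at each time, hence at all rational times simultaneously, and
  then at all times before \<open>T\<close> because both sides are continuous there.
\<close>

lemma bridge_ir_pathwise:
  assumes T: "0 < T" and ir: "is_bridge_ir M W T b Wir"
  shows "AE \<omega> in M. \<forall>t\<in>{0..T}. Wir t \<omega> = b * (t / T) + bridge_op T (\<lambda>s. w s \<omega>) t"
proof -
  have each: "AE \<omega> in M. Wir t \<omega> = b * (t / T) + bridge_op T (\<lambda>s. w s \<omega>) t" if t: "t \<in> {0..<T}" for t
  proof -
    obtain I where I: "has_wiener_integral M W (\<lambda>s. (T - t) / (T - s)) 0 t I" "\<forall>\<omega>\<in>space M. Wir t \<omega> = b * (t / T) + I \<omega>"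
      using ir t unfolding is_bridge_ir_def by blast
    have "AE \<omega> in M. I \<omega> = w t \<omega> - (T - t) * J T t \<omega>"
      by (rule wiener_integral_by_parts[OF _ _ I(1)]) (use t in auto)
    with AE_space show ?thesis
      by eventually_elim (use I(2) t in \<open>auto simp: bridge_op_def\<close>)
  qed
  have "AE \<omega> in M. \<forall>t\<in>\<rat> \<inter> {0..<T}. Wir t \<omega> = b * (t / T) + bridge_op T (\<lambda>s. w s \<omega>) t"
    using each by (intro AE_ball_countable[THEN iffD2] ballI) (auto intro: countable_Int1 countable_rat)
  moreover have "AE \<omega> in M. continuous_on {0..<T} (\<lambda>t. Wir t \<omega>)"
    using ir unfolding is_bridge_ir_def by blast
  ultimately show ?thesis using AE_space
  proof eventually_elim
    case (elim \<omega>)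
    let ?g = "\<lambda>t. Wir t \<omega> - (b * (t / T) + bridge_op T (\<lambda>s. w s \<omega>) t)"
    have bc: "continuous_on {0..<T} (bridge_op T (\<lambda>s. w s \<omega>))"
      by (rule continuous_on_subset[OF bridge_op_continuous_on[OF w_continuous_on[OF elim(3)] T]]) auto
    have gc: "continuous_on {0..<T} ?g"
      using T by (intro continuous_intros elim(2) bc) auto
    have "?g t = 0" if t: "t \<in> {0..<T}" for t
    proof (rule ccontr)
      assume "?g t \<noteq> 0"
      then obtain e where e: "0 < e" "\<And>s. s \<in> {0..<T} \<Longrightarrow> dist s t < e \<Longrightarrow> dist (?g s) (?g t) < \<bar>?g t\<bar>"
        using gc t unfolding continuous_on_iff by (metis zero_less_abs_iff)
      obtain s where s: "s \<in> \<rat>" "t < s" "s < min T (t + e)"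
        using Rats_dense_in_real[of t "min T (t + e)"] t e(1) by auto
      have "?g s = 0" using elim(1) s t by auto
      moreover have "dist (?g s) (?g t) < \<bar>?g t\<bar>"
        using s t by (intro e(2)) (auto simp: dist_real_def)
      ultimately show False by (simp add: dist_real_def)
    qed
    moreover have "Wir T \<omega> = b" using ir elim(3) unfolding is_bridge_ir_def by blast
    ultimately show ?case
      using T by (auto simp: bridge_op_def less_eq_real_def)
  qed
qed

lemma conditional_error_ir:
  fixes T b d :: real
  assumes T: "0 < T" and ir: "is_bridge_ir M W T b Wir"
  defines "\<eta> \<equiv> \<lambda>t. (T - t) / T * ln ((T - t) / T)"
  defines "v \<equiv> \<lambda>t. 2 * t * ((T - t) / T) + 2 * (T - t) * \<eta> t - T * (\<eta> t)\<^sup>2 + ((d - b) * (t / T) + d * \<eta> t)\<^sup>2"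
  shows "\<And>t. 0 \<le> t \<Longrightarrow> t < T \<Longrightarrow> has_cond_expectation M T W Wir (\<lambda>w y. (w t - y t)\<^sup>2) d (v t)"
    and "has_cond_expectation M T W Wir (\<lambda>w y. LBINT t:{0..T}. (w t - y t)\<^sup>2) d
      (7 / 54 * (b - d)\<^sup>2 * T + 11 / 54 * b\<^sup>2 * T - 7 / 54 * d * b * T + 1 / 27 * T\<^sup>2)"
proof -
  define y where "y = (\<lambda>t \<omega>. bridge_op T (\<lambda>s. V T s \<omega>) t + b * (t / T))"
  define h where "h = bridge_op T (\<lambda>s. s / T)"
  have ym: "y t \<in> borel_measurable (bridge_algebra T)" for t
  proof (cases "t < T")
    case True
    have "(\<lambda>\<omega>. wint T (\<lambda>s. V T s \<omega>) t) \<in> borel_measurable (bridge_algebra T)"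
      by (rule measurable_wint[OF V_measurable_bridge_algebra]) (use True T V_continuous in auto)
    hence "(\<lambda>\<omega>. (V T t \<omega> - (T - t) * wint T (\<lambda>s. V T s \<omega>) t) + b * (t / T)) \<in> borel_measurable (bridge_algebra T)"
      by (intro borel_measurable_add borel_measurable_diff borel_measurable_times borel_measurable_const V_measurable_bridge_algebra)
    thus ?thesis using True by (simp add: y_def bridge_op_def)
  qed (simp add: y_def bridge_op_def)
  have yc: "continuous_on {0..T} (\<lambda>t. y t \<omega>)" if "\<omega> \<in> space M" for \<omega>
    unfolding y_def using T by (intro continuous_on_add bridge_op_continuous_on V_continuous that continuous_intros) auto
  have h: "continuous_on {0..T} h" unfolding h_def using T by (intro bridge_op_continuous_on continuous_intros) auto
  have B: "AE \<omega> in M. \<forall>t\<in>{0..T}. Wir t \<omega> = y t \<omega> + W T \<omega> * h t"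
    using bridge_ir_pathwise[OF T ir] w_AE AE_space
  proof eventually_elim
    case (elim \<omega>)
    show ?case
    proof
      fix t assume t: "t \<in> {0..T}"
      have "bridge_op T (\<lambda>s. w s \<omega>) t = bridge_op T (\<lambda>s. V T s \<omega> + w T \<omega> * (s / T)) t"
      proof -
        have "wint T (\<lambda>s. w s \<omega>) t = wint T (\<lambda>s. V T s \<omega> + w T \<omega> * (s / T)) t"
          by (rule wint_cong) (use t T V_eq in auto)
        thus ?thesis using t T V_eq[of T t \<omega>] by (simp add: bridge_op_def)
      qed
      also have "\<dots> = bridge_op T (\<lambda>s. V T s \<omega>) t + w T \<omega> * h t"
        unfolding h_def by (rule bridge_op_linear) (use t T V_continuous elim(3) in \<open>auto intro!: continuous_intros\<close>)
      finally show "Wir t \<omega> = y t \<omega> + W T \<omega> * h t"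
        using elim(1,2) t T by (simp add: y_def)
    qed
  qed
  have v: "has_bochner_integral M (\<lambda>\<omega>. ((V T t \<omega> + d * (t / T)) - (y t \<omega> + d * h t))\<^sup>2) (v t)" if t: "0 \<le> t" "t < T" for t
  proof -
    define m where "m = (d - b) * (t / T) + d * \<eta> t"
    have "has_bochner_integral M (\<lambda>\<omega>. ((T - t) * wint T (\<lambda>s. V T s \<omega>) t + m)\<^sup>2)
        (2 * t * ((T - t) / T) + 2 * (T - t) * \<eta> t - T * (\<eta> t)\<^sup>2 + m\<^sup>2)"
      using integral_representation_error_moments[OF T t] unfolding \<eta>_def
      by (intro has_bochner_integral_square_shift)
    moreover have "(V T t \<omega> + d * (t / T)) - (y t \<omega> + d * h t) = (T - t) * wint T (\<lambda>s. V T s \<omega>) t + m" for \<omega>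
    proof -
      have "h t = - \<eta> t" unfolding h_def \<eta>_def using bridge_op_linear_path[of T t] t T by simp
      thus ?thesis using t by (simp add: y_def m_def bridge_op_def left_diff_distrib diff_divide_distrib)
    qed
    ultimately show ?thesis by (simp only: v_def m_def)
  qed
  note sq = has_cond_expectation_square[where y=y and h=h and B=Wir and d=d and v=v, OF T ym yc h B v]
  show "has_cond_expectation M T W Wir (\<lambda>w y. (w t - y t)\<^sup>2) d (v t)" if "0 \<le> t" "t < T" for t
    by (rule sq(1)[OF _ _ _ that])
  show "has_cond_expectation M T W Wir (\<lambda>w y. LBINT t:{0..T}. (w t - y t)\<^sup>2) d
      (7 / 54 * (b - d)\<^sup>2 * T + 11 / 54 * b\<^sup>2 * T - 7 / 54 * d * b * T + 1 / 27 * T\<^sup>2)"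
    by (rule sq(2)) (use integral_ir_error[OF T, where b=b and d=d] in \<open>auto simp: v_def \<eta>_def\<close>)
qed

end

theorem theorem2p7:
  fixes M :: "'a measure" and W Wir :: "real \<Rightarrow> 'a \<Rightarrow> real" and T b :: real
  assumes "wiener_process M W"
    and "T > 0"
    and "is_bridge_ir M W T b Wir"
  shows
    "(\<forall>t\<in>{0..<T}. \<forall>d :: real.
        has_cond_expectation M T W (bridge_av W T b) (\<lambda>w y. (w t - y t)\<^sup>2) d
          ((d - b)\<^sup>2 * (t\<^sup>2 / T\<^sup>2)) \<and>
        has_cond_expectation M T W Wir (\<lambda>w y. (w t - y t)\<^sup>2) d
          (2 * t * ((T - t) / T) + 2 * ((T - t)\<^sup>2 / T) * ln ((T - t) / T)
           - (T - t)\<^sup>2 / T * (ln ((T - t) / T))\<^sup>2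
           + ((d - b) * (t / T) + d * ((T - t) / T) * ln ((T - t) / T))\<^sup>2) \<and>
        has_cond_expectation M T W (bridge_st W T b) (\<lambda>w y. (w t - y t)\<^sup>2) d
          (t\<^sup>2 / T - (2 * t - T)\<^sup>2 / T * indicator {T / 2..<T} t
           + (b * (t / T) - d * ((2 * t - T) / T) * indicator {T / 2..<T} t)\<^sup>2)) \<and>
     (\<forall>d :: real.
        has_cond_expectation M T W (bridge_av W T b) (\<lambda>w y. LBINT t:{0..T}. (w t - y t)\<^sup>2) d
          (1 / 3 * (d - b)\<^sup>2 * T) \<and>
        has_cond_expectation M T W Wir (\<lambda>w y. LBINT t:{0..T}. (w t - y t)\<^sup>2) d
          (7 / 54 * (b - d)\<^sup>2 * T + 11 / 54 * b\<^sup>2 * T - 7 / 54 * d * b * T + 1 / 27 * T\<^sup>2) \<and>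
        has_cond_expectation M T W (bridge_st W T b) (\<lambda>w y. LBINT t:{0..T}. (w t - y t)\<^sup>2) d
          (1 / 6 * (d - b)\<^sup>2 * T + 1 / 6 * b\<^sup>2 * T - 1 / 12 * d * b * T + 1 / 6 * T\<^sup>2))"
proof -
  interpret wiener_process M W by fact
  obtain w where "continuous_wiener M W w" by (rule continuous_version)
  then interpret continuous_wiener M W w .
  note T = assms(2) and ir = assms(3)
  show ?thesis
  proof (intro conjI ballI allI)
    fix t d :: real assume "t \<in> {0..<T}"
    hence t: "0 \<le> t" "t < T" by auto
    show "has_cond_expectation M T W (bridge_av W T b) (\<lambda>w y. (w t - y t)\<^sup>2) d ((d - b)\<^sup>2 * (t\<^sup>2 / T\<^sup>2))"
      by (rule conditional_error_av(1)[OF T t])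
    have "2 * (T - t) * ((T - t) / T * ln ((T - t) / T)) = 2 * ((T - t)\<^sup>2 / T) * ln ((T - t) / T)"
      "T * ((T - t) / T * ln ((T - t) / T))\<^sup>2 = (T - t)\<^sup>2 / T * (ln ((T - t) / T))\<^sup>2"
      "d * ((T - t) / T * ln ((T - t) / T)) = d * ((T - t) / T) * ln ((T - t) / T)"
      using T by (simp_all add: power2_eq_square)
    with conditional_error_ir(1)[OF T ir t, of d]
    show "has_cond_expectation M T W Wir (\<lambda>w y. (w t - y t)\<^sup>2) d
          (2 * t * ((T - t) / T) + 2 * ((T - t)\<^sup>2 / T) * ln ((T - t) / T)
           - (T - t)\<^sup>2 / T * (ln ((T - t) / T))\<^sup>2
           + ((d - b) * (t / T) + d * ((T - t) / T) * ln ((T - t) / T))\<^sup>2)"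
      by (simp only:)
    have "(max 0 (2 * t - T))\<^sup>2 / T = (2 * t - T)\<^sup>2 / T * indicator {T / 2..<T} t"
      "d * (max 0 (2 * t - T) / T) = d * ((2 * t - T) / T) * indicator {T / 2..<T} t"
      using t by (auto simp: indicator_def max_def)
    with conditional_error_st(1)[OF T t, of b d]
    show "has_cond_expectation M T W (bridge_st W T b) (\<lambda>w y. (w t - y t)\<^sup>2) d
          (t\<^sup>2 / T - (2 * t - T)\<^sup>2 / T * indicator {T / 2..<T} t
           + (b * (t / T) - d * ((2 * t - T) / T) * indicator {T / 2..<T} t)\<^sup>2)"
      by (simp only:)
  qed (rule conditional_error_av(2)[OF T] conditional_error_ir(2)[OF T ir] conditional_error_st(2)[OF T])+
qed

end
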